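(* Assume the following. (1) For $\mu$-a.e. $s\in E$, the operator $A(s,\cdot)$ is maximal monotone; and for every $\lambda>0$ and $x\in\mathcal H$, the map $s\mapsto J_\lambda(s,x)$ is $\mathcal E/\mathcal B(\mathcal H)$-measurable. (2) $(\lambda_n)_{n\in\mathbb N}$ is a sequence of positive reals with $\sum_n\lambda_n=+\infty$ and $\sum_n\lambda_n^2<\infty$; the random variables $(\xi_n)_{n\ge1}$ are independent and identically distributed with distribution $\mu$. (3) The monotone operator $\underline A$ is maximal. (4) $\mathrm{zer}(\underline A)\neq\emptyset$ and $\mathrm{zer}(\underline A)\subset \mathcal Z_A(2)$. (5) For every bounded set $K\subset\mathcal H$, the family of functions $(\|A_0(\cdot,x)\|: x\in K\cap\mathcal D)$ is uniformly integrable with respect to $\mu$. (6) For every $M>0$ there exists $\kappa_M>0$ such that for all $x\in\mathcal H$ with $\|x\|\le M$, $\int d(x,D_s)^2\,d\mu(s)\ge \kappa_M\, d(x,\mathcal D)^2$. (7) There exist an integer $p\ge1$ and a function $C\in L^2(E,\mathbb R_+,\mu)$ such that for all $x\in\mathcal H$ and $\lambda>0$, $\|J_\lambda(s,x)-\Pi(s,x)\|\le \lambda\, C(s)(1+\|x\|^p)$ for $\mu$-a.e. $s$, and $\mathcal Z_A(2p)\neq\emptyset$. Assume moreover that $\lambda_n/\lambda_{n+1}\to1$ as $n\to\infty$. Let $x_0\in\mathcal H$ be fixed and let $(x_n)$ be the random sequence defined by $x_{n+1}=J_{\lambda_n}(\xi_{n+1},x_n)$, $n\in\mathbb N$, with weighted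 averages $\overline x_n=\sum_{k=1}^n\lambda_kx_k/\sum_{k=1}^n\lambda_k$. Then, almost surely, $(\overline x_n)$ converges weakly to a zero of $\underline A$.
   Context: $(E,\mathcal E,\mu)$ is a complete probability space, $\mathcal H$ is a separable Hilbert space with Borel $\sigma$-algebra $\mathcal B(\mathcal H)$, $A:E\times\mathcal H\to2^{\mathcal H}$ is a set-valued mapping, $(\Omega,\mathcal F,\mathbb P)$ is a probability space and $\xi_n:\Omega\to E$ ($n\ge1$) are random variables. For $\lambda>0$, $J_\lambda(s,x)=(I+\lambda A(s,\cdot))^{-1}(x)$ is the resolvent (single-valued and defined on all of $\mathcal H$ whenever $A(s,\cdot)$ is maximal monotone). $D_s=\mathrm{dom}(A(s,\cdot))=\{x: A(s,x)\ne\emptyset\}$. The essential intersection $\mathcal D$ of the domains is the set of $x\in\mathcal H$ such that $x\in D_s$ for all $s$ outside some $\mu$-negligible set (depending on $x$). $\Pi(s,x)$ is the projection of $x$ onto the closure $\mathrm{cl}(D_s)$. $d(x,Q)=\inf_{y\in Q}\|x-y\|$, equal to $+\infty$ if $Q=\emptyset$. For $x\in D_s$, $A_0(s,x)$ is the element of least norm of $A(s,x)$. For $x\in\mathcal H$ and $p\ge1$, $S_A^p(x)$ is the set of measurable functions $\phi:E\to\mathcal H$ with $\phi(s)\in A(s,x)$ for $\mu$-a.e. $s$ and $\int\|\phi\|^p d\mu<\infty$. The mean operator is the Aumann integral $\underline A(x)=\int A(s,x)\,d\mu(s)=\{\int\phi\,d\mu:\phi\in S_A^1(x)\}$ (Bochner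 integrals). $\mathrm{zer}(\underline A)=\{x: 0\in\underline A(x)\}$ and $\mathcal Z_A(p)=\{x\in\mathcal H:\exists\phi\in S_A^p(x),\ \int\phi\,d\mu=0\}$. A family $(f_i)_{i\in I}$ of ($\mu$-a.e. defined) measurable functions $E\to\mathbb R_+$ is uniformly integrable if $\lim_{a\to+\infty}\sup_i\int_{\{f_i>a\}}f_i\,d\mu=0$. *)

theory Defs
  imports "HOL-Probability.Probability"
begin

definition op_dom :: "('h \<Rightarrow> 'h set) \<Rightarrow> 'h set" where
  "op_dom B = {x. B x \<noteq> {}}"

definition zer :: "('h::zero \<Rightarrow> 'h set) \<Rightarrow> 'h set" where
  "zer B = {x. 0 \<in> B x}"

definition monotone_operator :: "('h::real_inner \<Rightarrow> 'h set) \<Rightarrow> bool" where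
  "monotone_operator B \<longleftrightarrow>
     (\<forall>x y. \<forall>u\<in>B x. \<forall>v\<in>B y. (u - v) \<bullet> (x - y) \<ge> 0)"

definition maximal_monotone :: "('h::real_inner \<Rightarrow> 'h set) \<Rightarrow> bool" where
  "maximal_monotone B \<longleftrightarrow>
     monotone_operator B \<and> (\<forall>B'. monotone_operator B' \<and> (\<forall>x. B x \<subseteq> B' x) \<longrightarrow> B' = B)"

text \<open>
  The definite descriptions in \<open>resolvent\<close> and \<open>least_norm_elem\<close> are meaningful when \<open>B\<close> is
  maximal monotone (and, for the latter, when \<open>B x\<close> is nonempty), and the one in \<open>proj\<close> when \<open>S\<close>
  is a nonempty closed convex set.  For a random operator that is maximal monotone almost
  everywhere, the arbitrary values occur only on a null set.
\<close>

definition resolvent :: "('h::real_inner \<Rightarrow> 'h set) \<Rightarrow> real \<Rightarrow> 'h \<Rightarrow> 'h" where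
  "resolvent B l x = (THE y. \<exists>u\<in>B y. x = y + l *\<^sub>R u)"

definition least_norm_elem :: "('h::real_inner \<Rightarrow> 'h set) \<Rightarrow> 'h \<Rightarrow> 'h" where
  "least_norm_elem B x = (THE u. u \<in> B x \<and> (\<forall>v\<in>B x. norm u \<le> norm v))"

text \<open>The library's \<open>closest_point\<close> is restricted to \<open>heine_borel\<close>, i.e. to finite dimension.\<close>

definition proj :: "'h::real_inner set \<Rightarrow> 'h \<Rightarrow> 'h" where
  "proj S x = (THE y. y \<in> S \<and> (\<forall>z\<in>S. norm (x - y) \<le> norm (x - z)))"

text \<open>Unlike \<open>infdist\<close>, the distance to the empty set is \<open>\<infinity>\<close>.\<close>

definition dist_set :: "'h::real_normed_vector \<Rightarrow> 'h set \<Rightarrow> ennreal" where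
  "dist_set x Q = (INF y\<in>Q. ennreal (norm (x - y)))"

definition ess_dom :: "'s measure \<Rightarrow> ('s \<Rightarrow> 'h \<Rightarrow> 'h set) \<Rightarrow> 'h set" where
  "ess_dom M A = {x. AE s in M. x \<in> op_dom (A s)}"

definition selections ::
  "'s measure \<Rightarrow> ('s \<Rightarrow> 'h \<Rightarrow> 'h::{real_inner, banach, second_countable_topology} set)
     \<Rightarrow> nat \<Rightarrow> 'h \<Rightarrow> ('s \<Rightarrow> 'h) set" where
  "selections M A p x =
     {\<phi> \<in> borel_measurable M. (AE s in M. \<phi> s \<in> A s x) \<and> integrable M (\<lambda>s. norm (\<phi> s) ^ p)}"

definition mean_operator ::
  "'s measure \<Rightarrow> ('s \<Rightarrow> 'h \<Rightarrow> 'h::{real_inner, banach, second_countable_topology} set)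
     \<Rightarrow> 'h \<Rightarrow> 'h set" where
  "mean_operator M A x = {(\<integral>s. \<phi> s \<partial>M) |\<phi>. \<phi> \<in> selections M A 1 x}"

definition zer_sel ::
  "'s measure \<Rightarrow> ('s \<Rightarrow> 'h \<Rightarrow> 'h::{real_inner, banach, second_countable_topology} set)
     \<Rightarrow> nat \<Rightarrow> 'h set" where
  "zer_sel M A p = {x. \<exists>\<phi>\<in>selections M A p x. (\<integral>s. \<phi> s \<partial>M) = 0}"

definition uniformly_integrable :: "'s measure \<Rightarrow> 'i set \<Rightarrow> ('i \<Rightarrow> 's \<Rightarrow> real) \<Rightarrow> bool" where
  "uniformly_integrable M I f \<longleftrightarrow>
     (\<forall>i\<in>I. f i \<in> borel_measurable M) \<and>
     ((\<lambda>a. SUP i\<in>I. \<integral>\<^sup>+s\<in>{s. f i s > a}. ennreal (f i s) \<partial>M) \<longlongrightarrow> 0) at_top"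

definition weakly_converges :: "(nat \<Rightarrow> 'h::real_inner) \<Rightarrow> 'h \<Rightarrow> bool" where
  "weakly_converges X z \<longleftrightarrow> (\<forall>y. (\<lambda>n. X n \<bullet> y) \<longlonglongrightarrow> z \<bullet> y)"

primrec prox_iter ::
  "('s \<Rightarrow> 'h \<Rightarrow> 'h set) \<Rightarrow> (nat \<Rightarrow> real) \<Rightarrow> (nat \<Rightarrow> 'w \<Rightarrow> 's) \<Rightarrow> 'h::real_inner
     \<Rightarrow> nat \<Rightarrow> 'w \<Rightarrow> 'h" where
  "prox_iter A lam \<xi> x0 0 \<omega> = x0"
| "prox_iter A lam \<xi> x0 (Suc n) \<omega> =
     resolvent (A (\<xi> (Suc n) \<omega>)) (lam n) (prox_iter A lam \<xi> x0 n \<omega>)"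

definition prox_avg ::
  "('s \<Rightarrow> 'h \<Rightarrow> 'h set) \<Rightarrow> (nat \<Rightarrow> real) \<Rightarrow> (nat \<Rightarrow> 'w \<Rightarrow> 's) \<Rightarrow> 'h::real_inner
     \<Rightarrow> nat \<Rightarrow> 'w \<Rightarrow> 'h" where
  "prox_avg A lam \<xi> x0 n \<omega> =
     (\<Sum>k=1..n. lam k *\<^sub>R prox_iter A lam \<xi> x0 k \<omega>) /\<^sub>R (\<Sum>k=1..n. lam k)"

end

theory Submission
  imports Defs
begin

text \<open>
  Write \<open>T\<close> for the mean operator \<open>x \<mapsto> \<integral> A(s, x) d\<mu>(s)\<close>, \<open>x\<^sub>k\<close> for the iterates, \<open>y\<^sub>n\<close> for their weighted
  averages and \<open>D\<close> for the essential domain. Two things make \<open>(y\<^sub>n)\<close> converge weakly to a zero of \<open>T\<close>: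
  every weak cluster point is a zero, and there is only one.

  Uniqueness. Let \<open>z\<close> be a zero with a square integrable selection \<open>\<phi>\<close> of \<open>A(\<sqdot>, z)\<close> of mean \<open>0\<close>.
  Monotonicity alone gives (\<open>resolvent_step\<close>)
  \<open>\<parallel>x\<^sub>k\<^sub>+\<^sub>1 - z\<parallel>\<^sup>2 \<le> \<parallel>x\<^sub>k - z\<parallel>\<^sup>2 - 2 \<lambda>\<^sub>k \<langle>\<phi>(\<xi>\<^sub>k\<^sub>+\<^sub>1), x\<^sub>k - z\<rangle> + \<lambda>\<^sub>k\<^sup>2 \<parallel>\<phi>(\<xi>\<^sub>k\<^sub>+\<^sub>1)\<parallel>\<^sup>2\<close>.
  The inner products are martingale increments and \<open>\<Sum> \<lambda>\<^sub>k\<^sup>2 < \<infinity>\<close>, so both error series converge almost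
  surely, and hence so does \<open>\<parallel>x\<^sub>k - z\<parallel>\<close> (\<open>AE_dist_zero_converges\<close>). Expanding squares, \<open>\<langle>x\<^sub>k, z - z'\<rangle>\<close>
  converges for any two zeros, and so do its averages \<open>\<langle>y\<^sub>n, z - z'\<rangle>\<close>; two cluster points \<open>z, z'\<close> that are
  zeros must then coincide (\<open>Opial_Passty\<close>).

  Cluster points. As \<open>T\<close> is maximal, \<open>w\<close> is a zero as soon as \<open>\<langle>v, w - u\<rangle> \<le> 0\<close> for all \<open>(u, v)\<close> in the
  graph of \<open>T\<close>, and a countable dense set of pairs suffices. So one has to show
  \<open>limsup \<langle>v, y\<^sub>n - u\<rangle> \<le> 0\<close> almost surely for a fixed pair, where \<open>v = \<integral>\<phi> d\<mu>\<close> and \<open>\<phi>\<close> is a selection of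
  \<open>A(\<sqdot>, u)\<close>. If \<open>\<phi>\<close> were square integrable, summing the inequality above (with \<open>u\<close> for \<open>z\<close>) and
  dividing by \<open>\<Lambda>\<^sub>n = \<Sum>\<^sub>k \<lambda>\<^sub>k\<close> would do. In general \<open>\<phi>\<close> is only integrable and is truncated at a
  height \<open>c\<close>. At a draw with \<open>\<parallel>\<phi>(\<xi>\<^sub>k\<^sub>+\<^sub>1)\<parallel> > c\<close> the inequality is replaced by the bound
  \<open>O(\<parallel>x\<^sub>k - x\<^sub>k\<^sub>+\<^sub>1\<parallel>)\<close> on the increase of the squared distance, and the comparison of resolvents with
  projections bounds such a step by \<open>d(x\<^sub>k, D) + \<lambda>\<^sub>k C(\<xi>\<^sub>k\<^sub>+\<^sub>1) (1 + \<parallel>x\<^sub>k\<parallel>\<^sup>p)\<close> (\<open>resolvent_displacement\<close>).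

  What is left is to compare \<open>d(x\<^sub>k, D)\<close> with the step sizes. One step of the algorithm is within
  \<open>O(\<lambda>\<^sub>k)\<close> of a projection onto the closure of a random domain, which brings the iterate closer to \<open>D\<close>,
  and the regularity of the domains turns this into a contraction of the mean square distance, up to
  an error of order \<open>\<lambda>\<^sub>k\<^sup>2\<close> (\<open>mean_infdist_contraction\<close>). It follows that \<open>\<Sum>\<^sub>k d(x\<^sub>k, D) = O(\<Lambda>\<^sub>n)\<close> almost
  surely (\<open>distance_to_domain\<close>), so that the draws with \<open>\<parallel>\<phi>\<parallel> > c\<close> contribute to the averages at most a
  constant times \<open>\<mu>{\<parallel>\<phi>\<parallel> > c} + \<integral>\<^bsub>\<parallel>\<phi>\<parallel> > c\<^esub> C d\<mu>\<close> (\<open>truncated_test_pair\<close>). This vanishes as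
  \<open>c \<rightarrow> \<infinity>\<close> (\<open>test_pair_average\<close>).

  All of this presupposes that resolvents exist, which is Minty's theorem (\<open>monotone_graph_Minty\<close>,
  \<open>resolvent_inclusion\<close>).
\<close>

section \<open>Maximal monotone operators and their resolvents\<close>

text \<open>
  Minimizing sequences of a strongly convex functional satisfy the first hypothesis, with a multiple of
  the excess over the infimum for \<open>e\<close>: the value at a midpoint does not fall below the infimum.
\<close>

lemma sq_norm_midpoint_le_Cauchy:
  fixes c :: "nat \<Rightarrow> 'h::{real_inner, banach}"
  assumes mid: "\<And>i j. (norm (c i - c j))\<^sup>2 \<le> e i + e j"
    and e: "e \<longlonglongrightarrow> 0"
  obtains y where "c \<longlonglongrightarrow> y"
proof -
  have "Cauchy c"
  proof (rule metric_CauchyI)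
    fix r :: real assume r: "r > 0"
    then have "r\<^sup>2 / 2 > 0" by simp
    from order_tendstoD(2)[OF e this] obtain N where N: "\<And>n. n \<ge> N \<Longrightarrow> e n < r\<^sup>2 / 2"
      by (auto simp: eventually_sequentially)
    have "dist (c i) (c j) < r" if "i \<ge> N" "j \<ge> N" for i j
    proof -
      have "(norm (c i - c j))\<^sup>2 < r\<^sup>2"
        using mid[of i j] N[OF that(1)] N[OF that(2)] by simp
      then show ?thesis
        using r by (simp add: dist_norm power2_less_imp_less)
    qed
    then show "\<exists>N. \<forall>i\<ge>N. \<forall>j\<ge>N. dist (c i) (c j) < r" by blast
  qed
  then show ?thesis using that by (auto simp: Cauchy_convergent_iff convergent_def)
qed

text \<open>
  A monotone graph lies below its Fitzpatrick function. Monotonicity says that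
  \<open>a \<bullet> q + p \<bullet> b \<le> a \<bullet> b + p \<bullet> q\<close> for two points of the graph; both sides are affine in
  \<open>(a, b, a \<bullet> b)\<close> and in \<open>(p, q, p \<bullet> q)\<close>, so the inequality extends to the convex hull in each argument
  in turn, and on the diagonal it is the claim.
\<close>

lemma monotone_graph_hull:
  fixes G :: "('h::real_inner \<times> 'h) set"
  assumes mono: "\<And>a b a' b'. (a, b) \<in> G \<Longrightarrow> (a', b') \<in> G \<Longrightarrow> (b - b') \<bullet> (a - a') \<ge> 0"
    and mem: "(a, b, h) \<in> convex hull ((\<lambda>(a, b). (a, b, a \<bullet> b)) ` G)"
  shows "a \<bullet> b \<le> h"
proof -
  let ?K = "(\<lambda>(a, b). (a, b, a \<bullet> b)) ` G"
  have conv: "convex {(a, b, h). a \<bullet> q + p \<bullet> b \<le> h + r}" for p q :: 'h and r :: real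
  proof (rule convexI)
    fix x y :: "'h \<times> 'h \<times> real" and s t :: real
    assume x: "x \<in> {(a, b, h). a \<bullet> q + p \<bullet> b \<le> h + r}" and y: "y \<in> {(a, b, h). a \<bullet> q + p \<bullet> b \<le> h + r}"
      and st: "0 \<le> s" "0 \<le> t" "s + t = 1"
    obtain a b h a' b' h' where xy: "x = (a, b, h)" "y = (a', b', h')" by (cases x, cases y)
    have "s * (a \<bullet> q + p \<bullet> b) + t * (a' \<bullet> q + p \<bullet> b') \<le> s * (h + r) + t * (h' + r)"
      by (rule add_mono; rule mult_left_mono) (use x y st xy in auto)
    also have "\<dots> = s * h + t * h' + (s + t) * r" by (simp add: algebra_simps)
    finally show "s *\<^sub>R x + t *\<^sub>R y \<in> {(a, b, h). a \<bullet> q + p \<bullet> b \<le> h + r}"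
      using st unfolding xy by (simp add: inner_simps algebra_simps)
  qed
  have one: "a \<bullet> q + p \<bullet> b \<le> h + p \<bullet> q" if "(p, q) \<in> G" "(a, b, h) \<in> convex hull ?K" for a b h p q
  proof -
    have "convex hull ?K \<subseteq> {(a, b, h). a \<bullet> q + p \<bullet> b \<le> h + p \<bullet> q}"
    proof (rule hull_minimal)
      show "?K \<subseteq> {(a, b, h). a \<bullet> q + p \<bullet> b \<le> h + p \<bullet> q}"
        using mono[OF _ that(1)] by (auto simp: inner_simps algebra_simps inner_commute)
    qed (rule conv)
    with that show ?thesis by auto
  qed
  have "convex hull ?K \<subseteq> {(p, q, r). p \<bullet> b + a \<bullet> q \<le> r + h}"
  proof (rule hull_minimal)
    show "?K \<subseteq> {(p, q, r). p \<bullet> b + a \<bullet> q \<le> r + h}"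
      using one[OF _ mem] by (auto simp: algebra_simps)
  qed (rule conv)
  with mem show ?thesis by auto
qed

text \<open>
  The core of Minty's theorem. A solution \<open>y\<close> is a point common to the closed balls with centre
  \<open>(a - b)/2\<close> and radius \<open>\<parallel>a + b\<parallel>/2\<close>, since
  \<open>(b + y) \<bullet> (a - y) = \<parallel>a + b\<parallel>\<^sup>2/4 - \<parallel>y - (a - b)/2\<parallel>\<^sup>2\<close>. It is found as the centre of the minimizer
  of \<open>F(a, b, h) = h + \<parallel>a - b\<parallel>\<^sup>2/4\<close> over the convex hull of the points \<open>(a, b, a \<bullet> b)\<close>: there \<open>F\<close> is
  nonnegative, by the previous lemma, and strongly convex in the centre. Moving from a nearly minimal
  point a small way towards \<open>(a, b, a \<bullet> b)\<close> cannot decrease \<open>F\<close> below the infimum, and to first order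
  this says that \<open>y\<close> lies in the ball of \<open>(a, b)\<close>.
\<close>

lemma monotone_graph_Minty:
  fixes G :: "('h::{real_inner, banach} \<times> 'h) set"
  assumes mono: "\<And>a b a' b'. (a, b) \<in> G \<Longrightarrow> (a', b') \<in> G \<Longrightarrow> (b - b') \<bullet> (a - a') \<ge> 0"
  obtains y where "\<And>a b. (a, b) \<in> G \<Longrightarrow> (b + y) \<bullet> (a - y) \<ge> 0"
proof (cases "G = {}")
  case True
  then show ?thesis using that by blast
next
  case False
  define K where "K = convex hull ((\<lambda>(a, b). (a, b, a \<bullet> b)) ` G)"
  define ctr where "ctr = (\<lambda>(a, b, h::real). (1/2) *\<^sub>R (a - b) :: 'h)"
  define F where "F = (\<lambda>(a, b, h). h + (norm (ctr (a, b, h)))\<^sup>2)"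
  have K: "convex K" "\<And>a b. (a, b) \<in> G \<Longrightarrow> (a, b, a \<bullet> b) \<in> K"
    unfolding K_def using hull_subset[of "(\<lambda>(a, b). (a, b, a \<bullet> b)) ` G" convex] by auto
  have Fnn: "F k \<ge> 0" if "k \<in> K" for k
  proof -
    obtain a b h where k: "k = (a, b, h)" by (cases k)
    have "a \<bullet> b \<le> h" using monotone_graph_hull[OF mono] that unfolding k K_def by blast
    moreover have "a \<bullet> b + (norm (ctr k))\<^sup>2 = (norm ((1/2) *\<^sub>R (a + b)))\<^sup>2"
      unfolding power2_norm_eq_inner ctr_def k by (simp add: inner_simps inner_commute field_simps)
    ultimately show ?thesis
      unfolding F_def k by (smt (verit) case_prod_conv k zero_le_power2)
  qed
  \<comment> \<open>strong convexity: the last term is the gain\<close>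
  have Fconv: "F ((1 - t) *\<^sub>R k + t *\<^sub>R k') = (1 - t) * F k + t * F k' - t * (1 - t) * (norm (ctr k - ctr k'))\<^sup>2"
    for k k' t
    unfolding F_def ctr_def power2_norm_eq_inner
    by (cases k; cases k') (simp add: inner_simps inner_commute algebra_simps; simp add: field_simps)
  define m where "m = Inf (F ` K)"
  have bdd: "bdd_below (F ` K)" using Fnn by (auto intro: bdd_belowI[of _ 0])
  have m_le: "m \<le> F k" if "k \<in> K" for k
    unfolding m_def using bdd that by (auto intro: cInf_lower)
  have Kne: "F ` K \<noteq> {}" using False K(2) by fastforce
  have m0: "m \<ge> 0" unfolding m_def using Kne Fnn by (auto intro: cInf_greatest)
  have "\<exists>k\<in>K. F k < m + 1 / real (Suc n)" for n
    using cInf_lessD[OF Kne, of "m + 1 / real (Suc n)"] by (auto simp: m_def)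
  then obtain k where k: "\<And>n. k n \<in> K" "\<And>n. F (k n) < m + 1 / real (Suc n)" by metis
  have "(norm (ctr (k i) - ctr (k j)))\<^sup>2 \<le> 2 / real (Suc i) + 2 / real (Suc j)" for i j
  proof -
    have "(1 - 1/2) *\<^sub>R k i + (1/2) *\<^sub>R k j \<in> K"
      using K(1) k(1) by (intro convexD) auto
    from m_le[OF this] show ?thesis
      using k(2)[of i] k(2)[of j] unfolding Fconv by (simp add: algebra_simps)
  qed
  moreover have inv0: "(\<lambda>n. 1 / real (Suc n)) \<longlonglongrightarrow> 0"
    using LIMSEQ_inverse_real_of_nat by (simp add: inverse_eq_divide)
  have "(\<lambda>n. 2 / real (Suc n)) \<longlonglongrightarrow> 0"
    using tendsto_mult_left[OF inv0, of 2] by simp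
  ultimately obtain y where y: "(\<lambda>n. ctr (k n)) \<longlonglongrightarrow> y"
    using sq_norm_midpoint_le_Cauchy[of "\<lambda>n. ctr (k n)" "\<lambda>n. 2 / real (Suc n)"] by auto
  have "(b + y) \<bullet> (a - y) \<ge> 0" if ab: "(a, b) \<in> G" for a b
  proof -
    let ?g = "(a, b, a \<bullet> b)"
    have *: "(1 - t) * (norm (y - ctr ?g))\<^sup>2 \<le> F ?g" if t: "0 < t" "t < 1" for t
    proof -
      have "m \<le> (1 - t) * (m + 1 / real (Suc n)) + t * F ?g - t * (1 - t) * (norm (ctr (k n) - ctr ?g))\<^sup>2" for n
      proof -
        have "(1 - t) *\<^sub>R k n + t *\<^sub>R ?g \<in> K"
          using K k(1) t ab by (intro convexD) auto
        from m_le[OF this] have "m \<le> (1 - t) * F (k n) + t * F ?g - t * (1 - t) * (norm (ctr (k n) - ctr ?g))\<^sup>2"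
          unfolding Fconv .
        also have "(1 - t) * F (k n) \<le> (1 - t) * (m + 1 / real (Suc n))"
          using k(2)[of n] t by (intro mult_left_mono) auto
        finally show ?thesis by simp
      qed
      moreover have "(\<lambda>n. (1 - t) * (m + 1 / real (Suc n)) + t * F ?g - t * (1 - t) * (norm (ctr (k n) - ctr ?g))\<^sup>2)
        \<longlonglongrightarrow> (1 - t) * (m + 0) + t * F ?g - t * (1 - t) * (norm (y - ctr ?g))\<^sup>2"
        by (intro tendsto_intros y inv0)
      ultimately have "m \<le> (1 - t) * (m + 0) + t * F ?g - t * (1 - t) * (norm (y - ctr ?g))\<^sup>2"
        by (intro LIMSEQ_le_const) auto
      then have "t * ((1 - t) * (norm (y - ctr ?g))\<^sup>2) \<le> t * (F ?g - m)"
        by (simp add: algebra_simps)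
      then have "(1 - t) * (norm (y - ctr ?g))\<^sup>2 \<le> F ?g - m"
        using t by (simp add: mult_le_cancel_left_pos)
      then show ?thesis using m0 by simp
    qed
    have "(1 - 1 / real (Suc (Suc n))) * (norm (y - ctr ?g))\<^sup>2 \<le> F ?g" for n
      by (rule *) auto
    moreover have "(\<lambda>n. (1 - 1 / real (Suc (Suc n))) * (norm (y - ctr ?g))\<^sup>2) \<longlonglongrightarrow> (1 - 0) * (norm (y - ctr ?g))\<^sup>2"
      by (intro tendsto_intros LIMSEQ_Suc[OF inv0])
    ultimately have "(norm (y - ctr ?g))\<^sup>2 \<le> F ?g"
      by (auto intro: LIMSEQ_le_const2)
    moreover have "F ?g - (norm (y - ctr ?g))\<^sup>2 = (b + y) \<bullet> (a - y)"
      unfolding F_def ctr_def power2_norm_eq_inner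
      by (simp add: inner_simps inner_commute algebra_simps; simp add: field_simps)
    ultimately show ?thesis by simp
  qed
  then show ?thesis using that by blast
qed

lemma maximal_monotone_memI:
  assumes "maximal_monotone B" and test: "\<And>u v. v \<in> B u \<Longrightarrow> (v - q) \<bullet> (u - w) \<ge> 0"
  shows "q \<in> B w"
proof -
  define B' where "B' = B(w := insert q (B w))"
  have mB: "\<And>x y u v. u \<in> B x \<Longrightarrow> v \<in> B y \<Longrightarrow> (u - v) \<bullet> (x - y) \<ge> 0"
    using assms(1) unfolding maximal_monotone_def monotone_operator_def by blast
  have test': "(q - v) \<bullet> (w - u) \<ge> 0" if "v \<in> B u" for u v
    using test[OF that] by (simp add: inner_diff_left inner_diff_right)
  have "monotone_operator B'"
    unfolding monotone_operator_def B'_def using mB test test' by auto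
  moreover have "\<forall>x. B x \<subseteq> B' x" by (auto simp: B'_def)
  ultimately have "B' = B" using assms(1) unfolding maximal_monotone_def by blast
  then show ?thesis by (metis B'_def fun_upd_same insertI1)
qed

lemma maximal_monotone_mono:
  assumes "maximal_monotone B" "u \<in> B x" "v \<in> B y"
  shows "(u - v) \<bullet> (x - y) \<ge> 0"
  using assms unfolding maximal_monotone_def monotone_operator_def by blast

text \<open>
  Used to replace the operators \<open>A s\<close> on the null set where they fail to be maximal monotone.
\<close>

lemma maximal_monotone_zero: "maximal_monotone (\<lambda>_. {0::'h::real_inner})"
proof -
  have "B' x = {0}" if B': "monotone_operator B'" "\<And>x. {0} \<subseteq> B' x" for B' :: "'h \<Rightarrow> 'h set" and x
  proof -
    have "v = 0" if v: "v \<in> B' x" for v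
    proof -
      have "(v - 0) \<bullet> (x - (x + v)) \<ge> 0"
        using B' v unfolding monotone_operator_def by (meson insert_subset)
      then show ?thesis by (metis add_diff_cancel_left' diff_zero inner_gt_zero_iff inner_minus_right
            minus_diff_eq neg_0_le_iff_le not_le)
    qed
    with B'(2)[of x] show ?thesis by auto
  qed
  then have "B' = (\<lambda>_. {0})" if "monotone_operator B'" "\<forall>x. {0} \<subseteq> B' x" for B' :: "'h \<Rightarrow> 'h set"
    using that by (intro ext) auto
  then show ?thesis
    unfolding maximal_monotone_def by (auto simp: monotone_operator_def)
qed

text \<open>
  Minty's theorem, for the graph of \<open>l B - x\<close>. It identifies the definite description \<open>resolvent\<close>:
  uniqueness of the value is monotonicity.
\<close>

lemma resolvent_inclusion:
  fixes B :: "'h::{real_inner, banach} \<Rightarrow> 'h set"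
  assumes B: "maximal_monotone B" and l: "l > 0"
  shows "(x - resolvent B l x) /\<^sub>R l \<in> B (resolvent B l x)"
proof -
  define G where "G = {(a, l *\<^sub>R b - x) | a b. b \<in> B a}"
  have "(b - b') \<bullet> (a - a') \<ge> 0" if "(a, b) \<in> G" "(a', b') \<in> G" for a b a' b'
  proof -
    from that obtain c c' where "c \<in> B a" "b = l *\<^sub>R c - x" "c' \<in> B a'" "b' = l *\<^sub>R c' - x"
      by (auto simp: G_def)
    moreover from this have "(c - c') \<bullet> (a - a') \<ge> 0" using maximal_monotone_mono[OF B] by blast
    moreover have "(l *\<^sub>R c - x - (l *\<^sub>R c' - x)) \<bullet> (a - a') = l * ((c - c') \<bullet> (a - a'))"
      by (simp add: inner_simps algebra_simps)
    ultimately show ?thesis using l by (metis mult_nonneg_nonneg less_imp_le)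
  qed
  then obtain y where y: "\<And>a b. (a, b) \<in> G \<Longrightarrow> (b + y) \<bullet> (a - y) \<ge> 0"
    using monotone_graph_Minty[of G] by blast
  have "(x - y) /\<^sub>R l \<in> B y"
  proof (rule maximal_monotone_memI[OF B])
    fix u v assume "v \<in> B u"
    then have "(l *\<^sub>R v - x + y) \<bullet> (u - y) \<ge> 0" by (intro y) (auto simp: G_def)
    moreover have "l * ((v - (x - y) /\<^sub>R l) \<bullet> (u - y)) = (l *\<^sub>R v - x + y) \<bullet> (u - y)"
      unfolding inner_scaleR_left[symmetric] scaleR_diff_right using l by (simp add: algebra_simps)
    ultimately show "(v - (x - y) /\<^sub>R l) \<bullet> (u - y) \<ge> 0" using l by (metis zero_le_mult_iff not_le)
  qed
  moreover have "resolvent B l x = y"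
    unfolding resolvent_def
  proof (rule the_equality)
    show "\<exists>u\<in>B y. x = y + l *\<^sub>R u"
      using calculation l by (intro bexI[of _ "(x - y) /\<^sub>R l"]) auto
    fix y' assume "\<exists>u\<in>B y'. x = y' + l *\<^sub>R u"
    then obtain u where u: "u \<in> B y'" "x = y' + l *\<^sub>R u" by blast
    have "(u - (x - y) /\<^sub>R l) \<bullet> (y' - y) \<ge> 0"
      using maximal_monotone_mono[OF B u(1) calculation] .
    moreover have "u - (x - y) /\<^sub>R l = - (1 / l) *\<^sub>R (y' - y)"
      using u(2) l by (simp add: algebra_simps inverse_eq_divide)
    ultimately have "(norm (y' - y))\<^sup>2 / l \<le> 0" by (simp add: power2_norm_eq_inner)
    then show "y' = y" using l by (simp add: divide_le_0_iff)
  qed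
  ultimately show ?thesis by simp
qed

lemma resolvent_monotone:
  fixes B :: "'h::{real_inner, banach} \<Rightarrow> 'h set"
  assumes "maximal_monotone B" "l > 0" "v \<in> B u"
  shows "(x - resolvent B l x - l *\<^sub>R v) \<bullet> (resolvent B l x - u) \<ge> 0"
proof -
  let ?J = "resolvent B l x"
  have "((x - ?J) /\<^sub>R l - v) \<bullet> (?J - u) \<ge> 0"
    using maximal_monotone_mono[OF assms(1) resolvent_inclusion[OF assms(1,2)] assms(3)] .
  moreover have "l * (((x - ?J) /\<^sub>R l - v) \<bullet> (?J - u)) = (x - ?J - l *\<^sub>R v) \<bullet> (?J - u)"
    unfolding inner_scaleR_left[symmetric] scaleR_diff_right using assms(2) by simp
  ultimately show ?thesis using assms(2) by (metis zero_le_mult_iff less_imp_le)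
qed

lemma resolvent_nonexpansive:
  fixes B :: "'h::{real_inner, banach} \<Rightarrow> 'h set"
  assumes "maximal_monotone B" "l > 0"
  shows "norm (resolvent B l x - resolvent B l y) \<le> norm (x - y)"
proof -
  let ?J = "resolvent B l x" and ?J' = "resolvent B l y"
  have "(x - ?J - l *\<^sub>R ((y - ?J') /\<^sub>R l)) \<bullet> (?J - ?J') \<ge> 0"
    by (rule resolvent_monotone[OF assms resolvent_inclusion[OF assms]])
  then have "(norm (?J - ?J'))\<^sup>2 \<le> (x - y) \<bullet> (?J - ?J')"
    using assms(2) by (simp add: power2_norm_eq_inner inner_simps algebra_simps)
  also have "\<dots> \<le> norm (x - y) * norm (?J - ?J')" by (rule norm_cauchy_schwarz)
  finally have "norm (?J - ?J') * norm (?J - ?J') \<le> norm (x - y) * norm (?J - ?J')"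
    by (simp add: power2_eq_square)
  then show ?thesis by (cases "norm (?J - ?J') = 0") (auto simp: mult_le_cancel_right)
qed

text \<open>
  The basic inequality of the proximal method. The difference of the two sides is
  \<open>2 (x - J - l v) \<bullet> (J - u) + \<parallel>x - J - l v\<parallel>\<^sup>2\<close>, where \<open>J\<close> is the resolvent of \<open>x\<close>.
\<close>

lemma resolvent_step:
  fixes B :: "'h::{real_inner, banach} \<Rightarrow> 'h set"
  assumes "maximal_monotone B" "l > 0" "v \<in> B u"
  shows "(norm (resolvent B l x - u))\<^sup>2 \<le> (norm (x - u))\<^sup>2 - 2 * l * (v \<bullet> (x - u)) + l\<^sup>2 * (norm v)\<^sup>2"
proof -
  let ?J = "resolvent B l x"
  have "(x - ?J - l *\<^sub>R v) \<bullet> (?J - u) \<ge> 0" by (rule resolvent_monotone[OF assms])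
  moreover have "(norm (x - ?J - l *\<^sub>R v))\<^sup>2 \<ge> 0" by simp
  moreover have "(norm (x - u))\<^sup>2 - 2 * l * (v \<bullet> (x - u)) + l\<^sup>2 * (norm v)\<^sup>2 - (norm (?J - u))\<^sup>2
     = 2 * ((x - ?J - l *\<^sub>R v) \<bullet> (?J - u)) + (norm (x - ?J - l *\<^sub>R v))\<^sup>2"
    unfolding power2_norm_eq_inner
    by (simp add: inner_simps inner_commute algebra_simps power2_eq_square)
  ultimately show ?thesis by linarith
qed

text \<open>
  Resolvents \<open>J\<^sub>l x\<close> approach the projection of \<open>x\<close> onto the closure of the domain as \<open>l \<rightarrow> 0\<close>. The
  obtuse angle property of the limit, \<open>(x - q) \<bullet> (q - u) \<ge> 0\<close>, is read off from monotonicity against a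
  fixed \<open>v \<in> B u\<close>, whose weight \<open>l\<close> tends to \<open>0\<close>.
\<close>

lemma resolvent_limit_obtuse:
  fixes B :: "'h::{real_inner, banach} \<Rightarrow> 'h set"
  assumes "maximal_monotone B" and lim: "(\<lambda>n. resolvent B (1 / real (Suc n)) x) \<longlonglongrightarrow> q"
    and "u \<in> op_dom B"
  shows "(norm (q - u))\<^sup>2 \<le> (norm (x - u))\<^sup>2 - (norm (x - q))\<^sup>2"
proof -
  obtain v where v: "v \<in> B u" using assms(3) by (auto simp: op_dom_def)
  have inv0: "(\<lambda>n. 1 / real (Suc n)) \<longlonglongrightarrow> 0"
    using LIMSEQ_inverse_real_of_nat by (simp add: inverse_eq_divide)
  have "(\<lambda>n. (x - resolvent B (1 / real (Suc n)) x - (1 / real (Suc n)) *\<^sub>R v) \<bullet> (resolvent B (1 / real (Suc n)) x - u))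
     \<longlonglongrightarrow> (x - q - 0 *\<^sub>R v) \<bullet> (q - u)"
    by (intro tendsto_intros lim inv0)
  then have "(x - q - 0 *\<^sub>R v) \<bullet> (q - u) \<ge> 0"
    by (rule LIMSEQ_le_const) (auto intro!: resolvent_monotone assms v)
  moreover have "(norm (x - u))\<^sup>2 - (norm (x - q))\<^sup>2 - (norm (q - u))\<^sup>2 = 2 * ((x - q) \<bullet> (q - u))"
    unfolding power2_norm_eq_inner by (simp add: inner_simps inner_commute algebra_simps)
  ultimately show ?thesis by simp
qed

lemma dist_set_le_resolvent_limit:
  fixes B :: "'h::{real_inner, banach} \<Rightarrow> 'h set"
  assumes B: "maximal_monotone B" and lim: "(\<lambda>n. resolvent B (1 / real (Suc n)) x) \<longlonglongrightarrow> q"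
  shows "dist_set x (op_dom B) \<le> ennreal (norm (x - q))"
proof -
  have "(\<lambda>n. ennreal (norm (x - resolvent B (1 / real (Suc n)) x))) \<longlonglongrightarrow> ennreal (norm (x - q))"
    by (intro tendsto_ennrealI tendsto_intros lim)
  moreover have "dist_set x (op_dom B) \<le> ennreal (norm (x - resolvent B (1 / real (Suc n)) x))" for n
  proof -
    have "resolvent B (1 / real (Suc n)) x \<in> op_dom B"
      using resolvent_inclusion[OF B, of "1 / real (Suc n)" x] by (auto simp: op_dom_def)
    then show ?thesis unfolding dist_set_def by (intro INF_lower)
  qed
  ultimately show ?thesis using LIMSEQ_le_const by blast
qed

lemma infdist_le_dist_set:
  shows "ennreal (infdist x S) \<le> dist_set x S"
  unfolding dist_set_def
proof (intro INF_greatest ennreal_leI)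
  fix y assume "y \<in> S"
  then show "infdist x S \<le> norm (x - y)" using infdist_le[of y S x] by (simp add: dist_norm)
qed

section \<open>Weak convergence of averages\<close>

text \<open>
  Nearly shortest elements of the sets form a Cauchy sequence, because the least norms increase to a
  finite limit and midpoints stay in the larger set; the limit of the sequence is in all sets.
\<close>

lemma nested_closed_convex_common_point:
  fixes K :: "nat \<Rightarrow> 'h::{real_inner, banach} set"
  assumes closed: "\<And>n. closed (K n)" and conv: "\<And>n. convex (K n)" and ne: "\<And>n. K n \<noteq> {}"
    and dec: "\<And>i j. i \<le> j \<Longrightarrow> K j \<subseteq> K i" and bdd: "bounded (K 0)"
  obtains w where "\<And>n. w \<in> K n"
proof -
  define d where "d n = Inf ((\<lambda>y. (norm y)\<^sup>2) ` K n)" for n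
  have below: "bdd_below ((\<lambda>y. (norm y)\<^sup>2) ` K n)" for n by (auto intro: bdd_belowI[of _ 0])
  have d_le: "d n \<le> (norm y)\<^sup>2" if "y \<in> K n" for n y
    unfolding d_def using below that by (auto intro: cInf_lower)
  have d_mono: "d i \<le> d j" if "i \<le> j" for i j
    unfolding d_def using dec[OF that] ne below by (intro cInf_superset_mono) auto
  obtain R where R: "\<And>y. y \<in> K 0 \<Longrightarrow> norm y \<le> R" using bdd by (auto simp: bounded_iff)
  have "d n \<le> R\<^sup>2" for n
  proof -
    obtain y where y: "y \<in> K n" using ne by blast
    have "norm y \<le> R" using R dec[of 0 n] y by auto
    then have "(norm y)\<^sup>2 \<le> R\<^sup>2" by (intro power_mono) auto
    then show ?thesis using d_le[OF y] by linarith
  qed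
  then obtain D where D: "d \<longlonglongrightarrow> D" "\<And>n. d n \<le> D"
    using incseq_convergent[of d "R\<^sup>2"] d_mono by (auto simp: incseq_def)
  have "\<exists>y\<in>K n. (norm y)\<^sup>2 < d n + 1 / real (Suc n)" for n
    using cInf_lessD[of "(\<lambda>y. (norm y)\<^sup>2) ` K n" "d n + 1 / real (Suc n)"] ne by (auto simp: d_def)
  then obtain y where y: "\<And>n. y n \<in> K n" "\<And>n. (norm (y n))\<^sup>2 < d n + 1 / real (Suc n)" by metis
  define e where "e n = 2 * (D - d n) + 2 * (1 / real (Suc n))" for n
  have le: "(norm (y i - y j))\<^sup>2 \<le> e i + e j" if "i \<le> j" for i j
  proof -
    have "(1/2) *\<^sub>R y i + (1/2) *\<^sub>R y j \<in> K i"
      using y dec[OF that] by (intro convexD[OF conv]) auto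
    from d_le[OF this] have "4 * d i \<le> 4 * (norm ((1/2) *\<^sub>R y i + (1/2) *\<^sub>R y j))\<^sup>2" by simp
    also have "\<dots> = 2 * (norm (y i))\<^sup>2 + 2 * (norm (y j))\<^sup>2 - (norm (y i - y j))\<^sup>2"
      unfolding power2_norm_eq_inner by (simp add: inner_simps inner_commute algebra_simps)
    finally have "(norm (y i - y j))\<^sup>2 \<le> 2 * (norm (y i))\<^sup>2 + 2 * (norm (y j))\<^sup>2 - 4 * d i" by simp
    also have "\<dots> \<le> 2 * (d i + 1 / real (Suc i)) + 2 * (d j + 1 / real (Suc j)) - 4 * d i"
      using y(2)[of i] y(2)[of j] by (intro diff_right_mono add_mono mult_left_mono) auto
    also have "\<dots> \<le> e i + e j" using D(2)[of j] by (simp add: e_def)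
    finally show ?thesis .
  qed
  have "(norm (y i - y j))\<^sup>2 \<le> e i + e j" for i j
    using le[of i j] le[of j i] by (cases "i \<le> j") (auto simp: norm_minus_commute)
  moreover have "e \<longlonglongrightarrow> 2 * (D - D) + 2 * 0"
    unfolding e_def using LIMSEQ_inverse_real_of_nat
    by (intro tendsto_intros D) (simp add: inverse_eq_divide)
  ultimately obtain w where w: "y \<longlonglongrightarrow> w" using sq_norm_midpoint_le_Cauchy[of y e] by auto
  have "w \<in> K n" for n
  proof (rule Lim_in_closed_set[OF closed _ _ w])
    show "\<forall>\<^sub>F i in sequentially. y i \<in> K n"
      using eventually_ge_at_top[of n] by eventually_elim (use y dec in blast)
  qed auto
  then show ?thesis using that by blast
qed

text \<open>
  The points that lie in the closed convex hull of every tail of \<open>X\<close>, described by the half-spaces that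
  eventually contain the sequence. They take the place of weak cluster points: they inherit every
  linear inequality that holds eventually, and a bounded sequence has one.
\<close>

definition tail_point :: "(nat \<Rightarrow> 'h::real_inner) \<Rightarrow> 'h \<Rightarrow> bool" where
  "tail_point X w \<longleftrightarrow> (\<forall>y c. (\<forall>\<^sub>F n in sequentially. X n \<bullet> y \<le> c) \<longrightarrow> w \<bullet> y \<le> c)"

lemma bounded_tail_point:
  fixes X :: "nat \<Rightarrow> 'h::{real_inner, banach}"
  assumes "bounded (range X)"
  obtains w where "tail_point X w"
proof -
  define K where "K n = closure (convex hull (X ` {n..}))" for n
  have "K j \<subseteq> K i" if "i \<le> j" for i j
    unfolding K_def using that by (intro closure_mono hull_mono) auto
  moreover have "bounded (K 0)"
    unfolding K_def using assms by (intro bounded_closure bounded_convex_hull) (auto simp: atLeast_0)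
  moreover have "closed (K n)" "convex (K n)" "K n \<noteq> {}" for n
    by (auto simp: K_def convex_closure)
  ultimately obtain w where w: "\<And>n. w \<in> K n"
    using nested_closed_convex_common_point[of K] by metis
  have "w \<bullet> y \<le> c" if ev: "\<forall>\<^sub>F n in sequentially. X n \<bullet> y \<le> c" for y c
  proof -
    obtain N where N: "\<And>n. n \<ge> N \<Longrightarrow> X n \<bullet> y \<le> c" using ev by (auto simp: eventually_sequentially)
    have "K N \<subseteq> {x. y \<bullet> x \<le> c}"
      unfolding K_def using N
      by (intro closure_minimal hull_minimal closed_halfspace_le convex_halfspace_le) (auto simp: inner_commute)
    with w[of N] show ?thesis by (auto simp: inner_commute)
  qed
  then show ?thesis using that by (auto simp: tail_point_def)
qed

lemma tail_point_limit:
  assumes "tail_point X w" and lim: "(\<lambda>n. X n \<bullet> y) \<longlonglongrightarrow> l"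
  shows "w \<bullet> y = l"
proof (rule antisym)
  show "w \<bullet> y \<le> l"
  proof (rule field_le_epsilon)
    fix e :: real assume "e > 0"
    then have "\<forall>\<^sub>F n in sequentially. X n \<bullet> y < l + e" by (intro order_tendstoD(2)[OF lim]) auto
    then have "\<forall>\<^sub>F n in sequentially. X n \<bullet> y \<le> l + e" by eventually_elim simp
    then show "w \<bullet> y \<le> l + e" using assms(1) by (auto simp: tail_point_def)
  qed
  show "l \<le> w \<bullet> y"
  proof (rule field_le_epsilon)
    fix e :: real assume "e > 0"
    then have "\<forall>\<^sub>F n in sequentially. X n \<bullet> y > l - e" by (intro order_tendstoD(1)[OF lim]) auto
    then have "\<forall>\<^sub>F n in sequentially. X n \<bullet> (- y) \<le> e - l" by eventually_elim simp
    then have "w \<bullet> (- y) \<le> e - l" using assms(1) unfolding tail_point_def by blast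
    then show "l \<le> w \<bullet> y + e" by simp
  qed
qed

text \<open>
  Opial's lemma in Passty's form for averages. If \<open>w\<close> and \<open>w'\<close> are tail points, hence in \<open>Z\<close>, then \<open>X n \<bullet> (w - w')\<close>
  converges, and its limit is both \<open>w \<bullet> (w - w')\<close> and \<open>w' \<bullet> (w - w')\<close>; hence \<open>w = w'\<close>. If \<open>X n \<bullet> y\<close>
  exceeded \<open>w \<bullet> y + e\<close> along a subsequence, a tail point of this subsequence would be another one.
\<close>

lemma Opial_Passty:
  fixes X :: "nat \<Rightarrow> 'h::{real_inner, banach}"
  assumes bdd: "bounded (range X)"
    and cluster: "\<And>w. tail_point X w \<Longrightarrow> w \<in> Z"
    and conv: "\<And>z z'. z \<in> Z \<Longrightarrow> z' \<in> Z \<Longrightarrow> convergent (\<lambda>n. X n \<bullet> (z - z'))"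
  shows "\<exists>z\<in>Z. weakly_converges X z"
proof -
  obtain w where w: "tail_point X w" using bounded_tail_point[OF bdd] .
  have upper: "\<forall>\<^sub>F n in sequentially. X n \<bullet> y < w \<bullet> y + e" if e: "e > 0" for y e
  proof (rule ccontr)
    assume "\<not> ?thesis"
    then have inf: "\<exists>\<^sub>F n in sequentially. X n \<bullet> y \<ge> w \<bullet> y + e"
      by (simp add: frequently_def not_le)
    then have "infinite {n. X n \<bullet> y \<ge> w \<bullet> y + e}"
      by (simp add: frequently_cofinite flip: cofinite_eq_sequentially)
    then obtain r :: "nat \<Rightarrow> nat" where r: "strict_mono r" "\<And>n. r n \<in> {n. X n \<bullet> y \<ge> w \<bullet> y + e}"
      using infinite_enumerate by blast
    have "bounded (range (X \<circ> r))" using bdd by (rule bounded_subset) auto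
    then obtain w' where w': "tail_point (X \<circ> r) w'" using bounded_tail_point by blast
    have w'X: "tail_point X w'"
      unfolding tail_point_def
    proof (intro allI impI)
      fix v c assume "\<forall>\<^sub>F n in sequentially. X n \<bullet> v \<le> c"
      then have "\<forall>\<^sub>F n in sequentially. (X \<circ> r) n \<bullet> v \<le> c"
        unfolding comp_def by (rule eventually_subseq[OF r(1)])
      then show "w' \<bullet> v \<le> c" using w' by (auto simp: tail_point_def)
    qed
    obtain l where "(\<lambda>n. X n \<bullet> (w - w')) \<longlonglongrightarrow> l"
      using conv[OF cluster[OF w] cluster[OF w'X]] by (auto simp: convergent_def)
    then have "w \<bullet> (w - w') = w' \<bullet> (w - w')"
      using tail_point_limit[OF w] tail_point_limit[OF w'X] by simp
    then have "(w - w') \<bullet> (w - w') = 0" by (simp add: inner_diff_left)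
    then have "w' = w" by simp
    moreover have "\<forall>\<^sub>F n in sequentially. (X \<circ> r) n \<bullet> (- y) \<le> - (w \<bullet> y + e)"
      using r(2) by (intro always_eventually) (simp add: algebra_simps)
    then have "w' \<bullet> (- y) \<le> - (w \<bullet> y + e)" using w' unfolding tail_point_def by blast
    ultimately show False using e by simp
  qed
  have "(\<lambda>n. X n \<bullet> y) \<longlonglongrightarrow> w \<bullet> y" for y
  proof (rule order_tendstoI)
    fix a assume a: "w \<bullet> y < a"
    show "\<forall>\<^sub>F n in sequentially. X n \<bullet> y < a"
      using upper[of "a - w \<bullet> y" y] a by simp
  next
    fix a assume a: "a < w \<bullet> y"
    show "\<forall>\<^sub>F n in sequentially. a < X n \<bullet> y"
      using upper[of "w \<bullet> y - a" "- y"] a by simp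
  qed
  then show ?thesis using cluster[OF w] by (auto simp: weakly_converges_def)
qed

text \<open>
  The pathwise form of the Robbins-Siegmund lemma: \<open>m\<close> may change sign but has a convergent series.
\<close>

lemma convergent_almost_decreasing:
  fixes a m b :: "nat \<Rightarrow> real"
  assumes step: "\<And>k. a (Suc k) \<le> a k - m k + b k" and nn: "\<And>k. 0 \<le> a k"
    and m: "summable m" and b: "summable b"
  shows "convergent a"
proof -
  define s where "s k = (\<Sum>j<k. m j - b j)" for k
  have s: "convergent s"
    unfolding s_def using summable_diff[OF m b] by (simp add: summable_iff_convergent)
  then obtain B where B: "\<And>k. \<bar>s k\<bar> \<le> B"
    using convergent_imp_Bseq[OF s] by (auto simp: Bseq_def)
  have "decseq (\<lambda>k. a k + s k)"
    using step by (intro decseq_SucI) (simp add: s_def algebra_simps)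
  moreover have "- B \<le> a k + s k" for k using nn[of k] B[of k] by linarith
  ultimately have "convergent (\<lambda>k. a k + s k)"
    using decseq_convergent[of "\<lambda>k. a k + s k" "- B"] by (metis convergentI)
  from convergent_diff[OF this s] show ?thesis by simp
qed

lemma summable_contraction:
  fixes e b :: "nat \<Rightarrow> real"
  assumes step: "\<And>k. e (Suc k) \<le> r * e k + b k" and nn: "\<And>k. 0 \<le> e k" "\<And>k. 0 \<le> b k"
    and r: "0 \<le> r" "r < 1" and b: "summable b"
  shows "summable e"
proof (rule summableI_nonneg_bounded)
  fix n
  have "(\<Sum>k<n. e k) \<le> (\<Sum>k<Suc n. e k)" using nn by simp
  also have "\<dots> = e 0 + (\<Sum>k<n. e (Suc k))" by (rule sum.lessThan_Suc_shift)
  also have "\<dots> \<le> e 0 + (\<Sum>k<n. r * e k + b k)" using step by (intro add_mono sum_mono) auto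
  also have "\<dots> = e 0 + r * (\<Sum>k<n. e k) + (\<Sum>k<n. b k)"
    by (simp add: sum.distrib sum_distrib_left)
  also have "(\<Sum>k<n. b k) \<le> suminf b" using b nn by (intro sum_le_suminf) auto
  finally have "(1 - r) * (\<Sum>k<n. e k) \<le> e 0 + suminf b" by (simp add: algebra_simps)
  then show "(\<Sum>k<n. e k) \<le> (e 0 + suminf b) / (1 - r)" using r by (simp add: field_simps)
qed (rule nn)

lemma weighted_average_tendsto:
  fixes lam x :: "nat \<Rightarrow> real"
  assumes pos: "\<And>k. lam k > 0" and inf: "filterlim (\<lambda>n. \<Sum>k=1..n. lam k) at_top sequentially"
    and x: "x \<longlonglongrightarrow> l"
  shows "(\<lambda>n. (\<Sum>k=1..n. lam k * x k) / (\<Sum>k=1..n. lam k)) \<longlonglongrightarrow> l"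
proof (rule LIMSEQ_I)
  fix e :: real assume e: "e > 0"
  obtain N where N: "\<And>k. k \<ge> N \<Longrightarrow> \<bar>x k - l\<bar> < e / 2"
    using LIMSEQ_D[OF x, of "e / 2"] e by auto
  define c where "c = (\<Sum>k<N. lam k * \<bar>x k - l\<bar>)"
  define S where "S n = (\<Sum>k=1..n. lam k)" for n
  have bnd: "\<bar>(\<Sum>k=1..n. lam k * (x k - l))\<bar> \<le> c + e / 2 * S n" for n
  proof -
    have "\<bar>(\<Sum>k=1..n. lam k * (x k - l))\<bar> \<le> (\<Sum>k=1..n. lam k * \<bar>x k - l\<bar>)"
      using pos by (intro order_trans[OF sum_abs] sum_mono) (simp add: abs_mult less_imp_le)
    also have "\<dots> \<le> (\<Sum>k=1..n. (if k < N then lam k * \<bar>x k - l\<bar> else 0) + e / 2 * lam k)"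
    proof (intro sum_mono)
      fix k assume "k \<in> {1..n}"
      show "lam k * \<bar>x k - l\<bar> \<le> (if k < N then lam k * \<bar>x k - l\<bar> else 0) + e / 2 * lam k"
      proof (cases "k < N")
        case True
        then show ?thesis using pos[of k] e by simp
      next
        case False
        then have "lam k * \<bar>x k - l\<bar> \<le> lam k * (e / 2)"
          using N[of k] pos[of k] by (intro mult_left_mono) auto
        then show ?thesis using False by (simp add: mult.commute)
      qed
    qed
    also have "\<dots> = (\<Sum>k\<in>{1..n} \<inter> {..<N}. lam k * \<bar>x k - l\<bar>) + e / 2 * S n"
      by (simp add: sum.distrib sum_distrib_left S_def sum.If_cases lessThan_def)
    also have "(\<Sum>k\<in>{1..n} \<inter> {..<N}. lam k * \<bar>x k - l\<bar>) \<le> c"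
      unfolding c_def using pos by (intro sum_mono2) (auto simp: less_imp_le)
    finally show ?thesis by simp
  qed
  have "\<forall>\<^sub>F n in sequentially. S n > max 0 (2 * c / e)"
    using inf unfolding S_def filterlim_at_top_dense by blast
  then obtain n0 where n0: "\<And>n. n \<ge> n0 \<Longrightarrow> S n > max 0 (2 * c / e)"
    by (auto simp: eventually_sequentially)
  have "norm ((\<Sum>k=1..n. lam k * x k) / (\<Sum>k=1..n. lam k) - l) < e" if "n \<ge> n0" for n
  proof -
    have S: "S n > 0" "c < e / 2 * S n" using n0[OF that] e by (auto simp: field_simps)
    have "(\<Sum>k=1..n. lam k * x k) / S n - l = (\<Sum>k=1..n. lam k * (x k - l)) / S n"
      using S by (simp add: S_def field_simps sum_subtractf sum_distrib_left)
    then have "\<bar>(\<Sum>k=1..n. lam k * x k) / S n - l\<bar> \<le> (c + e / 2 * S n) / S n"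
      using bnd[of n] S by (simp add: divide_right_mono)
    also have "\<dots> < (e / 2 * S n + e / 2 * S n) / S n"
      using S by (intro divide_strict_right_mono) auto
    also have "\<dots> = e" using S by (simp add: field_simps)
    finally show ?thesis by (simp add: S_def)
  qed
  then show "\<exists>n0. \<forall>n\<ge>n0. norm ((\<Sum>k=1..n. lam k * x k) / (\<Sum>k=1..n. lam k) - l) < e" by blast
qed

section \<open>Convergence of series of orthogonal increments\<close>

lemma abs_mult_le_sum_squares: "\<bar>x * y\<bar> \<le> x\<^sup>2 + y\<^sup>2" for x y :: real
proof -
  have "2 * \<bar>x\<bar> * \<bar>y\<bar> \<le> \<bar>x\<bar>\<^sup>2 + \<bar>y\<bar>\<^sup>2" by (rule sum_squares_bound)
  moreover have "0 \<le> \<bar>x\<bar> * \<bar>y\<bar>" by simp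
  ultimately have "\<bar>x\<bar> * \<bar>y\<bar> \<le> \<bar>x\<bar>\<^sup>2 + \<bar>y\<bar>\<^sup>2" by linarith
  then show ?thesis by (simp add: abs_mult)
qed

lemma integrable_mult_of_squares:
  fixes X Y :: "'a \<Rightarrow> real"
  assumes X: "X \<in> borel_measurable M" "integrable M (\<lambda>\<omega>. (X \<omega>)\<^sup>2)"
    and Y: "Y \<in> borel_measurable M" "integrable M (\<lambda>\<omega>. (Y \<omega>)\<^sup>2)"
  shows "integrable M (\<lambda>\<omega>. X \<omega> * Y \<omega>)"
proof (rule Bochner_Integration.integrable_bound[OF Bochner_Integration.integrable_add[OF X(2) Y(2)]])
  show "(\<lambda>\<omega>. X \<omega> * Y \<omega>) \<in> borel_measurable M" using X(1) Y(1) by (rule borel_measurable_times)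
  show "AE \<omega> in M. norm (X \<omega> * Y \<omega>) \<le> norm ((X \<omega>)\<^sup>2 + (Y \<omega>)\<^sup>2)"
    unfolding real_norm_def
    by (intro always_eventually allI order_trans[OF abs_mult_le_sum_squares abs_ge_self])
qed

lemma integrable_square_of_bool_mult:
  fixes X :: "'a \<Rightarrow> real"
  assumes X: "X \<in> borel_measurable M" "integrable M (\<lambda>\<omega>. (X \<omega>)\<^sup>2)" and t: "Measurable.pred M t"
  shows "integrable M (\<lambda>\<omega>. (of_bool (t \<omega>) * X \<omega>)\<^sup>2)"
    and "(\<integral>\<omega>. (of_bool (t \<omega>) * X \<omega>)\<^sup>2 \<partial>M) \<le> (\<integral>\<omega>. (X \<omega>)\<^sup>2 \<partial>M)"
proof -
  have le: "(of_bool b * x)\<^sup>2 \<le> x\<^sup>2" for b and x :: real by (cases b) auto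
  have t': "(\<lambda>\<omega>. of_bool (t \<omega>) :: real) \<in> borel_measurable M" using t by measurable
  show *: "integrable M (\<lambda>\<omega>. (of_bool (t \<omega>) * X \<omega>)\<^sup>2)"
  proof (rule Bochner_Integration.integrable_bound[OF X(2)])
    show "(\<lambda>\<omega>. (of_bool (t \<omega>) * X \<omega>)\<^sup>2) \<in> borel_measurable M"
      by (intro borel_measurable_power borel_measurable_times t' X)
    show "AE \<omega> in M. norm ((of_bool (t \<omega>) * X \<omega>)\<^sup>2) \<le> norm ((X \<omega>)\<^sup>2)"
      by (intro always_eventually allI) (simp add: le)
  qed
  show "(\<integral>\<omega>. (of_bool (t \<omega>) * X \<omega>)\<^sup>2 \<partial>M) \<le> (\<integral>\<omega>. (X \<omega>)\<^sup>2 \<partial>M)"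
    by (intro integral_mono * X le)
qed

lemma measurable_filtration:
  assumes step: "\<And>k. subalgebra (F (Suc k)) (F k)" and "i \<le> k" and "f \<in> measurable (F i) N"
  shows "f \<in> measurable (F k) N"
  using assms(2,3)
proof (induction k rule: dec_induct)
  case (step n)
  then show ?case using measurable_from_subalg[OF assms(1)] by blast
qed

text \<open>
  \<open>T k\<close> is decided by the past of time \<open>k\<close>, so that \<open>of_bool (T k) * m k\<close> are again orthogonal
  increments, with smaller second moments.
\<close>

lemma (in prob_space) stopped_sum_second_moment:
  fixes m :: "nat \<Rightarrow> 'a \<Rightarrow> real" and T :: "nat \<Rightarrow> 'a \<Rightarrow> bool"
  assumes sub: "\<And>k. subalgebra M (F k)" and step: "\<And>k. subalgebra (F (Suc k)) (F k)"
    and meas: "\<And>k. m k \<in> borel_measurable (F (Suc k))"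
    and sq: "\<And>k. integrable M (\<lambda>\<omega>. (m k \<omega>)\<^sup>2)"
    and orth: "\<And>k Z. Z \<in> borel_measurable (F k) \<Longrightarrow> integrable M (\<lambda>\<omega>. (Z \<omega>)\<^sup>2) \<Longrightarrow> (\<integral>\<omega>. Z \<omega> * m k \<omega> \<partial>M) = 0"
    and T: "\<And>k. Measurable.pred (F k) (T k)"
  shows "(\<lambda>\<omega>. \<Sum>k\<in>{N..<n}. of_bool (T k \<omega>) * m k \<omega>) \<in> borel_measurable (F n)
    \<and> integrable M (\<lambda>\<omega>. (\<Sum>k\<in>{N..<n}. of_bool (T k \<omega>) * m k \<omega>)\<^sup>2)
    \<and> (\<integral>\<omega>. (\<Sum>k\<in>{N..<n}. of_bool (T k \<omega>) * m k \<omega>)\<^sup>2 \<partial>M) \<le> (\<Sum>k\<in>{N..<n}. \<integral>\<omega>. (m k \<omega>)\<^sup>2 \<partial>M)"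
proof (induction n)
  case 0
  then show ?case by simp
next
  case (Suc n)
  let ?W = "\<lambda>n \<omega>. \<Sum>k\<in>{N..<n}. of_bool (T k \<omega>) * m k \<omega>"
  have W: "?W n \<in> borel_measurable (F n)" "integrable M (\<lambda>\<omega>. (?W n \<omega>)\<^sup>2)"
    "(\<integral>\<omega>. (?W n \<omega>)\<^sup>2 \<partial>M) \<le> (\<Sum>k\<in>{N..<n}. \<integral>\<omega>. (m k \<omega>)\<^sup>2 \<partial>M)" using Suc by auto
  show ?case
  proof (cases "N \<le> n")
    case False
    then show ?thesis by (simp add: not_le)
  next
    case True
    define w where "w = ?W n"
    define x where "x \<omega> = of_bool (T n \<omega>) * m n \<omega>" for \<omega>
    have Ws: "?W (Suc n) = (\<lambda>\<omega>. w \<omega> + x \<omega>)"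
      unfolding w_def x_def by (rule ext) (rule sum.atLeastLessThan_Suc[OF True])
    have w: "w \<in> borel_measurable (F n)" "integrable M (\<lambda>\<omega>. (w \<omega>)\<^sup>2)"
      "(\<integral>\<omega>. (w \<omega>)\<^sup>2 \<partial>M) \<le> (\<Sum>k\<in>{N..<n}. \<integral>\<omega>. (m k \<omega>)\<^sup>2 \<partial>M)"
      using W by (simp_all only: w_def)
    have TM: "Measurable.pred M (T n)" using T measurable_from_subalg[OF sub] by blast
    have mM: "m n \<in> borel_measurable M" using meas measurable_from_subalg[OF sub] by blast
    have wM: "w \<in> borel_measurable M" using w(1) measurable_from_subalg[OF sub] by blast
    have tF: "(\<lambda>\<omega>. of_bool (T n \<omega>) :: real) \<in> borel_measurable (F n)" using T[of n] by measurable
    have xF: "x \<in> borel_measurable (F (Suc n))"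
      unfolding x_def by (intro borel_measurable_times measurable_from_subalg[OF step tF] meas)
    have xM: "x \<in> borel_measurable M" using xF measurable_from_subalg[OF sub] by blast
    have x2: "integrable M (\<lambda>\<omega>. (x \<omega>)\<^sup>2)" "(\<integral>\<omega>. (x \<omega>)\<^sup>2 \<partial>M) \<le> (\<integral>\<omega>. (m n \<omega>)\<^sup>2 \<partial>M)"
      unfolding x_def using integrable_square_of_bool_mult[OF mM sq TM] by auto
    have wx: "integrable M (\<lambda>\<omega>. w \<omega> * x \<omega>)"
      by (rule integrable_mult_of_squares[OF wM w(2) xM x2(1)])
    have 1: "?W (Suc n) \<in> borel_measurable (F (Suc n))"
      unfolding Ws by (intro borel_measurable_add measurable_from_subalg[OF step w(1)] xF)
    have sqW: "(?W (Suc n) \<omega>)\<^sup>2 = (w \<omega>)\<^sup>2 + (x \<omega>)\<^sup>2 + 2 * (w \<omega> * x \<omega>)" for \<omega>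
      using fun_cong[OF Ws, of \<omega>] by (simp only: power2_sum mult.assoc)
    have 2: "integrable M (\<lambda>\<omega>. (?W (Suc n) \<omega>)\<^sup>2)"
      unfolding sqW by (intro Bochner_Integration.integrable_add integrable_mult_right w x2 wx)
    have "(\<integral>\<omega>. (of_bool (T n \<omega>) * w \<omega>) * m n \<omega> \<partial>M) = 0"
      by (rule orth[OF borel_measurable_times[OF tF w(1)] integrable_square_of_bool_mult(1)[OF wM w(2) TM]])
    then have "(\<integral>\<omega>. w \<omega> * x \<omega> \<partial>M) = 0" by (simp add: x_def ac_simps)
    then have "(\<integral>\<omega>. (?W (Suc n) \<omega>)\<^sup>2 \<partial>M) = (\<integral>\<omega>. (w \<omega>)\<^sup>2 \<partial>M) + (\<integral>\<omega>. (x \<omega>)\<^sup>2 \<partial>M)"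
      unfolding sqW using w(2) x2(1) wx by simp
    also have "\<dots> \<le> (\<Sum>k\<in>{N..<n}. \<integral>\<omega>. (m k \<omega>)\<^sup>2 \<partial>M) + (\<integral>\<omega>. (m n \<omega>)\<^sup>2 \<partial>M)"
      by (intro add_mono w x2)
    also have "\<dots> = (\<Sum>k\<in>{N..<Suc n}. \<integral>\<omega>. (m k \<omega>)\<^sup>2 \<partial>M)"
      by (rule sum.atLeastLessThan_Suc[OF True, symmetric])
    finally show ?thesis using 1 2 by simp
  qed
qed

text \<open>
  Kolmogorov's maximal inequality: stop the sum at its first exit from \<open>(-a, a)\<close> and apply Chebyshev's
  inequality to the stopped sum.
\<close>

lemma (in prob_space) orthogonal_increments_maximal:
  fixes m :: "nat \<Rightarrow> 'a \<Rightarrow> real"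
  assumes sub: "\<And>k. subalgebra M (F k)" and step: "\<And>k. subalgebra (F (Suc k)) (F k)"
    and meas: "\<And>k. m k \<in> borel_measurable (F (Suc k))"
    and sq: "\<And>k. integrable M (\<lambda>\<omega>. (m k \<omega>)\<^sup>2)"
    and orth: "\<And>k Z. Z \<in> borel_measurable (F k) \<Longrightarrow> integrable M (\<lambda>\<omega>. (Z \<omega>)\<^sup>2) \<Longrightarrow> (\<integral>\<omega>. Z \<omega> * m k \<omega> \<partial>M) = 0"
    and a: "a > 0"
  shows "a\<^sup>2 * prob {\<omega>\<in>space M. \<exists>j\<in>{N..n}. a \<le> \<bar>\<Sum>i\<in>{N..<j}. m i \<omega>\<bar>} \<le> (\<Sum>k\<in>{N..<n}. \<integral>\<omega>. (m k \<omega>)\<^sup>2 \<partial>M)"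
proof -
  define T where "T k \<omega> \<longleftrightarrow> (\<forall>j\<in>{N..k}. \<bar>\<Sum>i\<in>{N..<j}. m i \<omega>\<bar> < a)" for k \<omega>
  define W where "W n \<omega> = (\<Sum>k\<in>{N..<n}. of_bool (T k \<omega>) * m k \<omega>)" for n \<omega>
  have mF: "m i \<in> borel_measurable (F k)" if "i < k" for i k
    using measurable_filtration[of F, OF step _ meas] that by simp
  have T: "Measurable.pred (F k) (T k)" for k
  proof -
    have "(\<lambda>\<omega>. \<Sum>i\<in>{N..<j}. m i \<omega>) \<in> borel_measurable (F k)" if "j \<in> {N..k}" for j
      by (intro borel_measurable_sum mF) (use that in auto)
    then have "Measurable.pred (F k) (\<lambda>\<omega>. \<bar>\<Sum>i\<in>{N..<j}. m i \<omega>\<bar> < a)" if "j \<in> {N..k}" for j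
      using that by measurable
    then show ?thesis unfolding T_def
      by (intro pred_intros_finite) auto
  qed
  note stopped = stopped_sum_second_moment[where F=F and T=T and m=m, OF sub step meas sq orth T]
  have mM: "m i \<in> borel_measurable M" for i using measurable_from_subalg[OF sub meas] .
  define E where "E = {\<omega>\<in>space M. \<exists>j\<in>{N..n}. a \<le> \<bar>\<Sum>i\<in>{N..<j}. m i \<omega>\<bar>}"
  have "Measurable.pred M (\<lambda>\<omega>. a \<le> \<bar>\<Sum>i\<in>{N..<j}. m i \<omega>\<bar>)" for j using mM by measurable
  then have E: "E \<in> events"
    unfolding E_def by (intro predE pred_intros_finite) auto
  \<comment> \<open>the stopped sum does not change after the first exit, and its value then is at least \<open>a\<close>\<close>
  have frozen: "(T k \<omega> \<longrightarrow> W k \<omega> = (\<Sum>i\<in>{N..<k}. m i \<omega>)) \<and> (\<not> T k \<omega> \<longrightarrow> a \<le> \<bar>W k \<omega>\<bar>)" for k \<omega>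
  proof (induction k)
    case 0
    then show ?case using a by (auto simp: W_def T_def)
  next
    case (Suc k)
    show ?case
    proof (cases "N \<le> k")
      case False
      then show ?thesis using a by (auto simp: W_def T_def atLeastAtMostSuc_conv)
    next
      case True
      have W: "W (Suc k) \<omega> = W k \<omega> + of_bool (T k \<omega>) * m k \<omega>"
        unfolding W_def by (rule sum.atLeastLessThan_Suc[OF True])
      have Ts: "T (Suc k) \<omega> \<longleftrightarrow> T k \<omega> \<and> \<bar>\<Sum>i\<in>{N..<Suc k}. m i \<omega>\<bar> < a"
        using True unfolding T_def by (auto simp: atLeastAtMostSuc_conv)
      show ?thesis using Suc True W Ts by auto
    qed
  qed
  have "a\<^sup>2 * prob E = (\<integral>\<omega>. a\<^sup>2 * indicator E \<omega> \<partial>M)"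
    using E by (simp add: sets.Int_space_eq2)
  also have "\<dots> \<le> (\<integral>\<omega>. (W n \<omega>)\<^sup>2 \<partial>M)"
  proof (rule integral_mono)
    show "integrable M (\<lambda>\<omega>. a\<^sup>2 * indicator E \<omega>)"
      using E by (intro integrable_mult_right integrable_real_indicator) (auto simp: emeasure_eq_measure)
    show "integrable M (\<lambda>\<omega>. (W n \<omega>)\<^sup>2)" using stopped unfolding W_def by blast
    fix \<omega> assume "\<omega> \<in> space M"
    show "a\<^sup>2 * indicator E \<omega> \<le> (W n \<omega>)\<^sup>2"
    proof (cases "\<omega> \<in> E")
      case True
      then have "\<not> T n \<omega>" unfolding T_def E_def by (auto simp: not_less)
      then have "a \<le> \<bar>W n \<omega>\<bar>" using frozen by blast
      then have "a\<^sup>2 \<le> \<bar>W n \<omega>\<bar>\<^sup>2" using a by (intro power_mono) auto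
      then show ?thesis using True by simp
    qed simp
  qed
  also have "\<dots> \<le> (\<Sum>k\<in>{N..<n}. \<integral>\<omega>. (m k \<omega>)\<^sup>2 \<partial>M)" using stopped unfolding W_def by blast
  finally show ?thesis unfolding E_def .
qed

text \<open>
  Martingale convergence in \<open>L\<^sup>2\<close>: by the maximal inequality the oscillation of the partial sums after
  time \<open>N\<close> exceeds \<open>a\<close> with probability at most \<open>a\<^sup>-\<^sup>2\<close> times the tail of a convergent series.
\<close>

lemma (in prob_space) orthogonal_increments_converge:
  fixes m :: "nat \<Rightarrow> 'a \<Rightarrow> real"
  assumes sub: "\<And>k. subalgebra M (F k)" and step: "\<And>k. subalgebra (F (Suc k)) (F k)"
    and meas: "\<And>k. m k \<in> borel_measurable (F (Suc k))"
    and sq: "\<And>k. integrable M (\<lambda>\<omega>. (m k \<omega>)\<^sup>2)"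
    and orth: "\<And>k Z. Z \<in> borel_measurable (F k) \<Longrightarrow> integrable M (\<lambda>\<omega>. (Z \<omega>)\<^sup>2) \<Longrightarrow> (\<integral>\<omega>. Z \<omega> * m k \<omega> \<partial>M) = 0"
    and sum: "summable (\<lambda>k. \<integral>\<omega>. (m k \<omega>)\<^sup>2 \<partial>M)"
  shows "AE \<omega> in M. summable (\<lambda>k. m k \<omega>)"
proof -
  have mM: "m i \<in> borel_measurable M" for i using measurable_from_subalg[OF sub meas] .
  define v where "v k = (\<integral>\<omega>. (m k \<omega>)\<^sup>2 \<partial>M)" for k
  have v: "summable v" "\<And>k. 0 \<le> v k" using sum by (auto simp: v_def[abs_def])
  have ae: "AE \<omega> in M. \<exists>N. \<forall>j\<ge>N. \<bar>\<Sum>i\<in>{N..<j}. m i \<omega>\<bar> < a" if a: "a > 0" for a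
  proof -
    define E where "E N n = {\<omega>\<in>space M. \<exists>j\<in>{N..n}. a \<le> \<bar>\<Sum>i\<in>{N..<j}. m i \<omega>\<bar>}" for N n
    have "Measurable.pred M (\<lambda>\<omega>. a \<le> \<bar>\<Sum>i\<in>{N..<j}. m i \<omega>\<bar>)" for N j using mM by measurable
    then have E: "E N n \<in> events" for N n
      unfolding E_def by (intro predE pred_intros_finite) auto
    have le: "prob (\<Union>n. E N n) \<le> (suminf v - sum v {..<N}) / a\<^sup>2" for N
    proof (rule LIMSEQ_le_const2)
      show "(\<lambda>n. prob (E N n)) \<longlonglongrightarrow> prob (\<Union>n. E N n)"
      proof (rule finite_Lim_measure_incseq)
        show "range (E N) \<subseteq> events" using E by blast
        have "E N p \<subseteq> E N q" if "p \<le> q" for p q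
        proof -
          have "{N..p} \<subseteq> {N..q}" using that by auto
          then show ?thesis unfolding E_def by blast
        qed
        then show "incseq (E N)" by (auto simp: incseq_def)
      qed
      have "prob (E N n) \<le> (suminf v - sum v {..<N}) / a\<^sup>2" for n
      proof -
        have "a\<^sup>2 * prob (E N n) \<le> sum v {N..<n}"
          unfolding E_def v_def by (rule orthogonal_increments_maximal[where F=F and m=m and a=a, OF sub step meas sq orth a])
        also have "\<dots> \<le> suminf v - sum v {..<N}"
        proof (cases "N \<le> n")
          case True
          have "sum v {..<N} + sum v {N..<n} = sum v {..<n}"
            using True by (simp add: lessThan_atLeast0 sum.atLeastLessThan_concat)
          also have "\<dots> \<le> suminf v" using v by (intro sum_le_suminf) auto
          finally show ?thesis by simp
        next
          case False
          have "sum v {..<N} \<le> suminf v" using v by (intro sum_le_suminf) auto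
          then show ?thesis using False by simp
        qed
        finally show ?thesis using a by (simp add: field_simps)
      qed
      then show "\<exists>N'. \<forall>n\<ge>N'. prob (E N n) \<le> (suminf v - sum v {..<N}) / a\<^sup>2" by blast
    qed
    define B where "B = (\<Inter>N. \<Union>n. E N n)"
    have B: "B \<in> events" unfolding B_def using E by auto
    have "prob B \<le> (suminf v - sum v {..<N}) / a\<^sup>2" for N
    proof -
      have "prob B \<le> prob (\<Union>n. E N n)"
        unfolding B_def using E by (intro finite_measure_mono) auto
      then show ?thesis using le[of N] by linarith
    qed
    moreover have "(\<lambda>N. (suminf v - sum v {..<N}) / a\<^sup>2) \<longlonglongrightarrow> (suminf v - suminf v) / a\<^sup>2"
      using v(1) a by (intro tendsto_intros summable_LIMSEQ) auto
    ultimately have "prob B \<le> (suminf v - suminf v) / a\<^sup>2"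
      by (intro LIMSEQ_le_const) auto
    then have "prob B = 0" using measure_nonneg[of M B] by simp
    then have "AE \<omega> in M. \<omega> \<notin> B" using B prob_eq_0 by blast
    with AE_space show ?thesis
    proof eventually_elim
      case (elim \<omega>)
      then obtain N where N: "\<And>n. \<omega> \<notin> E N n" unfolding B_def by blast
      have "\<bar>\<Sum>i\<in>{N..<j}. m i \<omega>\<bar> < a" if "j \<ge> N" for j
        using N[of j] elim that unfolding E_def by (auto simp: not_le)
      then show ?case by blast
    qed
  qed
  have "AE \<omega> in M. \<forall>i::nat. \<exists>N. \<forall>j\<ge>N. \<bar>\<Sum>k\<in>{N..<j}. m k \<omega>\<bar> < 1 / real (Suc i)"
    unfolding AE_all_countable by (intro allI ae) auto
  then show ?thesis
  proof eventually_elim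
    case (elim \<omega>)
    show ?case
      unfolding summable_Cauchy
    proof (intro allI impI)
      fix e :: real assume e: "e > 0"
      obtain i where i: "1 / real (Suc i) < e / 2" using e nat_approx_posE[of "e/2"] by auto
      obtain N where N: "\<And>j. j \<ge> N \<Longrightarrow> \<bar>\<Sum>k\<in>{N..<j}. m k \<omega>\<bar> < 1 / real (Suc i)" using elim by blast
      have "norm (\<Sum>k\<in>{p..<q}. m k \<omega>) < e" if p: "p \<ge> N" for p q
      proof (cases "p \<le> q")
        case True
        have "(\<Sum>k\<in>{N..<p}. m k \<omega>) + (\<Sum>k\<in>{p..<q}. m k \<omega>) = (\<Sum>k\<in>{N..<q}. m k \<omega>)"
          using p True by (simp add: sum.atLeastLessThan_concat)
        then show ?thesis using N[of p] N[of q] p True i by simp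
      qed (use e in simp)
      then show "\<exists>N. \<forall>p\<ge>N. \<forall>q. norm (\<Sum>k\<in>{p..<q}. m k \<omega>) < e" by blast
    qed
  qed
qed

section \<open>Independent draws\<close>

text \<open>
  \<open>F k\<close> is the past of time \<open>k\<close>, and the draw \<open>\<xi> (Suc k)\<close> has law \<open>M\<close> and is independent of it.
  Independence is expressed by the joint law of the outcome, seen through \<open>F k\<close>, and the draw: this is
  the form in which Fubini's theorem applies to functions of the past and the next draw.
\<close>

locale innovation = P: prob_space P + M: prob_space M
  for P :: "'w measure" and M :: "'s measure" +
  fixes F :: "nat \<Rightarrow> 'w measure" and \<xi> :: "nat \<Rightarrow> 'w \<Rightarrow> 's"
  assumes sub: "\<And>k. subalgebra P (F k)"
    and step: "\<And>k. subalgebra (F (Suc k)) (F k)"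
    and innov: "\<And>k. \<xi> (Suc k) \<in> measurable (F (Suc k)) M"
    and joint_law: "\<And>k. distr P (F k \<Otimes>\<^sub>M M) (\<lambda>\<omega>. (\<omega>, \<xi> (Suc k) \<omega>)) = distr P (F k) (\<lambda>\<omega>. \<omega>) \<Otimes>\<^sub>M M"
begin

lemma innov_P: "\<xi> (Suc k) \<in> measurable P M"
  using measurable_from_subalg[OF sub innov] .

lemma id_P: "(\<lambda>\<omega>. \<omega>) \<in> measurable P (F k)"
  using measurable_from_subalg[OF sub measurable_ident] by (simp add: id_def)

lemma joint_P: "(\<lambda>\<omega>. (\<omega>, \<xi> (Suc k) \<omega>)) \<in> measurable P (F k \<Otimes>\<^sub>M M)"
  using id_P innov_P by (rule measurable_Pair)

lemma measurable_joint:
  "measurable (distr P (F k) (\<lambda>\<omega>. \<omega>) \<Otimes>\<^sub>M M) N = measurable (F k \<Otimes>\<^sub>M M) N"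
  by (intro measurable_cong_sets sets_pair_measure_cong sets_distr refl)

lemma nn_integral_innov:
  assumes g: "(\<lambda>(\<omega>, s). g \<omega> s) \<in> borel_measurable (F k \<Otimes>\<^sub>M M)"
  shows "(\<integral>\<^sup>+\<omega>. g \<omega> (\<xi> (Suc k) \<omega>) \<partial>P) = (\<integral>\<^sup>+\<omega>. \<integral>\<^sup>+s. g \<omega> s \<partial>M \<partial>P)"
proof -
  let ?D = "distr P (F k) (\<lambda>\<omega>. \<omega>)"
  have g': "(\<lambda>(\<omega>, s). g \<omega> s) \<in> borel_measurable (?D \<Otimes>\<^sub>M M)"
    unfolding measurable_joint by (rule g)
  have "(\<integral>\<^sup>+\<omega>. g \<omega> (\<xi> (Suc k) \<omega>) \<partial>P) = (\<integral>\<^sup>+x. (case x of (\<omega>, s) \<Rightarrow> g \<omega> s) \<partial>(?D \<Otimes>\<^sub>M M))"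
    unfolding joint_law[symmetric] using g by (subst nn_integral_distr[OF joint_P]) simp_all
  also have "\<dots> = (\<integral>\<^sup>+\<omega>. \<integral>\<^sup>+s. g \<omega> s \<partial>M \<partial>?D)"
    unfolding M.nn_integral_fst[OF g', symmetric] by simp
  also have "\<dots> = (\<integral>\<^sup>+\<omega>. \<integral>\<^sup>+s. g \<omega> s \<partial>M \<partial>P)"
    using M.borel_measurable_nn_integral[OF g] by (intro nn_integral_distr[OF id_P]) simp
  finally show ?thesis .
qed

lemma AE_innov:
  assumes Q: "Measurable.pred (F k \<Otimes>\<^sub>M M) (\<lambda>(\<omega>, s). Q \<omega> s)"
    and ae: "\<And>\<omega>. AE s in M. Q \<omega> s"
  shows "AE \<omega> in P. Q \<omega> (\<xi> (Suc k) \<omega>)"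
proof -
  define g :: "'w \<Rightarrow> 's \<Rightarrow> ennreal" where "g \<omega> s = (if Q \<omega> s then 0 else 1)" for \<omega> s
  have "(\<lambda>x. if (case x of (\<omega>, s) \<Rightarrow> Q \<omega> s) then 0 else 1 :: ennreal) \<in> borel_measurable (F k \<Otimes>\<^sub>M M)"
    using Q by (intro measurable_If measurable_const) (auto simp: pred_def)
  then have g: "(\<lambda>(\<omega>, s). g \<omega> s) \<in> borel_measurable (F k \<Otimes>\<^sub>M M)"
    by (simp add: g_def case_prod_unfold)
  have "(\<integral>\<^sup>+s. g \<omega> s \<partial>M) = 0" for \<omega>
  proof -
    have "AE s in M. g \<omega> s = 0" using ae[of \<omega>] by eventually_elim (simp add: g_def)
    then have "(\<integral>\<^sup>+s. g \<omega> s \<partial>M) = (\<integral>\<^sup>+s. 0 \<partial>M)" by (rule nn_integral_cong_AE)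
    then show ?thesis by simp
  qed
  then have "(\<integral>\<^sup>+\<omega>. g \<omega> (\<xi> (Suc k) \<omega>) \<partial>P) = 0"
    using nn_integral_innov[OF g] by simp
  moreover have "(\<lambda>\<omega>. g \<omega> (\<xi> (Suc k) \<omega>)) \<in> borel_measurable P"
    using measurable_compose[OF joint_P g] by simp
  ultimately have "AE \<omega> in P. g \<omega> (\<xi> (Suc k) \<omega>) = 0"
    by (simp add: nn_integral_0_iff_AE)
  then show ?thesis by eventually_elim (auto simp: g_def split: if_splits)
qed

lemma integral_innov:
  fixes g :: "'w \<Rightarrow> 's \<Rightarrow> real"
  assumes g: "(\<lambda>(\<omega>, s). g \<omega> s) \<in> borel_measurable (F k \<Otimes>\<^sub>M M)"
    and int: "integrable P (\<lambda>\<omega>. g \<omega> (\<xi> (Suc k) \<omega>))"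
  shows "(\<integral>\<omega>. g \<omega> (\<xi> (Suc k) \<omega>) \<partial>P) = (\<integral>\<omega>. \<integral>s. g \<omega> s \<partial>M \<partial>P)"
proof -
  let ?D = "distr P (F k) (\<lambda>\<omega>. \<omega>)"
  interpret D: prob_space ?D using id_P by (rule P.prob_space_distr)
  interpret DM: pair_sigma_finite ?D M ..
  have int': "integrable (?D \<Otimes>\<^sub>M M) (\<lambda>(\<omega>, s). g \<omega> s)"
    unfolding joint_law[symmetric] integrable_distr_eq[OF joint_P g] using int by simp
  have "(\<integral>\<omega>. g \<omega> (\<xi> (Suc k) \<omega>) \<partial>P) = (\<integral>x. (case x of (\<omega>, s) \<Rightarrow> g \<omega> s) \<partial>(?D \<Otimes>\<^sub>M M))"
    unfolding joint_law[symmetric] integral_distr[OF joint_P g] by simp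
  also have "\<dots> = (\<integral>\<omega>. \<integral>s. g \<omega> s \<partial>M \<partial>?D)"
    unfolding DM.integral_fst'[OF int', symmetric] by simp
  also have "\<dots> = (\<integral>\<omega>. \<integral>s. g \<omega> s \<partial>M \<partial>P)"
    using M.borel_measurable_lebesgue_integral[OF g] by (intro integral_distr[OF id_P])
  finally show ?thesis .
qed

text \<open>
  Conditionally on \<open>F k\<close>, the mean of \<open>g k \<omega> (\<xi> (Suc k) \<omega>)\<close> is \<open>\<integral>s. g k \<omega> s \<partial>M\<close>; the centred terms are
  therefore orthogonal to the past. All laws of large numbers below are instances.
\<close>

lemma centred_sums_converge:
  fixes g :: "nat \<Rightarrow> 'w \<Rightarrow> 's \<Rightarrow> real"
  assumes g: "\<And>k. (\<lambda>(\<omega>, s). g k \<omega> s) \<in> borel_measurable (F k \<Otimes>\<^sub>M M)"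
    and bound: "\<And>k. (\<integral>\<^sup>+\<omega>. \<integral>\<^sup>+s. ennreal ((g k \<omega> s)\<^sup>2) \<partial>M \<partial>P) \<le> ennreal (e k)"
    and e: "summable e" "\<And>k. 0 \<le> e k"
  shows "AE \<omega> in P. summable (\<lambda>k. g k \<omega> (\<xi> (Suc k) \<omega>) - (\<integral>s. g k \<omega> s \<partial>M))"
proof -
  define G where "G k \<omega> = (\<integral>s. g k \<omega> s \<partial>M)" for k \<omega>
  define h where "h k \<omega> = g k \<omega> (\<xi> (Suc k) \<omega>)" for k \<omega>
  have GF: "G k \<in> borel_measurable (F k)" for k
    unfolding G_def using M.borel_measurable_lebesgue_integral[OF g] .
  have GP: "G k \<in> borel_measurable P" for k using measurable_from_subalg[OF sub GF] .
  have hF: "h k \<in> borel_measurable (F (Suc k))" for k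
  proof -
    have "(\<lambda>\<omega>. (\<omega>, \<xi> (Suc k) \<omega>)) \<in> measurable (F (Suc k)) (F k \<Otimes>\<^sub>M M)"
      using measurable_from_subalg[OF step measurable_ident] innov
      by (intro measurable_Pair) (auto simp: id_def)
    from measurable_compose[OF this g] show ?thesis unfolding h_def by simp
  qed
  have hP: "h k \<in> borel_measurable P" for k using measurable_from_subalg[OF sub hF] .
  have g_sec: "g k \<omega> \<in> borel_measurable M" if "\<omega> \<in> space P" for k \<omega>
  proof -
    have "\<omega> \<in> space (F k)" using that sub[of k] by (simp add: subalgebra_def)
    from measurable_compose[OF measurable_Pair1'[OF this] g] show ?thesis by simp
  qed
  have g2: "(\<lambda>(\<omega>, s). ennreal ((g k \<omega> s)\<^sup>2)) \<in> borel_measurable (F k \<Otimes>\<^sub>M M)" for k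
    using g[of k] by (simp add: case_prod_unfold)
  have h2: "(\<integral>\<^sup>+\<omega>. ennreal ((h k \<omega>)\<^sup>2) \<partial>P) \<le> ennreal (e k)" for k
    unfolding h_def using nn_integral_innov[OF g2] bound by simp
  have G2: "(\<integral>\<^sup>+\<omega>. ennreal ((G k \<omega>)\<^sup>2) \<partial>P) \<le> ennreal (e k)" for k
  proof -
    have "ennreal ((G k \<omega>)\<^sup>2) \<le> (\<integral>\<^sup>+s. ennreal ((g k \<omega> s)\<^sup>2) \<partial>M)" if \<omega>: "\<omega> \<in> space P" for \<omega>
    proof (cases "(\<integral>\<^sup>+s. ennreal ((g k \<omega> s)\<^sup>2) \<partial>M) = \<infinity>")
      case False
      then have sq: "integrable M (\<lambda>s. (g k \<omega> s)\<^sup>2)"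
        using g_sec[OF \<omega>] by (intro integrableI_nonneg) (auto simp: less_top)
      then have i: "integrable M (g k \<omega>)"
        using M.square_integrable_imp_integrable[OF g_sec[OF \<omega>]] by simp
      have "0 \<le> M.variance (g k \<omega>)" by (rule M.variance_positive)
      then have "(G k \<omega>)\<^sup>2 \<le> (\<integral>s. (g k \<omega> s)\<^sup>2 \<partial>M)"
        using M.variance_eq[OF i sq] by (simp add: G_def)
      then show ?thesis using sq by (subst nn_integral_eq_integral) (auto simp: ennreal_leI)
    qed simp
    then have "(\<integral>\<^sup>+\<omega>. ennreal ((G k \<omega>)\<^sup>2) \<partial>P) \<le> (\<integral>\<^sup>+\<omega>. \<integral>\<^sup>+s. ennreal ((g k \<omega> s)\<^sup>2) \<partial>M \<partial>P)"
      by (rule nn_integral_mono)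
    with bound[of k] show ?thesis by (rule order_trans[rotated])
  qed
  have h_sq: "integrable P (\<lambda>\<omega>. (h k \<omega>)\<^sup>2)" and G_sq: "integrable P (\<lambda>\<omega>. (G k \<omega>)\<^sup>2)" for k
    using h2[of k] G2[of k] hP[of k] GP[of k]
    by (auto intro!: integrableI_nonneg elim: le_less_trans)
  note prod_int = integrable_mult_of_squares[where M=P]
  have diff_eq: "(\<lambda>\<omega>. (h k \<omega> - G k \<omega>)\<^sup>2) = (\<lambda>\<omega>. (h k \<omega>)\<^sup>2 + (G k \<omega>)\<^sup>2 - 2 * (h k \<omega> * G k \<omega>))" for k
    by (simp add: power2_diff algebra_simps)
  have m_sq: "integrable P (\<lambda>\<omega>. (h k \<omega> - G k \<omega>)\<^sup>2)" for k
    unfolding diff_eq using h_sq G_sq prod_int[OF hP h_sq GP G_sq] by simp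
  have e_bound: "(\<integral>\<omega>. (h k \<omega> - G k \<omega>)\<^sup>2 \<partial>P) \<le> 4 * e k" for k
  proof -
    have *: "(\<integral>\<omega>. (h k \<omega>)\<^sup>2 \<partial>P) \<le> e k" "(\<integral>\<omega>. (G k \<omega>)\<^sup>2 \<partial>P) \<le> e k"
      using h2[of k] G2[of k] h_sq[of k] G_sq[of k]
      by (auto simp: nn_integral_eq_integral e)
    have "(\<integral>\<omega>. (h k \<omega> - G k \<omega>)\<^sup>2 \<partial>P) \<le> (\<integral>\<omega>. 2 * (h k \<omega>)\<^sup>2 + 2 * (G k \<omega>)\<^sup>2 \<partial>P)"
    proof (rule integral_mono[OF m_sq])
      show "integrable P (\<lambda>\<omega>. 2 * (h k \<omega>)\<^sup>2 + 2 * (G k \<omega>)\<^sup>2)" using h_sq G_sq by simp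
      fix \<omega>
      have "0 \<le> (h k \<omega> + G k \<omega>)\<^sup>2" by simp
      then show "(h k \<omega> - G k \<omega>)\<^sup>2 \<le> 2 * (h k \<omega>)\<^sup>2 + 2 * (G k \<omega>)\<^sup>2"
        by (simp add: power2_sum power2_diff)
    qed
    also have "\<dots> = 2 * (\<integral>\<omega>. (h k \<omega>)\<^sup>2 \<partial>P) + 2 * (\<integral>\<omega>. (G k \<omega>)\<^sup>2 \<partial>P)" using h_sq G_sq by simp
    finally show ?thesis using * by simp
  qed
  have "AE \<omega> in P. summable (\<lambda>k. h k \<omega> - G k \<omega>)"
  proof (rule P.orthogonal_increments_converge[where F=F, OF sub step])
    show "(\<lambda>\<omega>. h k \<omega> - G k \<omega>) \<in> borel_measurable (F (Suc k))" for k
      using hF[of k] measurable_from_subalg[OF step GF[of k]] by measurable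
    show "integrable P (\<lambda>\<omega>. (h k \<omega> - G k \<omega>)\<^sup>2)" for k by (rule m_sq)
    show "summable (\<lambda>k. \<integral>\<omega>. (h k \<omega> - G k \<omega>)\<^sup>2 \<partial>P)"
    proof (rule summable_comparison_test')
      show "summable (\<lambda>k. 4 * e k)" using e by (intro summable_mult)
      show "norm (\<integral>\<omega>. (h k \<omega> - G k \<omega>)\<^sup>2 \<partial>P) \<le> 4 * e k" if "k \<ge> 0" for k
        using e_bound[of k] by simp
    qed
    fix k and Z :: "'w \<Rightarrow> real" assume ZF: "Z \<in> borel_measurable (F k)" and Z2: "integrable P (\<lambda>\<omega>. (Z \<omega>)\<^sup>2)"
    have ZP: "Z \<in> borel_measurable P" using measurable_from_subalg[OF sub ZF] .
    have ih: "integrable P (\<lambda>\<omega>. Z \<omega> * h k \<omega>)" and iG: "integrable P (\<lambda>\<omega>. Z \<omega> * G k \<omega>)"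
      using prod_int[OF ZP Z2] hP h_sq GP G_sq by auto
    have "(\<lambda>(\<omega>, s). Z \<omega> * g k \<omega> s) \<in> borel_measurable (F k \<Otimes>\<^sub>M M)"
      using g[of k] ZF by (simp add: case_prod_unfold)
    from integral_innov[OF this] ih have "(\<integral>\<omega>. Z \<omega> * h k \<omega> \<partial>P) = (\<integral>\<omega>. Z \<omega> * G k \<omega> \<partial>P)"
      by (simp add: h_def G_def)
    then show "(\<integral>\<omega>. Z \<omega> * (h k \<omega> - G k \<omega>) \<partial>P) = 0"
      using ih iG by (simp add: right_diff_distrib)
  qed
  then show ?thesis by (simp add: h_def G_def)
qed

end

text \<open>
  It is enough to compare the joint law with the product on rectangles, and there independence of the
  disjoint blocks \<open>{1..k}\<close> and \<open>{Suc k}\<close> of the family gives the factorization.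
\<close>

lemma (in prob_space) iid_innovation:
  assumes N: "prob_space N"
    and ind: "indep_vars (\<lambda>_. N) \<xi> {1..}" and law: "\<And>n. n \<ge> 1 \<Longrightarrow> distr M N (\<xi> n) = N"
  shows "innovation M N (\<lambda>k. vimage_algebra (space M) (\<lambda>\<omega>. \<lambda>i\<in>{1..k}. \<xi> i \<omega>) (PiM {1..k} (\<lambda>_. N))) \<xi>"
proof -
  interpret N: prob_space N by (rule N)
  define H where "H k \<omega> = (\<lambda>i\<in>{1..k}. \<xi> i \<omega>)" for k :: nat and \<omega>
  define S where "S k = PiM {1..k} (\<lambda>_::nat. N)" for k
  define F where "F k = vimage_algebra (space M) (H k) (S k)" for k
  have meas: "\<xi> i \<in> measurable M N" if "i \<ge> 1" for i
    using ind that by (auto simp: indep_vars_def)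
  have H: "H k \<in> measurable M (S k)" for k
    unfolding H_def S_def by (intro measurable_restrict meas) auto
  have HF: "H k \<in> measurable (F k) (S k)" for k
    unfolding F_def using H[of k] by (intro measurable_vimage_algebra1) (auto dest: measurable_space)
  have coord: "\<xi> i \<in> measurable (F k) N" if "i \<in> {1..k}" for i k
  proof -
    have "(\<lambda>\<omega>. H k \<omega> i) \<in> measurable (F k) N"
      using measurable_compose[OF HF[of k, unfolded S_def] measurable_component_singleton[OF that]] by simp
    then show ?thesis using that by (simp add: H_def)
  qed
  have sets_F: "sets (F k) = {H k -` A \<inter> space M | A. A \<in> sets (S k)}" for k
    unfolding F_def using H[of k] by (intro sets_vimage_algebra2) (auto dest: measurable_space)
  have sub: "subalgebra M (F k)" for k
    unfolding subalgebra_def using sets_F H by (auto simp: F_def intro: measurable_sets)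
  have step: "subalgebra (F (Suc k)) (F k)" for k
  proof -
    have "H k \<in> measurable (F (Suc k)) (S k)"
      unfolding H_def S_def by (intro measurable_restrict coord) auto
    then show ?thesis
      unfolding subalgebra_def using sets_F[of k] by (auto simp: F_def dest!: measurable_sets)
  qed
  have id: "(\<lambda>\<omega>. \<omega>) \<in> measurable M (F k)" for k
    using measurable_from_subalg[OF sub measurable_ident] by (simp add: id_def)
  have joint: "distr M (F k) (\<lambda>\<omega>. \<omega>) \<Otimes>\<^sub>M N = distr M (F k \<Otimes>\<^sub>M N) (\<lambda>\<omega>. (\<omega>, \<xi> (Suc k) \<omega>))" for k
  proof (rule pair_measure_eqI)
    let ?D = "distr M (F k) (\<lambda>\<omega>. \<omega>)" and ?T = "PiM {Suc k} (\<lambda>_. N)"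
    have pm: "(\<lambda>\<omega>. (\<omega>, \<xi> (Suc k) \<omega>)) \<in> measurable M (F k \<Otimes>\<^sub>M N)"
      using id meas by (intro measurable_Pair) auto
    interpret D: prob_space ?D using id by (rule prob_space_distr)
    show "sigma_finite_measure ?D" ..
    show "sigma_finite_measure N" ..
    show "sets (?D \<Otimes>\<^sub>M N) = sets (distr M (F k \<Otimes>\<^sub>M N) (\<lambda>\<omega>. (\<omega>, \<xi> (Suc k) \<omega>)))"
      by (simp cong: sets_pair_measure_cong)
    fix A B assume A: "A \<in> sets ?D" and B: "B \<in> sets N"
    obtain A' where A': "A' \<in> sets (S k)" "A = H k -` A' \<inter> space M"
      using A sets_F by auto
    define B' where "B' = (\<lambda>f. f (Suc k)) -` B \<inter> space ?T"
    have B': "B' \<in> sets ?T"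
      unfolding B'_def using B by (intro measurable_sets[OF measurable_component_singleton]) auto
    let ?Y = "\<lambda>\<omega>. restrict (\<lambda>i. \<xi> i \<omega>) {Suc k}"
    have Ysp: "?Y \<omega> \<in> space ?T" if "\<omega> \<in> space M" for \<omega>
      using that meas[of "Suc k"] by (auto simp: space_PiM dest: measurable_space)
    have YB: "?Y -` B' \<inter> space M = \<xi> (Suc k) -` B \<inter> space M"
      unfolding B'_def using Ysp by auto
    have "indep_var (S k) (H k) ?T ?Y"
      unfolding S_def H_def using indep_var_restrict[OF ind, of "{1..k}" "{Suc k}"] by auto
    from indep_varD[OF this A'(1) B']
    have eq: "prob (A \<inter> (\<xi> (Suc k) -` B \<inter> space M)) = prob A * prob (\<xi> (Suc k) -` B \<inter> space M)"
      unfolding YB[symmetric] A'(2) by (simp add: vimage_def Int_def conj_ac)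
    have "emeasure N B = emeasure (distr M N (\<xi> (Suc k))) B" using law by simp
    then have NB: "emeasure N B = emeasure M (\<xi> (Suc k) -` B \<inter> space M)"
      using B meas by (simp add: emeasure_distr)
    have AM: "A \<subseteq> space M" unfolding A'(2) by auto
    have "emeasure (distr M (F k \<Otimes>\<^sub>M N) (\<lambda>\<omega>. (\<omega>, \<xi> (Suc k) \<omega>))) (A \<times> B)
        = emeasure M ((\<lambda>\<omega>. (\<omega>, \<xi> (Suc k) \<omega>)) -` (A \<times> B) \<inter> space M)"
      using A B by (intro emeasure_distr[OF pm]) auto
    also have "(\<lambda>\<omega>. (\<omega>, \<xi> (Suc k) \<omega>)) -` (A \<times> B) \<inter> space M = A \<inter> (\<xi> (Suc k) -` B \<inter> space M)"
      by auto
    finally show "emeasure ?D A * emeasure N B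
        = emeasure (distr M (F k \<Otimes>\<^sub>M N) (\<lambda>\<omega>. (\<omega>, \<xi> (Suc k) \<omega>))) (A \<times> B)"
      using A AM id[of k] by (simp add: NB emeasure_distr Int_absorb2 emeasure_eq_measure eq ennreal_mult)
  qed
  have "innovation M N F \<xi>"
    by unfold_locales (use sub step joint coord in auto)
  then show ?thesis by (simp add: F_def[abs_def] H_def[abs_def] S_def)
qed

section \<open>The stochastic proximal point iteration\<close>

text \<open>
  A Caratheodory function is jointly measurable: it is the limit of the functions obtained by
  approximating the second argument by simple functions of it.
\<close>

lemma borel_measurable_Caratheodory:
  fixes f :: "'s \<Rightarrow> 'a::{metric_space, second_countable_topology} \<Rightarrow> 'b::metric_space"
  assumes meas: "\<And>x. (\<lambda>s. f s x) \<in> borel_measurable M"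
    and cont: "\<And>s. s \<in> space M \<Longrightarrow> continuous_on UNIV (f s)"
  shows "(\<lambda>(x, s). f s x) \<in> borel_measurable (borel \<Otimes>\<^sub>M M)"
proof -
  obtain r :: "nat \<Rightarrow> 'a \<Rightarrow> 'a" where r: "\<And>i. simple_function borel (r i)" "\<And>x. (\<lambda>i. r i x) \<longlonglongrightarrow> x"
    using borel_measurable_implies_sequence_metric[of "\<lambda>x. x" borel undefined] by auto
  have m: "(\<lambda>(x, s). f s (r i x)) \<in> borel_measurable (borel \<Otimes>\<^sub>M M)" for i
  proof -
    have "finite (range (r i))" and "r i \<in> measurable borel (count_space (range (r i)))"
      using r(1)[of i] by (auto simp: simple_function_def measurable_count_space_eq2)
    moreover have "(\<lambda>y. f (snd y) x) \<in> borel_measurable (borel \<Otimes>\<^sub>M M)" for x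
      using measurable_compose[OF measurable_snd meas] .
    ultimately have "(\<lambda>y. f (snd y) (r i (fst y))) \<in> borel_measurable (borel \<Otimes>\<^sub>M M)"
      by (intro measurable_compose_countable'[where f="\<lambda>x y. f (snd y) x" and g="\<lambda>y. r i (fst y)"
            and I="range (r i)"] measurable_compose[OF measurable_fst] countable_finite) auto
    then show ?thesis by (simp add: case_prod_unfold)
  qed
  show ?thesis
  proof (rule borel_measurable_LIMSEQ_metric[OF m])
    fix y :: "'a \<times> 's" assume y: "y \<in> space (borel \<Otimes>\<^sub>M M)"
    obtain x s where xs: "y = (x, s)" by (cases y)
    have "isCont (f s) x" using cont[of s] y xs by (simp add: continuous_on_eq_continuous_at space_pair_measure)
    then have "(\<lambda>i. f s (r i x)) \<longlonglongrightarrow> f s x" using r(2) by (rule isCont_tendsto_compose)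
    then show "(\<lambda>i. case y of (x, s) \<Rightarrow> f s (r i x)) \<longlonglongrightarrow> (case y of (x, s) \<Rightarrow> f s x)" by (simp add: xs)
  qed
qed

lemma AE_summable_of_nn_integral:
  fixes f :: "nat \<Rightarrow> 'a \<Rightarrow> real"
  assumes f: "\<And>k. f k \<in> borel_measurable M" "\<And>k \<omega>. 0 \<le> f k \<omega>"
    and bound: "\<And>k. (\<integral>\<^sup>+\<omega>. ennreal (f k \<omega>) \<partial>M) \<le> ennreal (e k)" and e: "summable e" "\<And>k. 0 \<le> e k"
  shows "AE \<omega> in M. summable (\<lambda>k. f k \<omega>)"
proof -
  have m: "(\<lambda>\<omega>. ennreal (f k \<omega>)) \<in> borel_measurable M" for k using f(1)[of k] by measurable
  have "(\<integral>\<^sup>+\<omega>. (\<Sum>k. ennreal (f k \<omega>)) \<partial>M) = (\<Sum>k. \<integral>\<^sup>+\<omega>. ennreal (f k \<omega>) \<partial>M)"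
    by (rule nn_integral_suminf[OF m])
  also have "\<dots> \<le> (\<Sum>k. ennreal (e k))" by (intro suminf_le bound) auto
  also have "\<dots> = ennreal (suminf e)" using e by (intro suminf_ennreal2) auto
  finally have "(\<integral>\<^sup>+\<omega>. (\<Sum>k. ennreal (f k \<omega>)) \<partial>M) \<noteq> \<infinity>" by (auto simp: top_unique)
  then have "AE \<omega> in M. (\<Sum>k. ennreal (f k \<omega>)) \<noteq> \<infinity>"
    using m by (intro nn_integral_PInf_AE) auto
  then show ?thesis
    by eventually_elim (use f(2) in \<open>auto intro: summable_suminf_not_top\<close>)
qed

text \<open>
  Maximal monotonicity for every \<open>s\<close> makes the resolvents continuous in \<open>x\<close> for every \<open>s\<close>, hence jointly
  measurable, and so makes the iterates measurable.
\<close>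

locale prox_walk = innovation P M F \<xi>
  for P :: "'w measure" and M :: "'s measure" and F :: "nat \<Rightarrow> 'w measure" and \<xi> :: "nat \<Rightarrow> 'w \<Rightarrow> 's" +
  fixes A :: "'s \<Rightarrow> 'h \<Rightarrow> 'h::{real_inner, banach, second_countable_topology} set"
    and lam :: "nat \<Rightarrow> real" and x0 :: 'h
  assumes mm: "\<And>s. maximal_monotone (A s)"
    and J_meas: "\<And>l x. l > 0 \<Longrightarrow> (\<lambda>s. resolvent (A s) l x) \<in> borel_measurable M"
    and lam_pos: "\<And>n. lam n > 0"
    and lam_sq: "summable (\<lambda>n. (lam n)\<^sup>2)"
begin

abbreviation J :: "real \<Rightarrow> 's \<Rightarrow> 'h \<Rightarrow> 'h" where "J l s x \<equiv> resolvent (A s) l x"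

abbreviation X :: "nat \<Rightarrow> 'w \<Rightarrow> 'h" where "X \<equiv> prox_iter A lam \<xi> x0"

text \<open>
  The exceptional set is contained in a measurable null set, and \<open>AE_innov\<close> applies to its complement.
\<close>

lemma AE_innov_noise:
  assumes "AE s in M. Q s"
  shows "AE \<omega> in P. Q (\<xi> (Suc k) \<omega>)"
proof -
  obtain N where N: "{s\<in>space M. \<not> Q s} \<subseteq> N" "N \<in> null_sets M"
    using assms by (auto elim: AE_E simp: null_sets_def)
  have "AE \<omega> in P. \<xi> (Suc k) \<omega> \<notin> N"
  proof (rule AE_innov)
    show "Measurable.pred (F k \<Otimes>\<^sub>M M) (\<lambda>(\<omega>, s). s \<notin> N)"
    proof -
      have [measurable]: "N \<in> sets M" using N(2) by (rule null_setsD2)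
      show ?thesis unfolding case_prod_unfold by measurable
    qed
    show "AE s in M. s \<notin> N" using N(2) by (rule AE_not_in)
  qed
  with AE_space show ?thesis
    by eventually_elim (use N(1) innov_P[of k] in \<open>auto dest: measurable_space\<close>)
qed

lemma J_joint: "l > 0 \<Longrightarrow> (\<lambda>(x, s). J l s x) \<in> borel_measurable (borel \<Otimes>\<^sub>M M)"
proof (rule borel_measurable_Caratheodory[OF J_meas])
  fix s assume l: "l > 0"
  have "1-lipschitz_on UNIV (J l s)"
    by (rule lipschitz_onI) (simp_all add: dist_norm resolvent_nonexpansive[OF mm l])
  then show "continuous_on UNIV (J l s)" by (rule lipschitz_on_continuous_on)
qed

lemma J_step_meas:
  assumes "Y \<in> borel_measurable (F k)" "l > 0"
  shows "(\<lambda>(\<omega>, s). J l s (Y \<omega>)) \<in> borel_measurable (F k \<Otimes>\<^sub>M M)"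
proof -
  have "(\<lambda>x. (Y (fst x), snd x)) \<in> measurable (F k \<Otimes>\<^sub>M M) (borel \<Otimes>\<^sub>M M)"
    using measurable_compose[OF measurable_fst assms(1)] by (intro measurable_Pair) auto
  from measurable_compose[OF this J_joint[OF assms(2)]] show ?thesis by (simp add: case_prod_unfold)
qed

lemma X_meas: "X k \<in> borel_measurable (F k)"
proof (induction k)
  case 0
  then show ?case by simp
next
  case (Suc k)
  have "(\<lambda>\<omega>. (\<omega>, \<xi> (Suc k) \<omega>)) \<in> measurable (F (Suc k)) (F k \<Otimes>\<^sub>M M)"
    using measurable_from_subalg[OF step[of k] measurable_ident] innov[of k]
    by (intro measurable_Pair) (auto simp: id_def)
  from measurable_compose[OF this J_step_meas[OF Suc lam_pos[of k]]]
  show ?case by simp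
qed

lemma X_meas_P: "X k \<in> borel_measurable P"
  using measurable_from_subalg[OF sub X_meas] .

lemma fst_meas: "f \<in> borel_measurable (F k) \<Longrightarrow> (\<lambda>(\<omega>, s). f \<omega>) \<in> borel_measurable (F k \<Otimes>\<^sub>M M)"
  using measurable_compose[OF measurable_fst, of f "F k" borel M] by (simp add: case_prod_unfold)

lemma snd_meas: "f \<in> borel_measurable M \<Longrightarrow> (\<lambda>(\<omega>, s). f s) \<in> borel_measurable (F k \<Otimes>\<^sub>M M)"
  using measurable_compose[OF measurable_snd, of f M borel "F k"] by (simp add: case_prod_unfold)

lemma J_second_moment:
  assumes \<phi>: "\<phi> \<in> borel_measurable M" "AE s in M. \<phi> s \<in> A s z" "integrable M (\<lambda>s. (norm (\<phi> s))\<^sup>2)" "(\<integral>s. \<phi> s \<partial>M) = 0"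
    and l: "l > 0"
  shows "(\<integral>\<^sup>+s. ennreal ((norm (J l s x - z))\<^sup>2) \<partial>M) \<le> ennreal ((norm (x - z))\<^sup>2 + l\<^sup>2 * (\<integral>s. (norm (\<phi> s))\<^sup>2 \<partial>M))"
proof -
  have i: "integrable M \<phi>"
    using M.square_integrable_imp_integrable[of "\<lambda>s. norm (\<phi> s)"] \<phi>(1,3) by (simp add: integrable_norm_iff)
  let ?f = "\<lambda>s. (norm (x - z))\<^sup>2 - 2 * l * (\<phi> s \<bullet> (x - z)) + l\<^sup>2 * (norm (\<phi> s))\<^sup>2"
  have "AE s in M. (norm (J l s x - z))\<^sup>2 \<le> ?f s"
    using \<phi>(2) by eventually_elim (rule resolvent_step[OF mm l])
  then have le: "AE s in M. (norm (J l s x - z))\<^sup>2 \<le> ?f s" .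
  have fi: "integrable M ?f"
    using i \<phi>(3) by (intro Bochner_Integration.integrable_add Bochner_Integration.integrable_diff
        integrable_mult_right integrable_inner_left) auto
  have "(\<integral>\<^sup>+s. ennreal ((norm (J l s x - z))\<^sup>2) \<partial>M) \<le> (\<integral>\<^sup>+s. ennreal (?f s) \<partial>M)"
    using le by (intro nn_integral_mono_AE) (auto elim!: eventually_mono intro!: ennreal_leI)
  also have "\<dots> = ennreal (\<integral>s. ?f s \<partial>M)"
  proof (rule nn_integral_eq_integral[OF fi])
    show "AE s in M. 0 \<le> ?f s" using le by eventually_elim (rule order_trans[OF zero_le_power2])
  qed
  also have "(\<integral>s. ?f s \<partial>M) = (norm (x - z))\<^sup>2 + l\<^sup>2 * (\<integral>s. (norm (\<phi> s))\<^sup>2 \<partial>M)"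
    using i \<phi>(3) by (simp add: \<phi>(4) M.prob_space)
  finally show ?thesis .
qed

text \<open>
  Given the past, the term of first order in \<open>resolvent_step\<close> has mean \<open>0\<close>, and the terms of second order
  have a finite sum in mean.
\<close>

lemma X_second_moment:
  assumes \<phi>: "\<phi> \<in> borel_measurable M" "AE s in M. \<phi> s \<in> A s z" "integrable M (\<lambda>s. (norm (\<phi> s))\<^sup>2)" "(\<integral>s. \<phi> s \<partial>M) = 0"
  obtains B where "0 \<le> B" "\<And>k. (\<integral>\<^sup>+\<omega>. ennreal ((norm (X k \<omega> - z))\<^sup>2) \<partial>P) \<le> ennreal B"
proof -
  define v where "v = (\<integral>s. (norm (\<phi> s))\<^sup>2 \<partial>M)"
  have v: "0 \<le> v" by (simp add: v_def)
  have bnd: "(\<integral>\<^sup>+\<omega>. ennreal ((norm (X k \<omega> - z))\<^sup>2) \<partial>P) \<le> ennreal ((norm (x0 - z))\<^sup>2 + (\<Sum>j<k. (lam j)\<^sup>2 * v))" for k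
  proof (induction k)
    case 0
    then show ?case by (simp add: P.emeasure_space_1)
  next
    case (Suc k)
    have "(\<lambda>(\<omega>, s). J (lam k) s (X k \<omega>)) \<in> borel_measurable (F k \<Otimes>\<^sub>M M)"
      by (rule J_step_meas[OF X_meas lam_pos])
    then have m: "(\<lambda>(\<omega>, s). ennreal ((norm (J (lam k) s (X k \<omega>) - z))\<^sup>2)) \<in> borel_measurable (F k \<Otimes>\<^sub>M M)"
      unfolding case_prod_unfold by measurable
    have "(\<integral>\<^sup>+\<omega>. ennreal ((norm (X (Suc k) \<omega> - z))\<^sup>2) \<partial>P)
        = (\<integral>\<^sup>+\<omega>. \<integral>\<^sup>+s. ennreal ((norm (J (lam k) s (X k \<omega>) - z))\<^sup>2) \<partial>M \<partial>P)"
      using nn_integral_innov[OF m] by simp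
    also have "\<dots> \<le> (\<integral>\<^sup>+\<omega>. ennreal ((norm (X k \<omega> - z))\<^sup>2) + ennreal ((lam k)\<^sup>2 * v) \<partial>P)"
    proof (rule nn_integral_mono)
      fix \<omega>
      show "(\<integral>\<^sup>+s. ennreal ((norm (J (lam k) s (X k \<omega>) - z))\<^sup>2) \<partial>M) \<le> ennreal ((norm (X k \<omega> - z))\<^sup>2) + ennreal ((lam k)\<^sup>2 * v)"
        using J_second_moment[OF \<phi> lam_pos[of k], of "X k \<omega>"] v by (simp add: v_def)
    qed
    also have "\<dots> = (\<integral>\<^sup>+\<omega>. ennreal ((norm (X k \<omega> - z))\<^sup>2) \<partial>P) + ennreal ((lam k)\<^sup>2 * v)"
      using X_meas_P[of k] by (subst nn_integral_add) (auto simp: P.emeasure_space_1)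
    also have "\<dots> \<le> ennreal ((norm (x0 - z))\<^sup>2 + (\<Sum>j<k. (lam j)\<^sup>2 * v)) + ennreal ((lam k)\<^sup>2 * v)"
      by (intro add_mono Suc order_refl)
    also have "\<dots> = ennreal ((norm (x0 - z))\<^sup>2 + (\<Sum>j<Suc k. (lam j)\<^sup>2 * v))"
      using v by (subst ennreal_plus[symmetric]) (auto intro!: add_nonneg_nonneg sum_nonneg simp: add.assoc)
    finally show ?case .
  qed
  define B where "B = (norm (x0 - z))\<^sup>2 + (\<Sum>j. (lam j)\<^sup>2 * v)"
  have sm: "summable (\<lambda>j. (lam j)\<^sup>2 * v)" using lam_sq by (rule summable_mult2)
  show ?thesis
  proof (rule that)
    show "0 \<le> B" unfolding B_def using v sm by (intro add_nonneg_nonneg suminf_nonneg) auto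
    fix k
    have "(\<Sum>j<k. (lam j)\<^sup>2 * v) \<le> (\<Sum>j. (lam j)\<^sup>2 * v)" using v sm by (intro sum_le_suminf) auto
    then show "(\<integral>\<^sup>+\<omega>. ennreal ((norm (X k \<omega> - z))\<^sup>2) \<partial>P) \<le> ennreal B"
      using bnd[of k] by (elim order_trans) (auto simp: B_def intro!: ennreal_leI)
  qed
qed

text \<open>
  The iterates are almost Fejer monotone with respect to zeros that have a square integrable selection
  of mean zero: in \<open>resolvent_step\<close> the terms of first order form a convergent martingale, since the
  second moments of \<open>X k - z\<close> are bounded.
\<close>

lemma AE_dist_zero_converges:
  assumes \<phi>: "\<phi> \<in> borel_measurable M" "AE s in M. \<phi> s \<in> A s z" "integrable M (\<lambda>s. (norm (\<phi> s))\<^sup>2)" "(\<integral>s. \<phi> s \<partial>M) = 0"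
  shows "AE \<omega> in P. convergent (\<lambda>k. norm (X k \<omega> - z))"
proof -
  obtain B where B: "0 \<le> B" "\<And>k. (\<integral>\<^sup>+\<omega>. ennreal ((norm (X k \<omega> - z))\<^sup>2) \<partial>P) \<le> ennreal B"
    using X_second_moment[OF \<phi>] by blast
  define v where "v = (\<integral>s. (norm (\<phi> s))\<^sup>2 \<partial>M)"
  have v: "0 \<le> v" by (simp add: v_def)
  have v': "(\<integral>\<^sup>+s. ennreal ((norm (\<phi> s))\<^sup>2) \<partial>M) = ennreal v"
    unfolding v_def by (rule nn_integral_eq_integral[OF \<phi>(3)]) simp
  have i: "integrable M \<phi>"
    using M.square_integrable_imp_integrable[of "\<lambda>s. norm (\<phi> s)"] \<phi>(1,3) by (simp add: integrable_norm_iff)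
  define g where "g k \<omega> s = lam k * (\<phi> s \<bullet> (X k \<omega> - z))" for k \<omega> s
  have gm: "(\<lambda>(\<omega>, s). g k \<omega> s) \<in> borel_measurable (F k \<Otimes>\<^sub>M M)" for k
    using fst_meas[OF X_meas[of k]] snd_meas[OF \<phi>(1), of k] unfolding g_def case_prod_unfold by measurable
  have gb: "(\<integral>\<^sup>+\<omega>. \<integral>\<^sup>+s. ennreal ((g k \<omega> s)\<^sup>2) \<partial>M \<partial>P) \<le> ennreal ((lam k)\<^sup>2 * (v * B))" for k
  proof -
    have "(\<integral>\<^sup>+s. ennreal ((g k \<omega> s)\<^sup>2) \<partial>M) \<le> ennreal ((lam k)\<^sup>2 * v) * ennreal ((norm (X k \<omega> - z))\<^sup>2)" for \<omega>
    proof -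
      have "(\<integral>\<^sup>+s. ennreal ((g k \<omega> s)\<^sup>2) \<partial>M)
          \<le> (\<integral>\<^sup>+s. ennreal ((lam k)\<^sup>2 * (norm (X k \<omega> - z))\<^sup>2) * ennreal ((norm (\<phi> s))\<^sup>2) \<partial>M)"
      proof (rule nn_integral_mono)
        fix s
        have "(\<phi> s \<bullet> (X k \<omega> - z))\<^sup>2 \<le> (norm (\<phi> s) * norm (X k \<omega> - z))\<^sup>2"
          using Cauchy_Schwarz_ineq2 by (rule power2_le_iff_abs_le[THEN iffD2, rotated]) auto
        then have "(g k \<omega> s)\<^sup>2 \<le> (lam k)\<^sup>2 * (norm (\<phi> s) * norm (X k \<omega> - z))\<^sup>2"
          unfolding g_def power_mult_distrib[of "lam k"] by (intro mult_left_mono) auto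
        then show "ennreal ((g k \<omega> s)\<^sup>2) \<le> ennreal ((lam k)\<^sup>2 * (norm (X k \<omega> - z))\<^sup>2) * ennreal ((norm (\<phi> s))\<^sup>2)"
          by (subst ennreal_mult[symmetric]) (auto intro!: ennreal_leI simp: power_mult_distrib ac_simps)
      qed
      also have "\<dots> = ennreal ((lam k)\<^sup>2 * (norm (X k \<omega> - z))\<^sup>2) * ennreal v"
        using \<phi>(1) by (subst nn_integral_cmult) (auto simp: v')
      also have "\<dots> = ennreal ((lam k)\<^sup>2 * v) * ennreal ((norm (X k \<omega> - z))\<^sup>2)"
        using v by (simp add: ennreal_mult ac_simps)
      finally show ?thesis .
    qed
    then have "(\<integral>\<^sup>+\<omega>. \<integral>\<^sup>+s. ennreal ((g k \<omega> s)\<^sup>2) \<partial>M \<partial>P)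
        \<le> (\<integral>\<^sup>+\<omega>. ennreal ((lam k)\<^sup>2 * v) * ennreal ((norm (X k \<omega> - z))\<^sup>2) \<partial>P)"
      by (rule nn_integral_mono)
    also have "\<dots> = ennreal ((lam k)\<^sup>2 * v) * (\<integral>\<^sup>+\<omega>. ennreal ((norm (X k \<omega> - z))\<^sup>2) \<partial>P)"
      using X_meas_P[of k] by (intro nn_integral_cmult) auto
    also have "\<dots> \<le> ennreal ((lam k)\<^sup>2 * v) * ennreal B" using B(2) by (intro mult_left_mono) auto
    also have "\<dots> = ennreal ((lam k)\<^sup>2 * (v * B))" using v B(1) by (simp add: ennreal_mult ac_simps)
    finally show ?thesis .
  qed
  have "AE \<omega> in P. summable (\<lambda>k. g k \<omega> (\<xi> (Suc k) \<omega>) - (\<integral>s. g k \<omega> s \<partial>M))"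
    by (rule centred_sums_converge[OF gm gb]) (use v B lam_sq in \<open>auto intro: summable_mult2\<close>)
  moreover have "(\<integral>s. g k \<omega> s \<partial>M) = 0" for k \<omega>
    unfolding g_def using i \<phi>(4) by simp
  ultimately have m: "AE \<omega> in P. summable (\<lambda>k. g k \<omega> (\<xi> (Suc k) \<omega>))" by simp
  have b: "AE \<omega> in P. summable (\<lambda>k. (lam k)\<^sup>2 * (norm (\<phi> (\<xi> (Suc k) \<omega>)))\<^sup>2)"
  proof (rule AE_summable_of_nn_integral)
    show "(\<lambda>\<omega>. (lam k)\<^sup>2 * (norm (\<phi> (\<xi> (Suc k) \<omega>)))\<^sup>2) \<in> borel_measurable P" for k
      using measurable_compose[OF innov_P[of k] \<phi>(1)] by measurable
    show "summable (\<lambda>k. (lam k)\<^sup>2 * v)" using lam_sq by (rule summable_mult2)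
    fix k
    have m: "(\<lambda>(\<omega>, s). ennreal ((lam k)\<^sup>2) * ennreal ((norm (\<phi> s))\<^sup>2)) \<in> borel_measurable (F k \<Otimes>\<^sub>M M)"
      using snd_meas[OF \<phi>(1), of k] unfolding case_prod_unfold by measurable
    have "(\<integral>\<^sup>+\<omega>. ennreal ((lam k)\<^sup>2 * (norm (\<phi> (\<xi> (Suc k) \<omega>)))\<^sup>2) \<partial>P)
      = (\<integral>\<^sup>+\<omega>. \<integral>\<^sup>+s. ennreal ((lam k)\<^sup>2) * ennreal ((norm (\<phi> s))\<^sup>2) \<partial>M \<partial>P)"
      using nn_integral_innov[OF m] by (simp add: ennreal_mult)
    also have "\<dots> = ennreal ((lam k)\<^sup>2 * v)"
      using \<phi>(1) v by (subst nn_integral_cmult) (auto simp: v' P.emeasure_space_1 ennreal_mult)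
    finally show "(\<integral>\<^sup>+\<omega>. ennreal ((lam k)\<^sup>2 * (norm (\<phi> (\<xi> (Suc k) \<omega>)))\<^sup>2) \<partial>P) \<le> ennreal ((lam k)\<^sup>2 * v)" by simp
  qed (use v in auto)
  have "AE \<omega> in P. \<forall>k. \<phi> (\<xi> (Suc k) \<omega>) \<in> A (\<xi> (Suc k) \<omega>) z"
    unfolding AE_all_countable using AE_innov_noise[OF \<phi>(2)] by blast
  with m b show ?thesis
  proof eventually_elim
    case (elim \<omega>)
    have "convergent (\<lambda>k. (norm (X k \<omega> - z))\<^sup>2)"
    proof (rule convergent_almost_decreasing)
      show "(norm (X (Suc k) \<omega> - z))\<^sup>2 \<le> (norm (X k \<omega> - z))\<^sup>2 - 2 * g k \<omega> (\<xi> (Suc k) \<omega>)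
          + (lam k)\<^sup>2 * (norm (\<phi> (\<xi> (Suc k) \<omega>)))\<^sup>2" for k
        using resolvent_step[OF mm lam_pos, of "\<phi> (\<xi> (Suc k) \<omega>)" "\<xi> (Suc k) \<omega>" z k "X k \<omega>"] elim(3)
        by (simp add: g_def)
      show "summable (\<lambda>k. 2 * g k \<omega> (\<xi> (Suc k) \<omega>))" using elim(1) by (rule summable_mult)
    qed (use elim(2) in auto)
    then obtain l where "(\<lambda>k. (norm (X k \<omega> - z))\<^sup>2) \<longlonglongrightarrow> l" by (auto simp: convergent_def)
    from tendsto_real_sqrt[OF this] show ?case by (auto simp: convergent_def)
  qed
qed

end

section \<open>Distance of the iterates to the essential domain\<close>

lemma infdist_minimizing_sequence:
  assumes "D \<noteq> {}"
  obtains y where "\<And>n::nat. y n \<in> D" "(\<lambda>n. norm (x - y n)) \<longlonglongrightarrow> infdist x D"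
proof -
  have "\<exists>y\<in>D. dist x y < infdist x D + 1 / real (Suc n)" for n
  proof -
    have "(INF a\<in>D. dist x a) < infdist x D + 1 / real (Suc n)"
      using infdist_notempty[OF assms, of x] by simp
    then show ?thesis using cInf_lessD[of "dist x ` D"] assms by blast
  qed
  then obtain y where y: "\<And>n. y n \<in> D" "\<And>n. dist x (y n) < infdist x D + 1 / real (Suc n)" by metis
  have "(\<lambda>n. infdist x D + 1 / real (Suc n)) \<longlonglongrightarrow> infdist x D + 0"
    using LIMSEQ_inverse_real_of_nat by (intro tendsto_intros) (simp add: inverse_eq_divide)
  then have lim: "(\<lambda>n. infdist x D + 1 / real (Suc n)) \<longlonglongrightarrow> infdist x D" by simp
  have "(\<lambda>n. dist x (y n)) \<longlonglongrightarrow> infdist x D"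
  proof (rule tendsto_sandwich[OF _ _ tendsto_const lim])
    show "\<forall>\<^sub>F n in sequentially. infdist x D \<le> dist x (y n)"
      by (intro always_eventually allI infdist_le y(1))
    show "\<forall>\<^sub>F n in sequentially. dist x (y n) \<le> infdist x D + 1 / real (Suc n)"
      by (intro always_eventually allI less_imp_le y(2))
  qed
  then have "(\<lambda>n. norm (x - y n)) \<longlonglongrightarrow> infdist x D" by (simp only: dist_norm)
  then show ?thesis using y(1) that by blast
qed

lemma weighted_square_sum:
  fixes a b e :: real
  assumes "e > 0"
  shows "(a + b)\<^sup>2 \<le> (1 + 1 / e) * a\<^sup>2 + (1 + e) * b\<^sup>2"
proof -
  have "0 \<le> (a - e * b)\<^sup>2 / e" using assms by simp
  also have "\<dots> = a\<^sup>2 / e - 2 * a * b + e * b\<^sup>2"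
    using assms by (simp add: power2_eq_square field_simps)
  finally show ?thesis by (simp add: power2_sum algebra_simps)
qed

text \<open>
  \<open>D\<close> stands for the essential domain of the random operator.
\<close>

locale prox_domain = prox_walk P M F \<xi> A lam x0
  for P :: "'w measure" and M :: "'s measure" and F :: "nat \<Rightarrow> 'w measure" and \<xi> :: "nat \<Rightarrow> 'w \<Rightarrow> 's"
    and A :: "'s \<Rightarrow> 'h \<Rightarrow> 'h::{real_inner, banach, second_countable_topology} set"
    and lam :: "nat \<Rightarrow> real" and x0 :: 'h +
  fixes D :: "'h set" and C :: "'s \<Rightarrow> real" and p :: nat
  assumes D_ne: "D \<noteq> {}"
    and D_dom: "\<And>y. y \<in> D \<Longrightarrow> AE s in M. y \<in> op_dom (A s)"
    and C_meas: "C \<in> borel_measurable M"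
    and C_nn: "\<And>s. s \<in> space M \<Longrightarrow> C s \<ge> 0"
    and C_sq: "integrable M (\<lambda>s. (C s)\<^sup>2)"
    and J_proj: "\<And>x l. l > 0 \<Longrightarrow> AE s in M. norm (J l s x - proj (closure (op_dom (A s))) x)
                        \<le> l * C s * (1 + norm x ^ p)"
    and regular: "\<And>R. (R::real) > 0 \<Longrightarrow> \<exists>\<kappa>>0. \<forall>x. norm x \<le> R \<longrightarrow>
             (\<integral>\<^sup>+s. (dist_set x (op_dom (A s)))\<^sup>2 \<partial>M) \<ge> ennreal \<kappa> * (dist_set x D)\<^sup>2"
begin

text \<open>
  By \<open>J_proj\<close> the resolvents \<open>J l s x\<close> converge as \<open>l \<rightarrow> 0\<close>. Their limit along \<open>l = 1/(n+1)\<close> is a measurable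
  function of \<open>s\<close>, and \<open>resolvent_limit_obtuse\<close> gives it the properties of a projection onto the closure
  of the random domain.
\<close>

lemma projection_selection:
  obtains q where "q \<in> borel_measurable M"
    and "AE s in M. \<forall>u\<in>op_dom (A s). (norm (q s - u))\<^sup>2 \<le> (norm (x - u))\<^sup>2 - (norm (x - q s))\<^sup>2"
    and "AE s in M. dist_set x (op_dom (A s)) \<le> ennreal (norm (x - q s))"
    and "\<forall>l>0. AE s in M. norm (J l s x - q s) \<le> l * C s * (1 + norm x ^ p)"
proof -
  define q where "q s = lim (\<lambda>n. J (1 / real (Suc n)) s x)" for s
  have q: "q \<in> borel_measurable M"
    unfolding q_def by (intro borel_measurable_lim_metric J_meas) simp
  have "AE s in M. \<forall>n. norm (J (1 / real (Suc n)) s x - proj (closure (op_dom (A s))) x)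
      \<le> 1 / real (Suc n) * C s * (1 + norm x ^ p)"
    unfolding AE_all_countable by (intro allI J_proj) simp
  then have lim: "AE s in M. (\<lambda>n. J (1 / real (Suc n)) s x) \<longlonglongrightarrow> proj (closure (op_dom (A s))) x"
  proof eventually_elim
    case (elim s)
    have "(\<lambda>n. 1 / real (Suc n) * C s * (1 + norm x ^ p)) \<longlonglongrightarrow> 0 * C s * (1 + norm x ^ p)"
      using LIMSEQ_inverse_real_of_nat by (intro tendsto_intros) (simp add: inverse_eq_divide)
    then have 0: "(\<lambda>n. 1 / real (Suc n) * C s * (1 + norm x ^ p)) \<longlonglongrightarrow> 0" by simp
    have "(\<lambda>n. J (1 / real (Suc n)) s x - proj (closure (op_dom (A s))) x) \<longlonglongrightarrow> 0"
      by (rule Lim_null_comparison[OF always_eventually 0]) (rule elim)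
    then show ?case by (rule LIM_zero_cancel)
  qed
  then have eq: "AE s in M. q s = proj (closure (op_dom (A s))) x"
    by eventually_elim (simp add: q_def limI)
  have limq: "AE s in M. (\<lambda>n. J (1 / real (Suc n)) s x) \<longlonglongrightarrow> q s"
    using lim eq by eventually_elim simp
  show ?thesis
  proof (rule that[OF q])
    show "AE s in M. \<forall>u\<in>op_dom (A s). (norm (q s - u))\<^sup>2 \<le> (norm (x - u))\<^sup>2 - (norm (x - q s))\<^sup>2"
      using limq by eventually_elim (intro ballI resolvent_limit_obtuse[OF mm])
    show "AE s in M. dist_set x (op_dom (A s)) \<le> ennreal (norm (x - q s))"
      using limq by eventually_elim (rule dist_set_le_resolvent_limit[OF mm])
    show "\<forall>l>0. AE s in M. norm (J l s x - q s) \<le> l * C s * (1 + norm x ^ p)"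
    proof (intro allI impI)
      fix l :: real assume "l > 0"
      from J_proj[OF this, of x] eq show "AE s in M. norm (J l s x - q s) \<le> l * C s * (1 + norm x ^ p)"
        by eventually_elim simp
    qed
  qed
qed

text \<open>
  The projection of \<open>x\<close> onto the closure of the random domain is no farther from \<open>x\<close> than any point of \<open>D\<close>,
  since \<open>D\<close> is almost surely contained in the domain.
\<close>

lemma resolvent_displacement:
  assumes "l > 0"
  shows "AE s in M. norm (x - J l s x) \<le> infdist x D + l * C s * (1 + norm x ^ p)"
proof -
  obtain q where sel: "q \<in> borel_measurable M"
    "AE s in M. \<forall>u\<in>op_dom (A s). (norm (q s - u))\<^sup>2 \<le> (norm (x - u))\<^sup>2 - (norm (x - q s))\<^sup>2"
    "AE s in M. dist_set x (op_dom (A s)) \<le> ennreal (norm (x - q s))"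
    "\<forall>l>0. AE s in M. norm (J l s x - q s) \<le> l * C s * (1 + norm x ^ p)"
    by (rule projection_selection[of x]) (rule that)
  note q = sel(2) sel(4)[rule_format, OF assms]
  obtain y where y: "\<And>n::nat. y n \<in> D" "(\<lambda>n. norm (x - y n)) \<longlonglongrightarrow> infdist x D"
    using infdist_minimizing_sequence[OF D_ne] by blast
  have "AE s in M. \<forall>n. y n \<in> op_dom (A s)"
    unfolding AE_all_countable using D_dom y(1) by blast
  with q show ?thesis
  proof eventually_elim
    case (elim s)
    have "norm (x - q s) \<le> norm (x - y n)" for n
    proof -
      have "(norm (x - q s))\<^sup>2 \<le> (norm (x - y n))\<^sup>2"
        using elim(1)[rule_format, of "y n"] elim(3) by (smt (verit) zero_le_power2)
      then show ?thesis by (rule power2_le_imp_le) simp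
    qed
    then have "norm (x - q s) \<le> infdist x D"
      by (intro LIMSEQ_le_const[OF y(2)]) blast
    moreover have "norm (x - J l s x) \<le> norm (x - q s) + norm (J l s x - q s)"
      using norm_triangle_ineq4[of "x - q s" "J l s x - q s"] by simp
    ultimately show ?case using elim(2) by linarith
  qed
qed

text \<open>
  For \<open>y \<in> D\<close> and the projection \<open>q s\<close>, Pythagoras gives \<open>\<parallel>q s - y\<parallel>\<^sup>2 \<le> \<parallel>x - y\<parallel>\<^sup>2 - \<parallel>x - q s\<parallel>\<^sup>2\<close>, where
  \<open>\<parallel>x - q s\<parallel>\<close> is the distance from \<open>x\<close> to the random domain. By regularity its mean square is at least
  \<open>c\<close> times the squared distance from \<open>x\<close> to \<open>D\<close>; taking the infimum over \<open>y\<close> leaves the factor \<open>1 - c\<close>.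
  Replacing \<open>q s\<close> by the resolvent costs \<open>O(l)\<close>, by \<open>J_proj\<close>, and Young's inequality with weight \<open>c\<close>
  makes it a factor \<open>(1 + c) (1 - c) < 1\<close> and an error \<open>O(l\<^sup>2)\<close>.
\<close>

lemma mean_infdist_contraction:
  assumes R: "R > 0"
  obtains r K where "0 \<le> r" "r < 1" "0 \<le> K"
    "\<And>l x. l > 0 \<Longrightarrow> norm x \<le> R \<Longrightarrow>
      (\<integral>\<^sup>+s. ennreal ((infdist (J l s x) D)\<^sup>2) \<partial>M) \<le> ennreal (r * (infdist x D)\<^sup>2 + K * l\<^sup>2)"
proof -
  obtain \<kappa> where \<kappa>: "\<kappa> > 0" "\<And>x. norm x \<le> R \<Longrightarrow>
      (\<integral>\<^sup>+s. (dist_set x (op_dom (A s)))\<^sup>2 \<partial>M) \<ge> ennreal \<kappa> * (dist_set x D)\<^sup>2"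
    using regular[OF R] by blast
  \<comment> \<open>\<open>c < 1\<close> keeps the contraction factor \<open>(1 + c) * (1 - c)\<close> nonnegative\<close>
  define c where "c = min \<kappa> (1/2)"
  have c: "0 < c" "c < 1" "c \<le> \<kappa>" using \<kappa>(1) by (auto simp: c_def)
  define K where "K = (1 + 1 / c) * ((1 + R ^ p)\<^sup>2 * (\<integral>s. (C s)\<^sup>2 \<partial>M))"
  have K: "0 \<le> K" unfolding K_def using c by (intro mult_nonneg_nonneg) auto
  have main: "(\<integral>\<^sup>+s. ennreal ((infdist (J l s x) D)\<^sup>2) \<partial>M)
      \<le> ennreal ((1 + c) * ((norm (x - y))\<^sup>2 - c * (infdist x D)\<^sup>2) + K * l\<^sup>2)"
    if l: "l > 0" and x: "norm x \<le> R" and y: "y \<in> D" for l x y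
  proof -
    obtain q where sel: "q \<in> borel_measurable M"
      "AE s in M. \<forall>u\<in>op_dom (A s). (norm (q s - u))\<^sup>2 \<le> (norm (x - u))\<^sup>2 - (norm (x - q s))\<^sup>2"
      "AE s in M. dist_set x (op_dom (A s)) \<le> ennreal (norm (x - q s))"
      "\<forall>l>0. AE s in M. norm (J l s x - q s) \<le> l * C s * (1 + norm x ^ p)"
      by (rule projection_selection[of x]) (rule that)
    note q = sel(1-3) sel(4)[rule_format, OF l]
    have qy: "AE s in M. (norm (q s - y))\<^sup>2 \<le> (norm (x - y))\<^sup>2 - (norm (x - q s))\<^sup>2"
      using q(2) D_dom[OF y] by eventually_elim blast
    have qi: "integrable M (\<lambda>s. (norm (x - q s))\<^sup>2)"
    proof (rule M.integrable_const_bound[where B="(norm (x - y))\<^sup>2"])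
      show "AE s in M. norm ((norm (x - q s))\<^sup>2) \<le> (norm (x - y))\<^sup>2"
        using qy by eventually_elim (smt (verit) zero_le_power2 real_norm_def)
    qed (use q(1) in measurable)
    define Q where "Q = (\<integral>s. (norm (x - q s))\<^sup>2 \<partial>M)"
    have "ennreal (\<kappa> * (infdist x D)\<^sup>2) = ennreal \<kappa> * (ennreal (infdist x D))\<^sup>2"
      using \<kappa>(1) infdist_nonneg[of x D] by (simp add: ennreal_mult ennreal_power)
    also have "\<dots> \<le> ennreal \<kappa> * (dist_set x D)\<^sup>2"
      by (intro mult_left_mono power_mono infdist_le_dist_set) auto
    also have "\<dots> \<le> (\<integral>\<^sup>+s. (dist_set x (op_dom (A s)))\<^sup>2 \<partial>M)" by (rule \<kappa>(2)[OF x])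
    also have "\<dots> \<le> (\<integral>\<^sup>+s. ennreal ((norm (x - q s))\<^sup>2) \<partial>M)"
    proof (rule nn_integral_mono_AE)
      show "AE s in M. (dist_set x (op_dom (A s)))\<^sup>2 \<le> ennreal ((norm (x - q s))\<^sup>2)"
        using q(3) by eventually_elim (simp add: ennreal_power[symmetric] power_mono)
    qed
    also have "\<dots> = ennreal Q"
      unfolding Q_def by (rule nn_integral_eq_integral[OF qi]) simp
    finally have "\<kappa> * (infdist x D)\<^sup>2 \<le> Q"
      by (subst (asm) ennreal_le_iff) (auto simp: Q_def)
    moreover have "c * (infdist x D)\<^sup>2 \<le> \<kappa> * (infdist x D)\<^sup>2" using c by (intro mult_right_mono) auto
    ultimately have Q: "c * (infdist x D)\<^sup>2 \<le> Q" by linarith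
    define f where "f s = (1 + 1 / c) * (l\<^sup>2 * (1 + R ^ p)\<^sup>2 * (C s)\<^sup>2)
        + (1 + c) * ((norm (x - y))\<^sup>2 - (norm (x - q s))\<^sup>2)" for s
    have le: "AE s in M. (infdist (J l s x) D)\<^sup>2 \<le> f s"
      using qy q(4)
    proof eventually_elim
      case (elim s)
      have "infdist (J l s x) D \<le> norm (J l s x - y)" using infdist_le[OF y] by (simp add: dist_norm)
      also have "\<dots> \<le> norm (J l s x - q s) + norm (q s - y)"
        using norm_triangle_ineq[of "J l s x - q s" "q s - y"] by simp
      finally have "(infdist (J l s x) D)\<^sup>2 \<le> (norm (J l s x - q s) + norm (q s - y))\<^sup>2"
        by (intro power_mono infdist_nonneg)
      also have "\<dots> \<le> (1 + 1 / c) * (norm (J l s x - q s))\<^sup>2 + (1 + c) * (norm (q s - y))\<^sup>2"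
        by (rule weighted_square_sum[OF c(1)])
      also have "\<dots> \<le> f s"
      proof -
        have "(norm (J l s x - q s))\<^sup>2 \<le> (l * C s * (1 + norm x ^ p))\<^sup>2"
          using elim(2) by (intro power_mono) auto
        also have "\<dots> = (l\<^sup>2 * (C s)\<^sup>2) * (1 + norm x ^ p)\<^sup>2" by (simp add: power_mult_distrib)
        also have "\<dots> \<le> (l\<^sup>2 * (C s)\<^sup>2) * (1 + R ^ p)\<^sup>2"
          using x by (intro mult_left_mono power_mono add_left_mono) auto
        finally have "(norm (J l s x - q s))\<^sup>2 \<le> l\<^sup>2 * (1 + R ^ p)\<^sup>2 * (C s)\<^sup>2" by (simp add: ac_simps)
        then show ?thesis
          unfolding f_def using c elim(1) by (intro add_mono mult_left_mono) auto
      qed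
      finally show ?case .
    qed
    have fi: "integrable M f"
      unfolding f_def using qi C_sq by simp
    have "(\<integral>\<^sup>+s. ennreal ((infdist (J l s x) D)\<^sup>2) \<partial>M) \<le> (\<integral>\<^sup>+s. ennreal (f s) \<partial>M)"
      using le by (intro nn_integral_mono_AE) (auto elim!: eventually_mono intro!: ennreal_leI)
    also have "\<dots> = ennreal (\<integral>s. f s \<partial>M)"
    proof (rule nn_integral_eq_integral[OF fi])
      show "AE s in M. 0 \<le> f s" using le by eventually_elim (rule order_trans[OF zero_le_power2])
    qed
    also have "(\<integral>s. f s \<partial>M) = K * l\<^sup>2 + (1 + c) * ((norm (x - y))\<^sup>2 - Q)"
      unfolding f_def K_def Q_def using qi C_sq by (simp add: M.prob_space)
    also have "ennreal \<dots> \<le> ennreal ((1 + c) * ((norm (x - y))\<^sup>2 - c * (infdist x D)\<^sup>2) + K * l\<^sup>2)"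
    proof (rule ennreal_leI)
      have "(1 + c) * ((norm (x - y))\<^sup>2 - Q) \<le> (1 + c) * ((norm (x - y))\<^sup>2 - c * (infdist x D)\<^sup>2)"
        using Q c by (intro mult_left_mono) auto
      then show "K * l\<^sup>2 + (1 + c) * ((norm (x - y))\<^sup>2 - Q)
          \<le> (1 + c) * ((norm (x - y))\<^sup>2 - c * (infdist x D)\<^sup>2) + K * l\<^sup>2" by linarith
    qed
    finally show ?thesis .
  qed
  show ?thesis
  proof (rule that[of "(1 + c) * (1 - c)" K])
    have "(1 + c) * (1 - c) = 1 - c\<^sup>2" by (simp add: power2_eq_square algebra_simps)
    then show "(1 + c) * (1 - c) < 1" using c by simp
    show "0 \<le> (1 + c) * (1 - c)" using c by simp
    show "0 \<le> K" by (rule K)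
    fix l :: real and x :: 'h assume l: "l > 0" and x: "norm x \<le> R"
    obtain y where y: "\<And>n::nat. y n \<in> D" "(\<lambda>n. norm (x - y n)) \<longlonglongrightarrow> infdist x D"
      using infdist_minimizing_sequence[OF D_ne] by blast
    have "(\<lambda>n. ennreal ((1 + c) * ((norm (x - y n))\<^sup>2 - c * (infdist x D)\<^sup>2) + K * l\<^sup>2))
        \<longlonglongrightarrow> ennreal ((1 + c) * ((infdist x D)\<^sup>2 - c * (infdist x D)\<^sup>2) + K * l\<^sup>2)"
      by (intro tendsto_ennrealI tendsto_intros y)
    then have "(\<integral>\<^sup>+s. ennreal ((infdist (J l s x) D)\<^sup>2) \<partial>M)
        \<le> ennreal ((1 + c) * ((infdist x D)\<^sup>2 - c * (infdist x D)\<^sup>2) + K * l\<^sup>2)"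
      by (rule LIMSEQ_le_const) (use main[OF l x y(1)] in blast)
    also have "(1 + c) * ((infdist x D)\<^sup>2 - c * (infdist x D)\<^sup>2) = (1 + c) * (1 - c) * (infdist x D)\<^sup>2"
      by (simp add: algebra_simps)
    finally show "(\<integral>\<^sup>+s. ennreal ((infdist (J l s x) D)\<^sup>2) \<partial>M)
        \<le> ennreal ((1 + c) * (1 - c) * (infdist x D)\<^sup>2 + K * l\<^sup>2)" .
  qed
qed

text \<open>
  The constants of the contraction depend on a bound for the iterates. Estimates in mean are therefore
  restricted to this event, which is decided by the past and decreases with \<open>k\<close>; on almost every path it
  holds for all \<open>k\<close> once \<open>R\<close> is large.
\<close>

definition loc :: "real \<Rightarrow> nat \<Rightarrow> 'w \<Rightarrow> bool" where
  "loc R k \<omega> \<longleftrightarrow> (\<forall>j\<le>k. norm (X j \<omega>) \<le> R)"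

lemma loc_meas: "Measurable.pred (F k) (loc R k)"
proof -
  have "Measurable.pred (F k) (\<lambda>\<omega>. norm (X j \<omega>) \<le> R)" if "j \<in> {..k}" for j
  proof -
    have "X j \<in> borel_measurable (F k)"
      using measurable_filtration[of F, OF step _ X_meas] that by simp
    then show ?thesis by measurable
  qed
  then have "Measurable.pred (F k) (\<lambda>\<omega>. \<forall>j\<in>{..k}. norm (X j \<omega>) \<le> R)"
    by (intro pred_intros_finite) auto
  moreover have "(\<lambda>\<omega>. \<forall>j\<in>{..k}. norm (X j \<omega>) \<le> R) = loc R k"
    by (simp add: fun_eq_iff loc_def Ball_def)
  ultimately show ?thesis by (simp only:)
qed

lemma of_bool_loc_meas: "(\<lambda>\<omega>. of_bool (loc R k \<omega>) :: real) \<in> borel_measurable (F k)"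
  using loc_meas[where k=k and R=R] by measurable

lemma infdist_meas: "(\<lambda>x. infdist x D) \<in> borel_measurable borel"
  by (intro borel_measurable_continuous_onI continuous_on_infdist continuous_on_id)

definition dloc :: "real \<Rightarrow> nat \<Rightarrow> 'w \<Rightarrow> real" where
  "dloc R k \<omega> = of_bool (loc R k \<omega>) * infdist (X k \<omega>) D"

lemma dloc_meas: "dloc R k \<in> borel_measurable (F k)"
  unfolding dloc_def[abs_def]
  by (intro borel_measurable_times of_bool_loc_meas measurable_compose[OF X_meas infdist_meas])

text \<open>
  Let \<open>d\<^sub>k\<close> be the distance of the \<open>k\<close>-th iterate to \<open>D\<close>. The contraction, iterated in mean, makes the
  localized \<open>E d\<^sub>k\<^sup>2\<close> summable. So \<open>d\<^sub>k\<^sub>+\<^sub>1\<close> differs from its conditional mean by the terms of a convergent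
  martingale. By Jensen's inequality the conditional mean is at most \<open>sqrt r * d\<^sub>k + sqrt K * lam k\<close>;
  summing over \<open>k\<close> and absorbing the first term on the left, as \<open>sqrt r < 1\<close>, gives the pathwise bound.
\<close>

lemma distance_to_domain:
  assumes R: "R > 0"
  obtains L e where "0 \<le> L" "summable e" "\<forall>k. 0 \<le> e k"
    "\<forall>k. (\<integral>\<^sup>+\<omega>. ennreal ((dloc R k \<omega>)\<^sup>2) \<partial>P) \<le> ennreal (e k)"
    "AE \<omega> in P. (\<forall>j. norm (X j \<omega>) \<le> R) \<longrightarrow> (\<exists>c. \<forall>n. (\<Sum>k<n. infdist (X k \<omega>) D) \<le> c + L * (\<Sum>k<n. lam k))"
proof -
  obtain r K where r: "0 \<le> r" "r < 1" and K: "0 \<le> K"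
    and contr: "\<And>l x. l > 0 \<Longrightarrow> norm x \<le> R \<Longrightarrow>
      (\<integral>\<^sup>+s. ennreal ((infdist (J l s x) D)\<^sup>2) \<partial>M) \<le> ennreal (r * (infdist x D)\<^sup>2 + K * l\<^sup>2)"
    using mean_infdist_contraction[OF R] by metis
  define g where "g k \<omega> s = of_bool (loc R k \<omega>) * infdist (J (lam k) s (X k \<omega>)) D" for k \<omega> s
  have gm: "(\<lambda>(\<omega>, s). g k \<omega> s) \<in> borel_measurable (F k \<Otimes>\<^sub>M M)" for k
    using fst_meas[OF of_bool_loc_meas[where k=k and R=R]]
      measurable_compose[OF J_step_meas[OF X_meas[of k] lam_pos[of k]] infdist_meas]
    unfolding g_def case_prod_unfold by (rule borel_measurable_times)
  have dP: "dloc R k \<in> borel_measurable P" for k using measurable_from_subalg[OF sub dloc_meas] .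
  have sec: "(\<integral>\<^sup>+s. ennreal ((g k \<omega> s)\<^sup>2) \<partial>M) \<le> ennreal (r * (dloc R k \<omega>)\<^sup>2 + K * (lam k)\<^sup>2)" for k \<omega>
  proof (cases "loc R k \<omega>")
    case True
    then have "norm (X k \<omega>) \<le> R" by (simp add: loc_def)
    from contr[OF lam_pos this] True show ?thesis by (simp add: g_def dloc_def)
  next
    case False
    then show ?thesis by (simp add: g_def)
  qed
  have d_bound: "\<bar>dloc R k \<omega>\<bar> \<le> R + infdist 0 D" for k \<omega>
  proof (cases "loc R k \<omega>")
    case True
    then have "norm (X k \<omega>) \<le> R" by (simp add: loc_def)
    then show ?thesis using infdist_triangle[of "X k \<omega>" D 0] True by (simp add: dloc_def infdist_nonneg)
  next
    case False
    then show ?thesis using R infdist_nonneg[of 0 D] by (simp add: dloc_def)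
  qed
  have d_int: "integrable P (\<lambda>\<omega>. (dloc R k \<omega>)\<^sup>2)" for k
  proof (rule P.integrable_const_bound[where B="(R + infdist 0 D)\<^sup>2"])
    show "AE \<omega> in P. norm ((dloc R k \<omega>)\<^sup>2) \<le> (R + infdist 0 D)\<^sup>2"
      using power_mono[OF d_bound abs_ge_zero, of _ _ 2] by (intro always_eventually) simp
  qed (use dP in measurable)
  define e where "e k = (\<integral>\<omega>. (dloc R k \<omega>)\<^sup>2 \<partial>P)" for k
  have e_nn: "(\<integral>\<^sup>+\<omega>. ennreal ((dloc R k \<omega>)\<^sup>2) \<partial>P) = ennreal (e k)" for k
    unfolding e_def by (rule nn_integral_eq_integral[OF d_int]) simp
  have e0: "0 \<le> e k" for k by (simp add: e_def)
  have g_bound: "(\<integral>\<^sup>+\<omega>. \<integral>\<^sup>+s. ennreal ((g k \<omega> s)\<^sup>2) \<partial>M \<partial>P) \<le> ennreal (r * e k + K * (lam k)\<^sup>2)" for k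
  proof -
    have "(\<integral>\<^sup>+\<omega>. \<integral>\<^sup>+s. ennreal ((g k \<omega> s)\<^sup>2) \<partial>M \<partial>P) \<le> (\<integral>\<^sup>+\<omega>. ennreal (r * (dloc R k \<omega>)\<^sup>2 + K * (lam k)\<^sup>2) \<partial>P)"
      by (rule nn_integral_mono[OF sec])
    also have "\<dots> = ennreal (\<integral>\<omega>. r * (dloc R k \<omega>)\<^sup>2 + K * (lam k)\<^sup>2 \<partial>P)"
      using r K d_int by (intro nn_integral_eq_integral) auto
    also have "(\<integral>\<omega>. r * (dloc R k \<omega>)\<^sup>2 + K * (lam k)\<^sup>2 \<partial>P) = r * e k + K * (lam k)\<^sup>2"
      using d_int by (simp add: e_def P.prob_space)
    finally show ?thesis .
  qed
  have e_step: "e (Suc k) \<le> r * e k + K * (lam k)\<^sup>2" for k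
  proof -
    have m: "(\<lambda>(\<omega>, s). ennreal ((g k \<omega> s)\<^sup>2)) \<in> borel_measurable (F k \<Otimes>\<^sub>M M)"
      using gm[of k] unfolding case_prod_unfold by measurable
    have "ennreal (e (Suc k)) \<le> (\<integral>\<^sup>+\<omega>. ennreal ((g k \<omega> (\<xi> (Suc k) \<omega>))\<^sup>2) \<partial>P)"
      unfolding e_nn[symmetric]
    proof (intro nn_integral_mono ennreal_leI power_mono)
      fix \<omega>
      have "loc R k \<omega>" if "loc R (Suc k) \<omega>" using that by (auto simp: loc_def)
      then show "dloc R (Suc k) \<omega> \<le> g k \<omega> (\<xi> (Suc k) \<omega>)"
        by (auto simp: dloc_def g_def infdist_nonneg)
      show "0 \<le> dloc R (Suc k) \<omega>" by (simp add: dloc_def infdist_nonneg)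
    qed
    also have "\<dots> \<le> ennreal (r * e k + K * (lam k)\<^sup>2)"
      unfolding nn_integral_innov[OF m] by (rule g_bound)
    finally show ?thesis using r K e0 by (subst (asm) ennreal_le_iff) auto
  qed
  have Kl: "summable (\<lambda>k. K * (lam k)\<^sup>2)" using lam_sq by (rule summable_mult)
  have e: "summable e"
    by (rule summable_contraction[OF e_step e0 _ r Kl]) (use K in auto)
  have "AE \<omega> in P. summable (\<lambda>k. g k \<omega> (\<xi> (Suc k) \<omega>) - (\<integral>s. g k \<omega> s \<partial>M))"
  proof (rule centred_sums_converge[OF gm g_bound])
    show "summable (\<lambda>k. r * e k + K * (lam k)\<^sup>2)" using summable_mult[OF e] Kl by (rule summable_add)
  qed (use r K e0 in auto)
  then have "AE \<omega> in P. (\<forall>j. norm (X j \<omega>) \<le> R) \<longrightarrow>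
    (\<exists>c. \<forall>n. (\<Sum>k<n. infdist (X k \<omega>) D) \<le> c + sqrt K / (1 - sqrt r) * (\<Sum>k<n. lam k))"
    using AE_space
  proof eventually_elim
    case (elim \<omega>)
    show ?case
    proof
      assume bd: "\<forall>j. norm (X j \<omega>) \<le> R"
      have loc: "loc R k \<omega>" for k using bd by (simp add: loc_def)
      define d where "d k = infdist (X k \<omega>) D" for k
      have d0: "0 \<le> d k" for k by (simp add: d_def infdist_nonneg)
      define G where "G k = (\<integral>s. g k \<omega> s \<partial>M)" for k
      have G: "G k \<le> sqrt r * d k + sqrt K * lam k" for k
      proof -
        have "\<omega> \<in> space (F k)" using elim(2) sub[of k] by (simp add: subalgebra_def)
        from measurable_compose[OF measurable_Pair1'[OF this] gm]
        have gs: "g k \<omega> \<in> borel_measurable M" by simp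
        have sec': "(\<integral>\<^sup>+s. ennreal ((g k \<omega> s)\<^sup>2) \<partial>M) \<le> ennreal (r * (d k)\<^sup>2 + K * (lam k)\<^sup>2)"
          using sec[of k \<omega>] loc by (simp add: dloc_def d_def)
        have sq: "integrable M (\<lambda>s. (g k \<omega> s)\<^sup>2)"
          using gs sec' by (intro integrableI_nonneg) (auto elim: le_less_trans)
        have i: "integrable M (g k \<omega>)"
          using M.square_integrable_imp_integrable[OF gs] sq by simp
        have "0 \<le> M.variance (g k \<omega>)" by (rule M.variance_positive)
        then have "(G k)\<^sup>2 \<le> (\<integral>s. (g k \<omega> s)\<^sup>2 \<partial>M)"
          using M.variance_eq[OF i sq] by (simp add: G_def)
        also have "\<dots> \<le> r * (d k)\<^sup>2 + K * (lam k)\<^sup>2"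
          using sec' r K unfolding nn_integral_eq_integral[OF sq AE_I2[OF zero_le_power2]]
          by (subst (asm) ennreal_le_iff) auto
        also have "\<dots> = (sqrt r * d k)\<^sup>2 + (sqrt K * lam k)\<^sup>2"
          using r K by (simp add: power_mult_distrib)
        also have "\<dots> \<le> (sqrt r * d k + sqrt K * lam k)\<^sup>2"
          using r K d0[of k] lam_pos[of k] by (simp add: power2_sum)
        finally show ?thesis
          by (rule power2_le_imp_le)
            (use r K d0[of k] less_imp_le[OF lam_pos[of k]] in \<open>intro add_nonneg_nonneg mult_nonneg_nonneg; simp\<close>)
      qed
      have step: "d (Suc k) = g k \<omega> (\<xi> (Suc k) \<omega>)" for k
        using loc by (simp add: d_def g_def)
      have "convergent (\<lambda>n. \<Sum>k<n. d (Suc k) - G k)"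
        using elim(1) by (simp add: summable_iff_convergent step G_def)
      from convergent_imp_Bseq[OF this] obtain b where "\<And>n. norm (\<Sum>k<n. d (Suc k) - G k) \<le> b"
        by (rule BseqE) blast
      then have b: "(\<Sum>k<n. d (Suc k) - G k) \<le> b" for n
        using abs_le_D1[of "\<Sum>k<n. d (Suc k) - G k" b] unfolding real_norm_def by blast
      have sr: "sqrt r < 1" "0 \<le> sqrt r" using r by (auto simp: real_sqrt_lt_1_iff)
      have "(\<Sum>k<n. d k) \<le> (d 0 + b) / (1 - sqrt r) + sqrt K / (1 - sqrt r) * (\<Sum>k<n. lam k)" for n
      proof -
        have "(\<Sum>k<n. d k) \<le> (\<Sum>k<Suc n. d k)" using d0 by simp
        also have "\<dots> = d 0 + (\<Sum>k<n. d (Suc k))" by (rule sum.lessThan_Suc_shift)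
        also have "(\<Sum>k<n. d (Suc k)) \<le> b + (\<Sum>k<n. G k)"
          using b[of n] by (simp add: sum_subtractf)
        also have "(\<Sum>k<n. G k) \<le> (\<Sum>k<n. sqrt r * d k + sqrt K * lam k)" by (intro sum_mono G)
        also have "\<dots> = sqrt r * (\<Sum>k<n. d k) + sqrt K * (\<Sum>k<n. lam k)"
          by (simp add: sum.distrib sum_distrib_left)
        finally have "(1 - sqrt r) * (\<Sum>k<n. d k) \<le> (d 0 + b) + sqrt K * (\<Sum>k<n. lam k)"
          by (simp add: algebra_simps)
        then have "(\<Sum>k<n. d k) \<le> ((d 0 + b) + sqrt K * (\<Sum>k<n. lam k)) / (1 - sqrt r)"
          using sr by (simp add: field_simps)
        then show ?thesis by (simp add: add_divide_distrib)
      qed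
      then show "\<exists>c. \<forall>n. (\<Sum>k<n. infdist (X k \<omega>) D) \<le> c + sqrt K / (1 - sqrt r) * (\<Sum>k<n. lam k)"
        unfolding d_def by blast
    qed
  qed
  moreover have "0 \<le> sqrt K / (1 - sqrt r)" using r K by (simp add: real_sqrt_le_1_iff)
  ultimately show ?thesis using e0 e_nn by (intro that[OF _ e]) auto
qed

end

section \<open>Test pairs from the graph of the mean operator\<close>

context prox_domain begin

text \<open>
  Only integrability of \<open>\<phi>\<close> is at hand, so \<open>resolvent_step\<close> is used for the draws with \<open>\<parallel>\<phi>\<parallel> \<le> c\<close> only, where
  the quadratic term is at most \<open>c\<^sup>2 (lam k)\<^sup>2\<close>. At the other draws the squared distance to \<open>u\<close> grows by at most
  \<open>2 (R + \<parallel>u\<parallel>)\<close> times the displacement, which \<open>resolvent_displacement\<close> bounds. In the sum over \<open>k\<close>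
  three laws of large numbers replace the truncated selection, the indicator of the large draws (with
  the predictable weights \<open>infdist (X k) D\<close>) and \<open>C\<close> on the large draws by their means. The constant \<open>L\<close>
  does not depend on \<open>c\<close>, which is why the error can be made small by increasing \<open>c\<close>.
\<close>

lemma truncated_test_pair:
  assumes R: "R > 0"
  obtains L where "0 \<le> L"
    "\<And>\<phi> u c. \<phi> \<in> borel_measurable M \<Longrightarrow> AE s in M. \<phi> s \<in> A s u \<Longrightarrow> c > 0 \<Longrightarrow>
      AE \<omega> in P. (\<forall>j. norm (X j \<omega>) \<le> R) \<longrightarrow> (\<exists>b. \<forall>n.
        (\<Sum>k<n. lam k * ((\<integral>s. of_bool (norm (\<phi> s) \<le> c) *\<^sub>R \<phi> s \<partial>M) \<bullet> (X k \<omega> - u)))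
          \<le> b + (R + norm u) * ((\<integral>s. of_bool (c < norm (\<phi> s)) \<partial>M) * L
              + (1 + R ^ p) * (\<integral>s. C s * of_bool (c < norm (\<phi> s)) \<partial>M)) * (\<Sum>k<n. lam k))"
proof -
  obtain L e where L: "0 \<le> L" and e: "summable e" "\<forall>k. 0 \<le> e k"
    "\<forall>k. (\<integral>\<^sup>+\<omega>. ennreal ((dloc R k \<omega>)\<^sup>2) \<partial>P) \<le> ennreal (e k)"
    and dist: "AE \<omega> in P. (\<forall>j. norm (X j \<omega>) \<le> R) \<longrightarrow> (\<exists>c. \<forall>n. (\<Sum>k<n. infdist (X k \<omega>) D) \<le> c + L * (\<Sum>k<n. lam k))"
    by (rule distance_to_domain[OF R]) (rule that)
  have goal: "AE \<omega> in P. (\<forall>j. norm (X j \<omega>) \<le> R) \<longrightarrow> (\<exists>b. \<forall>n.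
        (\<Sum>k<n. lam k * ((\<integral>s. of_bool (norm (\<phi> s) \<le> c) *\<^sub>R \<phi> s \<partial>M) \<bullet> (X k \<omega> - u)))
          \<le> b + (R + norm u) * ((\<integral>s. of_bool (c < norm (\<phi> s)) \<partial>M) * L
              + (1 + R ^ p) * (\<integral>s. C s * of_bool (c < norm (\<phi> s)) \<partial>M)) * (\<Sum>k<n. lam k))"
    if \<phi>: "\<phi> \<in> borel_measurable M" and sel: "AE s in M. \<phi> s \<in> A s u" and c: "c > 0" for \<phi> u and c :: real
  proof -
    define R' where "R' = R + norm u"
    have R': "0 \<le> R'" using R by (simp add: R'_def)
    define \<psi> where "\<psi> s = of_bool (norm (\<phi> s) \<le> c) *\<^sub>R \<phi> s" for s
    define \<beta> where "\<beta> s = (of_bool (c < norm (\<phi> s)) :: real)" for s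
    have \<psi>m: "\<psi> \<in> borel_measurable M" unfolding \<psi>_def[abs_def] using \<phi> by measurable
    have \<beta>m: "\<beta> \<in> borel_measurable M" unfolding \<beta>_def[abs_def] using \<phi> by measurable
    have \<psi>b: "norm (\<psi> s) \<le> c" for s using c by (auto simp: \<psi>_def)
    have \<beta>b: "0 \<le> \<beta> s" "\<beta> s \<le> 1" "(\<beta> s)\<^sup>2 \<le> 1" for s by (auto simp: \<beta>_def)
    have \<psi>i: "integrable M \<psi>" by (rule M.integrable_const_bound[where B=c]) (use \<psi>m \<psi>b in auto)
    have \<beta>i: "integrable M \<beta>" by (rule M.integrable_const_bound[where B=1]) (use \<beta>m \<beta>b in auto)
    define v m CB where "v = (\<integral>s. \<psi> s \<partial>M)" and "m = (\<integral>s. \<beta> s \<partial>M)" and "CB = (\<integral>s. C s * \<beta> s \<partial>M)"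
    have m0: "0 \<le> m" unfolding m_def using \<beta>b by (simp add: integral_nonneg_AE)
    \<comment> \<open>the quantities summed along the path: the inner product with the truncated selection, and
      the two parts of the bound for the displacement at a large draw\<close>
    define g1 where "g1 k \<omega> s = lam k * (of_bool (loc R k \<omega>) * (\<psi> s \<bullet> (X k \<omega> - u)))" for k \<omega> s
    define g2 where "g2 k \<omega> s = dloc R k \<omega> * \<beta> s" for k \<omega> s
    define g3 where "g3 k \<omega> s = lam k * (C s * \<beta> s)" for k and \<omega> :: 'w and s
    have s1: "AE \<omega> in P. summable (\<lambda>k. g1 k \<omega> (\<xi> (Suc k) \<omega>) - (\<integral>s. g1 k \<omega> s \<partial>M))"
    proof (rule centred_sums_converge)
      show "(\<lambda>(\<omega>, s). g1 k \<omega> s) \<in> borel_measurable (F k \<Otimes>\<^sub>M M)" for k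
        using fst_meas[OF X_meas[of k]] snd_meas[OF \<psi>m, of k] fst_meas[OF of_bool_loc_meas[where k=k and R=R]]
        unfolding g1_def case_prod_unfold
        by (intro borel_measurable_times borel_measurable_const borel_measurable_inner borel_measurable_diff)
      show "summable (\<lambda>k. (lam k)\<^sup>2 * (c * R')\<^sup>2)" using lam_sq by (rule summable_mult2)
      fix k
      have "(g1 k \<omega> s)\<^sup>2 \<le> (lam k)\<^sup>2 * (c * R')\<^sup>2" for \<omega> s
      proof (cases "loc R k \<omega>")
        case True
        then have "norm (X k \<omega> - u) \<le> R'"
          using norm_triangle_ineq4[of "X k \<omega>" u] by (simp add: loc_def R'_def) (smt (verit) order_refl)
        then have "\<bar>\<psi> s \<bullet> (X k \<omega> - u)\<bar> \<le> c * R'"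
          using \<psi>b[of s] c by (intro order_trans[OF Cauchy_Schwarz_ineq2] mult_mono) auto
        then have "\<bar>\<psi> s \<bullet> (X k \<omega> - u)\<bar>\<^sup>2 \<le> (c * R')\<^sup>2" by (intro power_mono) auto
        then show ?thesis using True by (simp add: g1_def power_mult_distrib mult_left_mono)
      qed (simp add: g1_def)
      then have "(\<integral>\<^sup>+\<omega>. \<integral>\<^sup>+s. ennreal ((g1 k \<omega> s)\<^sup>2) \<partial>M \<partial>P)
          \<le> (\<integral>\<^sup>+\<omega>. \<integral>\<^sup>+s. ennreal ((lam k)\<^sup>2 * (c * R')\<^sup>2) \<partial>M \<partial>P)"
        by (intro nn_integral_mono ennreal_leI)
      then show "(\<integral>\<^sup>+\<omega>. \<integral>\<^sup>+s. ennreal ((g1 k \<omega> s)\<^sup>2) \<partial>M \<partial>P) \<le> ennreal ((lam k)\<^sup>2 * (c * R')\<^sup>2)"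
        by (simp add: M.emeasure_space_1 P.emeasure_space_1)
    qed simp
    have i1: "(\<integral>s. g1 k \<omega> s \<partial>M) = lam k * (of_bool (loc R k \<omega>) * (v \<bullet> (X k \<omega> - u)))" for k \<omega>
      unfolding g1_def v_def using \<psi>i by simp
    have s2: "AE \<omega> in P. summable (\<lambda>k. g2 k \<omega> (\<xi> (Suc k) \<omega>) - (\<integral>s. g2 k \<omega> s \<partial>M))"
    proof (rule centred_sums_converge[OF _ _ e(1) e(2)[rule_format]])
      show "(\<lambda>(\<omega>, s). g2 k \<omega> s) \<in> borel_measurable (F k \<Otimes>\<^sub>M M)" for k
        using fst_meas[OF dloc_meas[where k=k and R=R]] snd_meas[OF \<beta>m, of k]
        unfolding g2_def case_prod_unfold by (intro borel_measurable_times)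
      fix k
      have "(g2 k \<omega> s)\<^sup>2 \<le> (dloc R k \<omega>)\<^sup>2" for \<omega> s
        unfolding g2_def power_mult_distrib using \<beta>b(3)[of s] by (simp add: mult_left_le)
      then have "(\<integral>\<^sup>+\<omega>. \<integral>\<^sup>+s. ennreal ((g2 k \<omega> s)\<^sup>2) \<partial>M \<partial>P)
          \<le> (\<integral>\<^sup>+\<omega>. \<integral>\<^sup>+s. ennreal ((dloc R k \<omega>)\<^sup>2) \<partial>M \<partial>P)"
        by (intro nn_integral_mono ennreal_leI)
      also have "\<dots> \<le> ennreal (e k)" using e(3)[rule_format, of k] by (simp add: M.emeasure_space_1)
      finally show "(\<integral>\<^sup>+\<omega>. \<integral>\<^sup>+s. ennreal ((g2 k \<omega> s)\<^sup>2) \<partial>M \<partial>P) \<le> ennreal (e k)" .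
    qed
    have i2: "(\<integral>s. g2 k \<omega> s \<partial>M) = dloc R k \<omega> * m" for k \<omega>
      unfolding g2_def m_def by simp
    have s3: "AE \<omega> in P. summable (\<lambda>k. g3 k \<omega> (\<xi> (Suc k) \<omega>) - (\<integral>s. g3 k \<omega> s \<partial>M))"
    proof (rule centred_sums_converge)
      show "(\<lambda>(\<omega>, s). g3 k \<omega> s) \<in> borel_measurable (F k \<Otimes>\<^sub>M M)" for k
        unfolding g3_def
        using snd_meas[OF borel_measurable_times[OF borel_measurable_const[of "lam k"] borel_measurable_times[OF C_meas \<beta>m]], of k] .
      show "summable (\<lambda>k. (lam k)\<^sup>2 * (\<integral>s. (C s)\<^sup>2 \<partial>M))" using lam_sq by (rule summable_mult2)
      fix k
      have "(g3 k \<omega> s)\<^sup>2 \<le> (lam k)\<^sup>2 * (C s)\<^sup>2" for \<omega> s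
        unfolding g3_def power_mult_distrib using \<beta>b(3)[of s] by (simp add: mult_left_le mult_left_mono)
      then have "(\<integral>\<^sup>+s. ennreal ((g3 k \<omega> s)\<^sup>2) \<partial>M) \<le> (\<integral>\<^sup>+s. ennreal ((lam k)\<^sup>2 * (C s)\<^sup>2) \<partial>M)" for \<omega>
        by (intro nn_integral_mono ennreal_leI)
      also have "(\<integral>\<^sup>+s. ennreal ((lam k)\<^sup>2 * (C s)\<^sup>2) \<partial>M) = ennreal ((lam k)\<^sup>2 * (\<integral>s. (C s)\<^sup>2 \<partial>M))"
        using C_sq by (subst nn_integral_eq_integral) auto
      finally have "(\<integral>\<^sup>+\<omega>. \<integral>\<^sup>+s. ennreal ((g3 k \<omega> s)\<^sup>2) \<partial>M \<partial>P)
          \<le> (\<integral>\<^sup>+\<omega>. ennreal ((lam k)\<^sup>2 * (\<integral>s. (C s)\<^sup>2 \<partial>M)) \<partial>P)"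
        by (rule nn_integral_mono)
      then show "(\<integral>\<^sup>+\<omega>. \<integral>\<^sup>+s. ennreal ((g3 k \<omega> s)\<^sup>2) \<partial>M \<partial>P) \<le> ennreal ((lam k)\<^sup>2 * (\<integral>s. (C s)\<^sup>2 \<partial>M))"
        by (simp add: P.emeasure_space_1)
    qed simp
    have i3: "(\<integral>s. g3 k \<omega> s \<partial>M) = lam k * CB" for k \<omega>
      unfolding g3_def CB_def by simp
    have sel': "AE \<omega> in P. \<forall>k. \<phi> (\<xi> (Suc k) \<omega>) \<in> A (\<xi> (Suc k) \<omega>) u"
      unfolding AE_all_countable using AE_innov_noise[OF sel] by blast
    have disp: "AE \<omega> in P. \<forall>k. norm (X k \<omega> - X (Suc k) \<omega>)
        \<le> infdist (X k \<omega>) D + lam k * C (\<xi> (Suc k) \<omega>) * (1 + norm (X k \<omega>) ^ p)"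
      unfolding AE_all_countable prox_iter.simps
    proof (intro allI, rule AE_innov)
      fix k
      show "AE s in M. norm (X k \<omega> - J (lam k) s (X k \<omega>)) \<le> infdist (X k \<omega>) D + lam k * C s * (1 + norm (X k \<omega>) ^ p)" for \<omega>
        by (rule resolvent_displacement[OF lam_pos])
      have Xf: "(\<lambda>x. X k (fst x)) \<in> borel_measurable (F k \<Otimes>\<^sub>M M)"
        using fst_meas[OF X_meas[of k]] by (simp add: case_prod_unfold)
      have Jf: "(\<lambda>x. J (lam k) (snd x) (X k (fst x))) \<in> borel_measurable (F k \<Otimes>\<^sub>M M)"
        using J_step_meas[OF X_meas[of k] lam_pos[of k]] by (simp add: case_prod_unfold)
      have df: "(\<lambda>x. infdist (X k (fst x)) D) \<in> borel_measurable (F k \<Otimes>\<^sub>M M)"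
        using measurable_compose[OF Xf infdist_meas] .
      have Cf: "(\<lambda>x. C (snd x)) \<in> borel_measurable (F k \<Otimes>\<^sub>M M)"
        using snd_meas[OF C_meas, of k] by (simp add: case_prod_unfold)
      have nf: "(\<lambda>x. norm (X k (fst x) - J (lam k) (snd x) (X k (fst x)))) \<in> borel_measurable (F k \<Otimes>\<^sub>M M)"
        by (rule measurable_compose[OF borel_measurable_diff[OF Xf Jf] borel_measurable_norm])
      have nX: "(\<lambda>x. norm (X k (fst x))) \<in> borel_measurable (F k \<Otimes>\<^sub>M M)"
        by (rule measurable_compose[OF Xf borel_measurable_norm])
      show "Measurable.pred (F k \<Otimes>\<^sub>M M) (\<lambda>(\<omega>, s). norm (X k \<omega> - J (lam k) s (X k \<omega>))
            \<le> infdist (X k \<omega>) D + lam k * C s * (1 + norm (X k \<omega>) ^ p))"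
        unfolding case_prod_unfold pred_def
        by (intro borel_measurable_le nf nX borel_measurable_add borel_measurable_times
            borel_measurable_power borel_measurable_const df Cf)
    qed
    show ?thesis
      using s1 s2 s3 sel' disp dist AE_space
    proof eventually_elim
      case (elim \<omega>)
      show ?case
      proof
        assume bd: "\<forall>j. norm (X j \<omega>) \<le> R"
        have loc: "loc R k \<omega>" for k using bd by (simp add: loc_def)
        have Xu: "norm (X k \<omega> - u) \<le> R'" for k
          using norm_triangle_ineq4[of "X k \<omega>" u] bd[rule_format, of k] by (simp add: R'_def)
        define h1 h2 h3 where "h1 k = g1 k \<omega> (\<xi> (Suc k) \<omega>)" and "h2 k = g2 k \<omega> (\<xi> (Suc k) \<omega>)"
          and "h3 k = g3 k \<omega> (\<xi> (Suc k) \<omega>)" for k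
        define \<Lambda> where "\<Lambda> n = (\<Sum>k<n. lam k)" for n
        have partial_bound: "\<exists>b. \<forall>n. \<bar>\<Sum>k<n. f k\<bar> \<le> b" if "summable f" for f :: "nat \<Rightarrow> real"
          using that convergent_imp_Bseq[of "\<lambda>n. \<Sum>k<n. f k"]
          by (auto simp: summable_iff_convergent Bseq_def)
        obtain b1 where b1: "\<And>n. \<bar>\<Sum>k<n. h1 k - lam k * (v \<bullet> (X k \<omega> - u))\<bar> \<le> b1"
          using partial_bound[OF elim(1)] unfolding i1 h1_def using loc by auto
        obtain b2 where b2: "\<And>n. \<bar>\<Sum>k<n. h2 k - infdist (X k \<omega>) D * m\<bar> \<le> b2"
          using partial_bound[OF elim(2)] unfolding i2 h2_def dloc_def using loc by auto
        obtain b3 where b3: "\<And>n. \<bar>\<Sum>k<n. h3 k - lam k * CB\<bar> \<le> b3"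
          using partial_bound[OF elim(3)] unfolding i3 h3_def by auto
        obtain b4 where b4: "\<And>n. (\<Sum>k<n. infdist (X k \<omega>) D) \<le> b4 + L * \<Lambda> n"
          using elim(6) bd unfolding \<Lambda>_def by blast
        have step: "(norm (X (Suc k) \<omega> - u))\<^sup>2 \<le> (norm (X k \<omega> - u))\<^sup>2 - 2 * h1 k + c\<^sup>2 * (lam k)\<^sup>2
            + 2 * R' * (h2 k + (1 + R ^ p) * h3 k)" for k
        proof (cases "norm (\<phi> (\<xi> (Suc k) \<omega>)) \<le> c")
          case True
          then have h: "h1 k = lam k * (\<phi> (\<xi> (Suc k) \<omega>) \<bullet> (X k \<omega> - u))" "h2 k = 0" "h3 k = 0"
            using loc by (auto simp: h1_def h2_def h3_def g1_def g2_def g3_def \<psi>_def \<beta>_def)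
          have "(lam k)\<^sup>2 * (norm (\<phi> (\<xi> (Suc k) \<omega>)))\<^sup>2 \<le> (lam k)\<^sup>2 * c\<^sup>2"
            using True by (intro mult_left_mono power_mono) auto
          then show ?thesis
            using resolvent_step[OF mm lam_pos, of "\<phi> (\<xi> (Suc k) \<omega>)" "\<xi> (Suc k) \<omega>" u k "X k \<omega>"] elim(4)
            by (simp add: h algebra_simps)
        next
          case False
          have sp: "\<xi> (Suc k) \<omega> \<in> space M" using innov_P[of k] elim(7) by (auto dest: measurable_space)
          have h: "h1 k = 0" "h2 k = infdist (X k \<omega>) D" "h3 k = lam k * C (\<xi> (Suc k) \<omega>)"
            using False loc by (auto simp: h1_def h2_def h3_def g1_def g2_def g3_def \<psi>_def \<beta>_def dloc_def)
          let ?x = "X k \<omega>" and ?y = "X (Suc k) \<omega>"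
          have "norm (?x - ?y) \<le> h2 k + h3 k * (1 + norm ?x ^ p)" using elim(5) by (simp only: h)
          also have "\<dots> \<le> h2 k + h3 k * (1 + R ^ p)"
            using bd lam_pos[of k] C_nn[OF sp] unfolding h
            by (intro add_left_mono mult_left_mono power_mono) (auto simp: less_imp_le)
          finally have d: "norm (?x - ?y) \<le> h2 k + (1 + R ^ p) * h3 k" by (simp add: mult.commute)
          have "(norm (?y - u))\<^sup>2 = (norm (?x - u))\<^sup>2 - 2 * ((?x - ?y) \<bullet> (?y - u)) - (norm (?x - ?y))\<^sup>2"
            unfolding power2_norm_eq_inner by (simp add: inner_simps inner_commute algebra_simps del: prox_iter.simps)
          moreover have "\<bar>(?x - ?y) \<bullet> (?y - u)\<bar> \<le> norm (?x - ?y) * norm (?y - u)" by (rule Cauchy_Schwarz_ineq2)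
          moreover have "norm (?x - ?y) * norm (?y - u) \<le> (h2 k + (1 + R ^ p) * h3 k) * R'"
            using d Xu[of "Suc k"] by (intro mult_mono) (auto intro: order_trans[OF norm_ge_zero d])
          moreover have "0 \<le> (norm (?x - ?y))\<^sup>2" "0 \<le> c\<^sup>2 * (lam k)\<^sup>2" by auto
          ultimately show ?thesis unfolding h(1) by (simp only: mult.assoc mult.commute[of R'])
        qed
        define W where "W = (\<Sum>k. (lam k)\<^sup>2)"
        have W: "(\<Sum>k<n. (lam k)\<^sup>2) \<le> W" for n unfolding W_def using lam_sq by (intro sum_le_suminf) auto
        define b where "b = b1 + (norm (x0 - u))\<^sup>2 / 2 + c\<^sup>2 * W / 2 + R' * (b2 + m * b4 + (1 + R ^ p) * b3)"
        have "(\<Sum>k<n. lam k * (v \<bullet> (X k \<omega> - u))) \<le> b + R' * (m * L + (1 + R ^ p) * CB) * \<Lambda> n" for n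
        proof -
          have tele: "(norm (X n \<omega> - u))\<^sup>2 \<le> (norm (x0 - u))\<^sup>2 - 2 * (\<Sum>k<n. h1 k) + c\<^sup>2 * (\<Sum>k<n. (lam k)\<^sup>2)
              + 2 * R' * ((\<Sum>k<n. h2 k) + (1 + R ^ p) * (\<Sum>k<n. h3 k))"
          proof (induction n)
            case (Suc n)
            show ?case using Suc.IH step[of n] by (simp add: algebra_simps del: prox_iter.simps)
          qed simp
          have "(\<Sum>k<n. lam k * (v \<bullet> (X k \<omega> - u))) \<le> b1 + (\<Sum>k<n. h1 k)"
            using b1[of n] by (simp add: sum_subtractf)
          also have "2 * (\<Sum>k<n. h1 k) \<le> (norm (x0 - u))\<^sup>2 + c\<^sup>2 * (\<Sum>k<n. (lam k)\<^sup>2)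
              + 2 * R' * ((\<Sum>k<n. h2 k) + (1 + R ^ p) * (\<Sum>k<n. h3 k))"
            using tele zero_le_power2[of "norm (X n \<omega> - u)"] by linarith
          then have "(\<Sum>k<n. h1 k) \<le> (norm (x0 - u))\<^sup>2 / 2 + c\<^sup>2 * (\<Sum>k<n. (lam k)\<^sup>2) / 2
              + R' * ((\<Sum>k<n. h2 k) + (1 + R ^ p) * (\<Sum>k<n. h3 k))" by simp
          also have "c\<^sup>2 * (\<Sum>k<n. (lam k)\<^sup>2) / 2 \<le> c\<^sup>2 * W / 2" using W[of n] by (simp add: mult_left_mono)
          also have "(\<Sum>k<n. h2 k) + (1 + R ^ p) * (\<Sum>k<n. h3 k)
              \<le> (b2 + m * (b4 + L * \<Lambda> n)) + (1 + R ^ p) * (b3 + CB * \<Lambda> n)"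
          proof (intro add_mono mult_left_mono)
            have "(\<Sum>k<n. h2 k) \<le> b2 + m * (\<Sum>k<n. infdist (X k \<omega>) D)"
            proof -
              have "(\<Sum>k<n. infdist (X k \<omega>) D * m) = m * (\<Sum>k<n. infdist (X k \<omega>) D)"
                by (simp add: sum_distrib_left mult.commute)
              then show ?thesis using abs_le_D1[OF b2[of n]] by (simp add: sum_subtractf)
            qed
            also have "m * (\<Sum>k<n. infdist (X k \<omega>) D) \<le> m * (b4 + L * \<Lambda> n)" using m0 b4 by (intro mult_left_mono)
            finally show "(\<Sum>k<n. h2 k) \<le> b2 + m * (b4 + L * \<Lambda> n)" by simp
            show "(\<Sum>k<n. h3 k) \<le> b3 + CB * \<Lambda> n"
            proof -
              have "(\<Sum>k<n. lam k * CB) = CB * \<Lambda> n" by (simp add: \<Lambda>_def sum_distrib_left mult.commute)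
              then show ?thesis using abs_le_D1[OF b3[of n]] by (simp add: sum_subtractf)
            qed
          qed (use R in auto)
          finally show ?thesis using R' by (simp add: b_def algebra_simps mult_right_mono)
        qed
        then show "\<exists>b. \<forall>n. (\<Sum>k<n. lam k * ((\<integral>s. of_bool (norm (\<phi> s) \<le> c) *\<^sub>R \<phi> s \<partial>M) \<bullet> (X k \<omega> - u)))
          \<le> b + (R + norm u) * ((\<integral>s. of_bool (c < norm (\<phi> s)) \<partial>M) * L
              + (1 + R ^ p) * (\<integral>s. C s * of_bool (c < norm (\<phi> s)) \<partial>M)) * (\<Sum>k<n. lam k)"
          unfolding v_def m_def CB_def R'_def \<Lambda>_def \<psi>_def \<beta>_def by blast
      qed
    qed
  qed
  show ?thesis using that[OF L goal] by blast
qed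

end

section \<open>Convergence of the weighted averages\<close>

definition wavg :: "(nat \<Rightarrow> real) \<Rightarrow> (nat \<Rightarrow> 'h::real_vector) \<Rightarrow> nat \<Rightarrow> 'h" where
  "wavg lam x n = (\<Sum>k=1..n. lam k *\<^sub>R x k) /\<^sub>R (\<Sum>k=1..n. lam k)"

lemma sum_lessThan_Suc_split_first: "(\<Sum>k<Suc n. f k) = f 0 + (\<Sum>k=1..n. f k)" for f :: "nat \<Rightarrow> real"
  by (subst sum.lessThan_Suc_shift) (simp add: sum.atLeast1_atMost_eq)

lemma wavg_inner: "wavg lam x n \<bullet> y = (\<Sum>k=1..n. lam k * (x k \<bullet> y)) / (\<Sum>k=1..n. lam k)"
  by (simp add: wavg_def inner_sum_left divide_inverse mult.commute)

lemma norm_wavg_le: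
  assumes lam: "\<And>k. lam k > 0" and x: "\<And>k. norm (x k) \<le> R"
  shows "norm (wavg lam x n) \<le> R"
proof -
  have R: "0 \<le> R" using norm_ge_zero x order_trans by blast
  have S: "0 \<le> (\<Sum>k=1..n. lam k)" using lam by (intro sum_nonneg less_imp_le)
  have "norm (\<Sum>k=1..n. lam k *\<^sub>R x k) \<le> (\<Sum>k=1..n. lam k * R)"
    using lam x by (intro sum_norm_le) (simp add: mult_left_mono less_imp_le)
  also have "\<dots> = (\<Sum>k=1..n. lam k) * R" by (simp add: sum_distrib_right)
  finally have "norm (\<Sum>k=1..n. lam k *\<^sub>R x k) / (\<Sum>k=1..n. lam k) \<le> R"
    using S R by (cases "(\<Sum>k=1..n. lam k) = 0") (auto simp: field_simps)
  then show ?thesis using S by (simp add: wavg_def divide_inverse mult.commute)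
qed

text \<open>
  The deterministic half of the argument. A tail point of the averages satisfies \<open>v \<bullet> (w - u) \<le> 0\<close> for the
  pairs in \<open>S\<close>, by density for the whole graph, and is a zero by maximality; \<open>Opial_Passty\<close> applies.
\<close>

lemma weak_limit_of_averages:
  fixes x :: "nat \<Rightarrow> 'h::{real_inner, banach}" and T :: "'h \<Rightarrow> 'h set"
  assumes T: "maximal_monotone T" and ne: "zer T \<noteq> {}"
    and lam: "\<And>k. lam k > 0" "filterlim (\<lambda>n. \<Sum>k=1..n. lam k) at_top sequentially"
    and fejer: "\<And>z. z \<in> zer T \<Longrightarrow> convergent (\<lambda>k. norm (x k - z))"
    and S: "\<And>u v. v \<in> T u \<Longrightarrow> (u, v) \<in> closure S"
    and test: "\<And>u v e. (u, v) \<in> S \<Longrightarrow> e > 0 \<Longrightarrow> \<forall>\<^sub>F n in sequentially. v \<bullet> (wavg lam x n - u) \<le> e"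
  shows "\<exists>z\<in>zer T. weakly_converges (wavg lam x) z"
proof (rule Opial_Passty)
  obtain z where z: "z \<in> zer T" using ne by blast
  obtain B where B: "\<And>k. norm (x k - z) \<le> B"
    using convergent_imp_Bseq[OF fejer[OF z]] by (auto simp: Bseq_def)
  have "norm (x k) \<le> B + norm z" for k
    using norm_triangle_ineq[of "x k - z" z] B[of k] by simp
  then have "norm (wavg lam x n) \<le> B + norm z" for n by (rule norm_wavg_le[OF lam(1)])
  then show "bounded (range (wavg lam x))" by (auto simp: bounded_iff)
next
  fix w assume w: "tail_point (wavg lam x) w"
  have onS: "v \<bullet> (w - u) \<le> 0" if "(u, v) \<in> S" for u v
  proof (rule field_le_epsilon)
    fix e :: real assume "e > 0"
    from test[OF that this] have "\<forall>\<^sub>F n in sequentially. wavg lam x n \<bullet> v \<le> v \<bullet> u + e"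
      by eventually_elim (simp add: inner_diff_right inner_commute)
    then have "w \<bullet> v \<le> v \<bullet> u + e" using w by (auto simp: tail_point_def)
    then show "v \<bullet> (w - u) \<le> 0 + e" by (simp add: inner_diff_right inner_commute)
  qed
  have "closed {uv. snd uv \<bullet> (w - fst uv) \<le> 0}"
    by (intro closed_Collect_le continuous_intros)
  then have cl: "closure S \<subseteq> {uv. snd uv \<bullet> (w - fst uv) \<le> 0}"
    using onS by (intro closure_minimal) auto
  have "0 \<in> T w"
  proof (rule maximal_monotone_memI[OF T])
    fix u v assume "v \<in> T u"
    then have "v \<bullet> (w - u) \<le> 0" using S cl by force
    then show "(v - 0) \<bullet> (u - w) \<ge> 0" by (simp add: inner_diff_right)
  qed
  then show "w \<in> zer T" by (simp add: zer_def)
next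
  fix z z' assume z: "z \<in> zer T" "z' \<in> zer T"
  obtain l l' where "(\<lambda>k. norm (x k - z)) \<longlonglongrightarrow> l" "(\<lambda>k. norm (x k - z')) \<longlonglongrightarrow> l'"
    using fejer[OF z(1)] fejer[OF z(2)] by (auto simp: convergent_def)
  then have "(\<lambda>k. ((norm (x k - z'))\<^sup>2 - (norm (x k - z))\<^sup>2 + (norm z)\<^sup>2 - (norm z')\<^sup>2) * (1 / 2))
      \<longlonglongrightarrow> (l'\<^sup>2 - l\<^sup>2 + (norm z)\<^sup>2 - (norm z')\<^sup>2) * (1 / 2)"
    by (intro tendsto_intros)
  moreover have "((norm (x k - z'))\<^sup>2 - (norm (x k - z))\<^sup>2 + (norm z)\<^sup>2 - (norm z')\<^sup>2) * (1 / 2) = x k \<bullet> (z - z')" for k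
    unfolding power2_norm_eq_inner by (simp add: inner_simps inner_commute)
  ultimately have "(\<lambda>k. x k \<bullet> (z - z')) \<longlonglongrightarrow> (l'\<^sup>2 - l\<^sup>2 + (norm z)\<^sup>2 - (norm z')\<^sup>2) * (1 / 2)" by simp
  from weighted_average_tendsto[OF lam this]
  show "convergent (\<lambda>n. wavg lam x n \<bullet> (z - z'))" by (auto simp: wavg_inner convergent_def)
qed

context prox_domain begin

text \<open>
  As \<open>c \<rightarrow> \<infinity>\<close> the truncated mean tends to \<open>\<integral>s. \<phi> s \<partial>M\<close> and both means over the large draws tend to \<open>0\<close>, by
  dominated convergence.
\<close>

lemma test_pair_average:
  assumes \<phi>: "\<phi> \<in> borel_measurable M" and sel: "AE s in M. \<phi> s \<in> A s u" and int: "integrable M \<phi>"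
    and div: "filterlim (\<lambda>n. \<Sum>k=1..n. lam k) at_top sequentially"
  shows "AE \<omega> in P. bounded (range (\<lambda>k. X k \<omega>)) \<longrightarrow>
    (\<forall>e>0. \<forall>\<^sub>F n in sequentially. (\<integral>s. \<phi> s \<partial>M) \<bullet> (wavg lam (\<lambda>k. X k \<omega>) n - u) \<le> e)"
proof -
  define v where "v i = (\<integral>s. of_bool (norm (\<phi> s) \<le> real (Suc i)) *\<^sub>R \<phi> s \<partial>M)" for i
  define \<mu> where "\<mu> i = (\<integral>s. of_bool (real (Suc i) < norm (\<phi> s)) \<partial>M :: real)" for i
  define \<gamma> where "\<gamma> i = (\<integral>s. C s * of_bool (real (Suc i) < norm (\<phi> s)) \<partial>M)" for i
  have ev: "\<forall>\<^sub>F i in sequentially. norm (\<phi> s) \<le> real (Suc i)" for s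
    using eventually_ge_at_top[of "nat \<lceil>norm (\<phi> s)\<rceil>"] by eventually_elim linarith
  have Ci: "integrable M C" by (rule M.square_integrable_imp_integrable[OF C_meas C_sq])
  have v_lim: "v \<longlonglongrightarrow> (\<integral>s. \<phi> s \<partial>M)"
    unfolding v_def
  proof (rule integral_dominated_convergence[where w="\<lambda>s. norm (\<phi> s)"])
    show "AE s in M. (\<lambda>i. of_bool (norm (\<phi> s) \<le> real (Suc i)) *\<^sub>R \<phi> s) \<longlonglongrightarrow> \<phi> s"
    proof (rule AE_I2, rule tendsto_eventually)
      fix s show "\<forall>\<^sub>F i in sequentially. of_bool (norm (\<phi> s) \<le> real (Suc i)) *\<^sub>R \<phi> s = \<phi> s"
        using ev[of s] by eventually_elim simp
    qed
  qed (use \<phi> int in auto)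
  have \<mu>_lim: "\<mu> \<longlonglongrightarrow> (\<integral>s. 0 \<partial>M)"
    unfolding \<mu>_def
  proof (rule integral_dominated_convergence[where w="\<lambda>s. 1"])
    show "AE s in M. (\<lambda>i. of_bool (real (Suc i) < norm (\<phi> s)) :: real) \<longlonglongrightarrow> 0"
    proof (rule AE_I2, rule tendsto_eventually)
      fix s show "\<forall>\<^sub>F i in sequentially. of_bool (real (Suc i) < norm (\<phi> s)) = (0::real)"
        using ev[of s] by eventually_elim simp
    qed
  qed (use \<phi> in auto)
  have \<gamma>_lim: "\<gamma> \<longlonglongrightarrow> (\<integral>s. 0 \<partial>M)"
    unfolding \<gamma>_def
  proof (rule integral_dominated_convergence[where w="\<lambda>s. norm (C s)"])
    show "AE s in M. (\<lambda>i. C s * of_bool (real (Suc i) < norm (\<phi> s))) \<longlonglongrightarrow> 0"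
    proof (rule AE_I2, rule tendsto_eventually)
      fix s show "\<forall>\<^sub>F i in sequentially. C s * of_bool (real (Suc i) < norm (\<phi> s)) = 0"
        using ev[of s] by eventually_elim simp
    qed
  qed (use \<phi> C_meas Ci in auto)
  have radius: "AE \<omega> in P. (\<forall>j. norm (X j \<omega>) \<le> R) \<longrightarrow>
    (\<forall>e>0. \<forall>\<^sub>F n in sequentially. (\<integral>s. \<phi> s \<partial>M) \<bullet> (wavg lam (\<lambda>k. X k \<omega>) n - u) \<le> e)" if R: "R > 0" for R
  proof -
    obtain L where L: "0 \<le> L" and bnd:
      "\<And>\<phi> u c. \<phi> \<in> borel_measurable M \<Longrightarrow> AE s in M. \<phi> s \<in> A s u \<Longrightarrow> c > 0 \<Longrightarrow>
      AE \<omega> in P. (\<forall>j. norm (X j \<omega>) \<le> R) \<longrightarrow> (\<exists>b. \<forall>n.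
        (\<Sum>k<n. lam k * ((\<integral>s. of_bool (norm (\<phi> s) \<le> c) *\<^sub>R \<phi> s \<partial>M) \<bullet> (X k \<omega> - u)))
          \<le> b + (R + norm u) * ((\<integral>s. of_bool (c < norm (\<phi> s)) \<partial>M) * L
              + (1 + R ^ p) * (\<integral>s. C s * of_bool (c < norm (\<phi> s)) \<partial>M)) * (\<Sum>k<n. lam k))"
      by (rule truncated_test_pair[OF R]) blast
    define \<delta> where "\<delta> i = (R + norm u) * (\<mu> i * L + (1 + R ^ p) * \<gamma> i)" for i
    have "AE \<omega> in P. (\<forall>j. norm (X j \<omega>) \<le> R) \<longrightarrow> (\<exists>b. \<forall>n.
        (\<Sum>k<n. lam k * (v i \<bullet> (X k \<omega> - u))) \<le> b + \<delta> i * (\<Sum>k<n. lam k))" for i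
      unfolding v_def \<delta>_def \<mu>_def \<gamma>_def by (rule bnd[OF \<phi> sel]) simp
    then have "AE \<omega> in P. \<forall>i. (\<forall>j. norm (X j \<omega>) \<le> R) \<longrightarrow> (\<exists>b. \<forall>n.
        (\<Sum>k<n. lam k * (v i \<bullet> (X k \<omega> - u))) \<le> b + \<delta> i * (\<Sum>k<n. lam k))"
      by (simp only: AE_all_countable) blast
    then show ?thesis
    proof eventually_elim
      case (elim \<omega>)
      show ?case
      proof (intro impI allI)
        fix e :: real assume bd: "\<forall>j. norm (X j \<omega>) \<le> R" and e: "e > 0"
        have Xu: "norm (wavg lam (\<lambda>k. X k \<omega>) n - u) \<le> R + norm u" for n
          using norm_wavg_le[of lam "\<lambda>k. X k \<omega>" R n, OF lam_pos] bd
            norm_triangle_ineq4[of "wavg lam (\<lambda>k. X k \<omega>) n" u] by force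
        have "(\<lambda>i. \<delta> i + norm ((\<integral>s. \<phi> s \<partial>M) - v i) * (R + norm u)) \<longlonglongrightarrow>
          (R + norm u) * ((\<integral>s. 0 \<partial>M) * L + (1 + R ^ p) * (\<integral>s. 0 \<partial>M)) + norm ((\<integral>s. \<phi> s \<partial>M) - (\<integral>s. \<phi> s \<partial>M)) * (R + norm u)"
          unfolding \<delta>_def by (intro tendsto_intros \<mu>_lim \<gamma>_lim v_lim)
        then have "(\<lambda>i. \<delta> i + norm ((\<integral>s. \<phi> s \<partial>M) - v i) * (R + norm u)) \<longlonglongrightarrow> 0" by simp
        then have "\<forall>\<^sub>F i in sequentially. \<delta> i + norm ((\<integral>s. \<phi> s \<partial>M) - v i) * (R + norm u) < e / 2"
          using e by (intro order_tendstoD(2)) auto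
        then obtain i where i: "\<delta> i + norm ((\<integral>s. \<phi> s \<partial>M) - v i) * (R + norm u) < e / 2"
          by (auto simp: eventually_sequentially)
        obtain b where b: "\<And>n. (\<Sum>k<n. lam k * (v i \<bullet> (X k \<omega> - u))) \<le> b + \<delta> i * (\<Sum>k<n. lam k)"
          using elim bd by blast
        \<comment> \<open>the averages have no term of index \<open>0\<close>; \<open>b'\<close> absorbs it\<close>
        define b' where "b' = b + \<delta> i * lam 0 - lam 0 * (v i \<bullet> (x0 - u))"
        define \<Lambda> where "\<Lambda> n = (\<Sum>k=1..n. lam k)" for n
        have b': "(\<Sum>k=1..n. lam k * (v i \<bullet> (X k \<omega> - u))) \<le> b' + \<delta> i * \<Lambda> n" for n
          using b[of "Suc n"] unfolding sum_lessThan_Suc_split_first by (simp add: b'_def \<Lambda>_def algebra_simps)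
        have "\<forall>\<^sub>F n in sequentially. \<Lambda> n > max 0 (2 * \<bar>b'\<bar> / e)"
          using div unfolding \<Lambda>_def filterlim_at_top_dense by blast
        then show "\<forall>\<^sub>F n in sequentially. (\<integral>s. \<phi> s \<partial>M) \<bullet> (wavg lam (\<lambda>k. X k \<omega>) n - u) \<le> e"
        proof eventually_elim
          case (elim n)
          then have "2 * \<bar>b'\<bar> / e < \<Lambda> n" by simp
          then have "2 * \<bar>b'\<bar> < \<Lambda> n * e" using e by (simp add: pos_divide_less_eq)
          then have \<Lambda>: "\<Lambda> n > 0" "b' \<le> e / 2 * \<Lambda> n" using elim by (simp, simp add: mult.commute)
          have "(\<Sum>k=1..n. lam k * (v i \<bullet> (X k \<omega> - u))) = (\<Sum>k=1..n. lam k * (X k \<omega> \<bullet> v i)) - \<Lambda> n * (v i \<bullet> u)"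
            by (simp add: \<Lambda>_def inner_diff_right inner_commute right_diff_distrib sum_subtractf sum_distrib_right)
          then have "v i \<bullet> (wavg lam (\<lambda>k. X k \<omega>) n - u) = (\<Sum>k=1..n. lam k * (v i \<bullet> (X k \<omega> - u))) / \<Lambda> n"
            using \<Lambda>(1) wavg_inner[of lam "\<lambda>k. X k \<omega>" n "v i"]
            unfolding \<Lambda>_def by (simp add: inner_diff_right inner_commute diff_divide_distrib)
          also have "\<dots> \<le> (e / 2 * \<Lambda> n + \<delta> i * \<Lambda> n) / \<Lambda> n"
            using b'[of n] \<Lambda> by (intro divide_right_mono) auto
          also have "\<dots> = e / 2 + \<delta> i" using \<Lambda>(1) by (simp add: field_simps)
          finally have 1: "v i \<bullet> (wavg lam (\<lambda>k. X k \<omega>) n - u) \<le> e / 2 + \<delta> i" .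
          have "((\<integral>s. \<phi> s \<partial>M) - v i) \<bullet> (wavg lam (\<lambda>k. X k \<omega>) n - u)
              \<le> norm ((\<integral>s. \<phi> s \<partial>M) - v i) * (R + norm u)"
            using Xu by (intro order_trans[OF norm_cauchy_schwarz] mult_left_mono) auto
          then show ?case using 1 i by (simp add: inner_diff_left)
        qed
      qed
    qed
  qed
  have "AE \<omega> in P. \<forall>N. (\<forall>j. norm (X j \<omega>) \<le> real (Suc N)) \<longrightarrow>
    (\<forall>e>0. \<forall>\<^sub>F n in sequentially. (\<integral>s. \<phi> s \<partial>M) \<bullet> (wavg lam (\<lambda>k. X k \<omega>) n - u) \<le> e)"
    unfolding AE_all_countable by (intro allI radius) simp
  then show ?thesis
  proof eventually_elim
    case (elim \<omega>)
    show ?case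
    proof
      assume "bounded (range (\<lambda>k. X k \<omega>))"
      then obtain B where B: "\<And>j. norm (X j \<omega>) \<le> B" by (auto simp: bounded_iff)
      have "norm (X j \<omega>) \<le> real (Suc (nat \<lceil>B\<rceil>))" for j
        using B[of j] by linarith
      with elim show "\<forall>e>0. \<forall>\<^sub>F n in sequentially. (\<integral>s. \<phi> s \<partial>M) \<bullet> (wavg lam (\<lambda>k. X k \<omega>) n - u) \<le> e"
        by blast
    qed
  qed
qed

text \<open>
  Each exceptional null set depends on a zero or on a pair of the graph; separability leaves
  countably many of them.
\<close>

lemma averages_converge:
  assumes T: "maximal_monotone (mean_operator M A)"
    and ne: "zer (mean_operator M A) \<noteq> {}"
    and L2: "zer (mean_operator M A) \<subseteq> zer_sel M A 2"
    and div: "filterlim (\<lambda>n. \<Sum>k=1..n. lam k) at_top sequentially"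
  shows "AE \<omega> in P. \<exists>z\<in>zer (mean_operator M A). weakly_converges (wavg lam (\<lambda>k. X k \<omega>)) z"
proof -
  let ?T = "mean_operator M A" and ?Z = "zer (mean_operator M A)"
  define G where "G = {(u, v). v \<in> ?T u}"
  obtain S where S: "countable S" "S \<subseteq> G" "G \<subseteq> closure S" using separable[of G] by metis
  obtain Z where Z: "countable Z" "Z \<subseteq> ?Z" "?Z \<subseteq> closure Z" using separable[of ?Z] by metis
  have fejer: "AE \<omega> in P. convergent (\<lambda>k. norm (X k \<omega> - z))" if "z \<in> ?Z" for z
  proof -
    have "z \<in> zer_sel M A 2" using L2 that by blast
    then obtain \<phi> where "\<phi> \<in> selections M A 2 z" "(\<integral>s. \<phi> s \<partial>M) = 0"
      unfolding zer_sel_def by blast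
    then show ?thesis by (intro AE_dist_zero_converges[of \<phi>]) (auto simp: selections_def)
  qed
  have "AE \<omega> in P. \<forall>z\<in>Z. convergent (\<lambda>k. norm (X k \<omega> - z))"
    using Z fejer by (subst AE_ball_countable) auto
  moreover have "AE \<omega> in P. \<forall>uv\<in>S. bounded (range (\<lambda>k. X k \<omega>)) \<longrightarrow>
    (\<forall>e>0. \<forall>\<^sub>F n in sequentially. snd uv \<bullet> (wavg lam (\<lambda>k. X k \<omega>) n - fst uv) \<le> e)"
    unfolding AE_ball_countable[OF S(1)]
  proof
    fix uv assume "uv \<in> S"
    then have "snd uv \<in> ?T (fst uv)" using S(2) by (auto simp: G_def)
    then obtain \<phi> where \<phi>: "\<phi> \<in> selections M A 1 (fst uv)" "snd uv = (\<integral>s. \<phi> s \<partial>M)"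
      by (auto simp: mean_operator_def)
    have m: "\<phi> \<in> borel_measurable M" "AE s in M. \<phi> s \<in> A s (fst uv)" "integrable M (\<lambda>s. norm (\<phi> s))"
      using \<phi>(1) by (auto simp: selections_def)
    have "integrable M \<phi>" using m(3) integrable_norm_iff[OF m(1)] by blast
    from test_pair_average[OF m(1,2) this div]
    show "AE \<omega> in P. bounded (range (\<lambda>k. X k \<omega>)) \<longrightarrow>
      (\<forall>e>0. \<forall>\<^sub>F n in sequentially. snd uv \<bullet> (wavg lam (\<lambda>k. X k \<omega>) n - fst uv) \<le> e)"
      unfolding \<phi>(2) .
  qed
  ultimately show ?thesis
  proof eventually_elim
    case (elim \<omega>)
    let ?x = "\<lambda>k. X k \<omega>"
    \<comment> \<open>\<open>norm (?x k - z)\<close> is \<open>1\<close>-Lipschitz in \<open>z\<close> uniformly in \<open>k\<close>, so convergence passes from \<open>Z\<close> to its closure\<close>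
    have conv: "convergent (\<lambda>k. norm (?x k - z))" if "z \<in> ?Z" for z
    proof -
      have "Cauchy (\<lambda>k. norm (?x k - z))"
      proof (rule metric_CauchyI)
        fix e :: real assume e: "e > 0"
        have "z \<in> closure Z" using that Z(3) by blast
        then obtain y where y: "y \<in> Z" "dist y z < e / 3"
          using e unfolding closure_approachable by (meson divide_pos_pos zero_less_numeral)
        have "convergent (\<lambda>k. norm (?x k - y))" using elim(1) y(1) by (rule bspec)
        then have "Cauchy (\<lambda>k. norm (?x k - y))" by (rule convergent_Cauchy)
        from metric_CauchyD[OF this, of "e / 3"] e
        obtain N where "\<forall>i\<ge>N. \<forall>j\<ge>N. dist (norm (?x i - y)) (norm (?x j - y)) < e / 3" by auto
        then have N: "dist (norm (?x i - y)) (norm (?x j - y)) < e / 3" if "i \<ge> N" "j \<ge> N" for i j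
          using that by blast
        have near: "\<bar>norm (?x i - z) - norm (?x i - y)\<bar> < e / 3" for i
          using norm_triangle_ineq3[of "?x i - z" "?x i - y"] y(2) by (simp add: dist_norm)
        have "dist (norm (?x i - z)) (norm (?x j - z)) < e" if "i \<ge> N" "j \<ge> N" for i j
          using N[OF that] near[of i] near[of j] unfolding dist_real_def by linarith
        then show "\<exists>N. \<forall>i\<ge>N. \<forall>j\<ge>N. dist (norm (?x i - z)) (norm (?x j - z)) < e" by blast
      qed
      then show ?thesis by (simp add: Cauchy_convergent_iff)
    qed
    obtain z where "z \<in> ?Z" using ne by blast
    from convergent_imp_Bseq[OF conv[OF this]] obtain B where B: "\<And>k. norm (?x k - z) \<le> B"
      by (auto simp: Bseq_def)
    have "norm (?x k) \<le> B + norm z" for k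
      using norm_triangle_ineq[of "?x k - z" z] B[of k] by simp
    then have "bounded (range ?x)" by (auto simp: bounded_iff)
    then have test: "\<forall>\<^sub>F n in sequentially. v \<bullet> (wavg lam ?x n - u) \<le> e" if "(u, v) \<in> S" "e > 0" for u v e
      using bspec[OF elim(2) that(1)] that(2) by simp
    show ?case
    proof (rule weak_limit_of_averages[OF T ne lam_pos div conv _ test])
      show "(u, v) \<in> closure S" if "v \<in> ?T u" for u v using that S(3) by (auto simp: G_def)
    qed
  qed
qed

end

theorem theorem3:
  fixes M :: "'s measure"
    and P :: "'w measure"
    and A :: "'s \<Rightarrow> 'h \<Rightarrow> 'h::{real_inner, banach, second_countable_topology} set"
    and \<xi> :: "nat \<Rightarrow> 'w \<Rightarrow> 's"
    and lam :: "nat \<Rightarrow> real"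
    and C :: "'s \<Rightarrow> real"
    and p :: nat
    and x0 :: 'h
  assumes "prob_space M" and "complete_measure M" and "prob_space P"
    and "AE s in M. maximal_monotone (A s)"
    and "\<And>l x. l > 0 \<Longrightarrow> (\<lambda>s. resolvent (A s) l x) \<in> borel_measurable M"
    and "\<And>n. lam n > 0"
    and "filterlim (\<lambda>n. \<Sum>k<n. lam k) at_top sequentially"
    and "summable (\<lambda>n. (lam n)\<^sup>2)"
    and "prob_space.indep_vars P (\<lambda>_. M) \<xi> {1..}"
    and "\<And>n. n \<ge> 1 \<Longrightarrow> distr P M (\<xi> n) = M"
    and "maximal_monotone (mean_operator M A)"
    and "zer (mean_operator M A) \<noteq> {}"
    and "zer (mean_operator M A) \<subseteq> zer_sel M A 2"
    and "\<And>K. bounded K \<Longrightarrow>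
           uniformly_integrable M (K \<inter> ess_dom M A) (\<lambda>x s. norm (least_norm_elem (A s) x))"
    and "\<And>R. (R::real) > 0 \<Longrightarrow>
           \<exists>\<kappa>>0. \<forall>x. norm x \<le> R \<longrightarrow>
             (\<integral>\<^sup>+s. (dist_set x (op_dom (A s)))\<^sup>2 \<partial>M) \<ge> ennreal \<kappa> * (dist_set x (ess_dom M A))\<^sup>2"
    and "p \<ge> 1"
    and "C \<in> borel_measurable M"
    and "\<And>s. s \<in> space M \<Longrightarrow> C s \<ge> 0"
    and "integrable M (\<lambda>s. (C s)\<^sup>2)"
    and "\<And>x l. l > 0 \<Longrightarrow>
           AE s in M. norm (resolvent (A s) l x - proj (closure (op_dom (A s))) x)
                        \<le> l * C s * (1 + norm x ^ p)"
    and "zer_sel M A (2 * p) \<noteq> {}"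
    and "(\<lambda>n. lam n / lam (Suc n)) \<longlonglongrightarrow> 1"
  shows "AE \<omega> in P. \<exists>z\<in>zer (mean_operator M A).
           weakly_converges (\<lambda>n. prox_avg A lam \<xi> x0 n \<omega>) z"
proof -
  interpret P: prob_space P by fact
  interpret M: prob_space M by fact
  define F where "F k = vimage_algebra (space P) (\<lambda>\<omega>. \<lambda>i\<in>{1..k}. \<xi> i \<omega>) (PiM {1..k} (\<lambda>_. M))" for k
  have inn: "innovation P M F \<xi>"
    unfolding F_def[abs_def] by (rule P.iid_innovation) fact+
  obtain N where N: "{s\<in>space M. \<not> maximal_monotone (A s)} \<subseteq> N" "N \<in> null_sets M"
    using assms(4) by (auto elim: AE_E simp: null_sets_def)
  define good where "good s \<longleftrightarrow> s \<in> space M \<and> s \<notin> N" for s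
  \<comment> \<open>on the null set \<open>N\<close> the zero operator takes the place of \<open>A s\<close>\<close>
  define A' where "A' s = (if good s then A s else (\<lambda>_. {0}))" for s
  have mm: "maximal_monotone (A' s)" for s
    using N(1) maximal_monotone_zero by (auto simp: A'_def good_def)
  have good: "AE s in M. good s"
    using AE_not_in[OF N(2)] AE_space by eventually_elim (simp add: good_def)
  have eq: "AE s in M. A' s = A s"
    using good by eventually_elim (simp add: A'_def)
  have res0: "resolvent (\<lambda>_. {0}) l x = x" if "l > 0" for l and x :: 'h
    using resolvent_inclusion[OF maximal_monotone_zero that, of x] that by simp
  have J: "(\<lambda>s. resolvent (A' s) l x) \<in> borel_measurable M" if "l > 0" for l x
  proof -
    have "(\<lambda>s. if s \<in> N then x else resolvent (A s) l x) \<in> borel_measurable M"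
      by (rule measurable_If_set[OF measurable_const assms(5)[OF that]]) (use N(2) in auto)
    moreover have "resolvent (A' s) l x = (if s \<in> N then x else resolvent (A s) l x)" if "s \<in> space M" for s
      using that res0[OF \<open>l > 0\<close>] by (simp add: A'_def good_def)
    ultimately show ?thesis by (subst measurable_cong) auto
  qed
  have sel: "selections M A' q x = selections M A q x" for q x
  proof -
    have "(AE s in M. \<phi> s \<in> A' s x) \<longleftrightarrow> (AE s in M. \<phi> s \<in> A s x)" for \<phi> :: "'s \<Rightarrow> 'h"
    proof
      show "AE s in M. \<phi> s \<in> A s x" if "AE s in M. \<phi> s \<in> A' s x"
        using that eq by eventually_elim simp
      show "AE s in M. \<phi> s \<in> A' s x" if "AE s in M. \<phi> s \<in> A s x"
        using that eq by eventually_elim simp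
    qed
    then show ?thesis by (simp add: selections_def)
  qed
  have mean: "mean_operator M A' = mean_operator M A" by (simp add: mean_operator_def sel fun_eq_iff)
  have zs: "zer_sel M A' 2 = zer_sel M A 2" by (simp add: zer_sel_def sel)
  have ne: "ess_dom M A \<noteq> {}"
  proof -
    obtain z where "z \<in> zer_sel M A 2" using assms(12,13) by blast
    then obtain \<phi> where "AE s in M. \<phi> s \<in> A s z" by (auto simp: zer_sel_def selections_def)
    then have "AE s in M. z \<in> op_dom (A s)" by eventually_elim (auto simp: op_dom_def)
    then show ?thesis by (auto simp: ess_dom_def)
  qed
  interpret prox_domain P M F \<xi> A' lam x0 "ess_dom M A" C p
  proof (intro prox_domain.intro prox_walk.intro inn prox_walk_axioms.intro prox_domain_axioms.intro mm J)
    show "AE s in M. y \<in> op_dom (A' s)" if "y \<in> ess_dom M A" for y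
    proof -
      have "AE s in M. y \<in> op_dom (A s)" using that by (simp add: ess_dom_def)
      with eq show ?thesis by eventually_elim simp
    qed
    show "AE s in M. norm (resolvent (A' s) l x - proj (closure (op_dom (A' s))) x) \<le> l * C s * (1 + norm x ^ p)"
      if "l > 0" for x l
      using assms(20)[OF that, of x] eq by eventually_elim simp
    have "(\<integral>\<^sup>+s. (dist_set x (op_dom (A' s)))\<^sup>2 \<partial>M) = (\<integral>\<^sup>+s. (dist_set x (op_dom (A s)))\<^sup>2 \<partial>M)" for x
      by (rule nn_integral_cong_AE) (use eq in \<open>eventually_elim, simp\<close>)
    then show "\<exists>\<kappa>>0. \<forall>x. norm x \<le> R \<longrightarrow>
             (\<integral>\<^sup>+s. (dist_set x (op_dom (A' s)))\<^sup>2 \<partial>M) \<ge> ennreal \<kappa> * (dist_set x (ess_dom M A))\<^sup>2" if "R > 0" for R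
      using assms(15)[OF that] by simp
  qed (use assms ne in auto)
  have div: "filterlim (\<lambda>n. \<Sum>k=1..n. lam k) at_top sequentially"
  proof -
    have "filterlim (\<lambda>n. - lam 0 + (\<Sum>k<Suc n. lam k)) at_top sequentially"
      using filterlim_compose[OF assms(7) filterlim_Suc]
      by (intro filterlim_tendsto_add_at_top[OF tendsto_const])
    moreover have "- lam 0 + (\<Sum>k<Suc n. lam k) = (\<Sum>k=1..n. lam k)" for n
      unfolding sum_lessThan_Suc_split_first by simp
    ultimately show ?thesis by simp
  qed
  have "AE \<omega> in P. \<forall>k. good (\<xi> (Suc k) \<omega>)"
    unfolding AE_all_countable using AE_innov_noise[OF good] by blast
  moreover have "AE \<omega> in P. \<exists>z\<in>zer (mean_operator M A'). weakly_converges (wavg lam (\<lambda>k. X k \<omega>)) z"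
    using assms(11,12,13) div by (intro averages_converge) (simp_all add: mean zs)
  ultimately show ?thesis
  proof eventually_elim
    case (elim \<omega>)
    have "X k \<omega> = prox_iter A lam \<xi> x0 k \<omega>" for k
      by (induction k) (use elim(1) in \<open>simp_all add: A'_def\<close>)
    then have "wavg lam (\<lambda>k. X k \<omega>) = (\<lambda>n. prox_avg A lam \<xi> x0 n \<omega>)"
      by (simp add: wavg_def prox_avg_def fun_eq_iff)
    with elim(2) show ?case by (simp add: mean)
  qed
qed

end
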